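(* Let $n\geq 2$ be an integer. There exists an embedding (injective group homomorphism) of $\mathfrak G_n/\mathfrak{IG}_n$ into $\mathrm{Aut}(\Sigma_n)/\langle\sigma\rangle$. If $n$ is prime, then these two groups are isomorphic.
   Context: Let $n\ge 2$. $\mathcal O_n$ is the Cuntz algebra, the $C^*$-algebra generated by isometries $S_1,\dots,S_n$ with $\sum_{i=1}^n S_iS_i^*=1$. For $k\ge 0$, $W_n^k$ is the set of words $\mu=(\mu_1,\dots,\mu_k)$ with letters in $\{1,\dots,n\}$, $S_\mu=S_{\mu_1}\cdots S_{\mu_k}$ (and $S_\emptyset=1$), $P_\mu=S_\mu S_\mu^*$. $\mathcal D_n$ (the diagonal) is the $C^*$-subalgebra generated by all $P_\mu$, and $\mathcal D_n^k=\mathrm{span}\{P_\mu:\mu\in W_n^k\}$. $\mathcal P_n=\bigcup_k\mathcal P_n^k$, where $\mathcal P_n^k$ is the set of unitaries $\sum_{\mu\in W_n^k}S_{\sigma(\mu)}S_\mu^*$ with $\sigma$ a permutation of $W_n^k$. The canonical shift is $\varphi(x)=\sum_{i=1}^n S_ixS_i^*$; it restricts to an endomorphism of $\mathcal D_n$ (with $\varphi^0=\mathrm{id}$). An automorphism $\alpha$ of $\mathcal D_n$ has property (P) if there is an integer $m\ge 0$ such that $\alpha\varphi^k(x)=\varphi^{k-m}\alpha\varphi^m(x)$ for all $k\ge m$ and all $x\in\mathcal D_n^1$. $\mathfrak G_n$ is the group of all $\alpha\in\mathrm{Aut}(\mathcal D_n)$ such that both $\alpha$ and $\alpha^{-1}$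 have property (P). $\mathfrak{IG}_n=\{\mathrm{Ad}(u)|_{\mathcal D_n}:u\in\mathcal P_n\}$, where $\mathrm{Ad}(u)(x)=uxu^*$; it is a normal subgroup of $\mathfrak G_n$. $\Sigma_n=\{1,\dots,n\}^{\mathbb Z}$ is the full two-sided $n$-shift (product topology), $\sigma$ is the two-sided shift homeomorphism of $\Sigma_n$, $\mathrm{Aut}(\Sigma_n)$ is the group of homeomorphisms of $\Sigma_n$ commuting with $\sigma$, and $\langle\sigma\rangle$ is its subgroup generated by $\sigma$ (which is central). *)

theory Defs
  imports
    "HOL-Analysis.Analysis"
    "HOL-Algebra.Bij"
    "HOL-Algebra.Coset"
    "HOL-Algebra.Generated_Groups"
    "HOL-Computational_Algebra.Primes"
begin

section \<open>Unital $C^*$-algebras\<close>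

text \<open>
  The distribution has no complex normed spaces.  The class below is that of nonzero unital
  complex $C^*$-algebras, built on the real Banach algebra structure.
\<close>

class cstar_algebra = real_normed_algebra_1 + banach +
  fixes scaleC :: "complex \<Rightarrow> 'a \<Rightarrow> 'a" (infixr \<open>*C\<close> 75)
    and adj :: "'a \<Rightarrow> 'a"
  assumes scaleC_add_right: "a *C (x + y) = a *C x + a *C y"
    and scaleC_add_left: "(a + b) *C x = a *C x + b *C x"
    and scaleC_scaleC: "a *C (b *C x) = (a * b) *C x"
    and scaleC_of_real: "complex_of_real r *C x = r *\<^sub>R x"
    and norm_scaleC: "norm (a *C x) = cmod a * norm x"
    and mult_scaleC_left: "(a *C x) * y = a *C (x * y)"
    and mult_scaleC_right: "x * (a *C y) = a *C (x * y)"
    and adj_add: "adj (x + y) = adj x + adj y"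
    and adj_scaleC: "adj (a *C x) = cnj a *C adj x"
    and adj_mult: "adj (x * y) = adj y * adj x"
    and adj_adj: "adj (adj x) = x"
    and cstar_identity: "norm (adj x * x) = (norm x)\<^sup>2"

global_interpretation complex_vector: vector_space "scaleC :: complex \<Rightarrow> 'a \<Rightarrow> 'a::cstar_algebra"
proof
  fix x :: 'a
  have "complex_of_real 1 *C x = 1 *\<^sub>R x" by (rule scaleC_of_real)
  then show "1 *C x = x" by simp
qed (simp_all add: scaleC_add_right scaleC_add_left scaleC_scaleC)

definition cstar_subalgebra :: "'a::cstar_algebra set \<Rightarrow> bool" where
  "cstar_subalgebra B \<longleftrightarrow>
     complex_vector.subspace B \<and> (\<forall>x\<in>B. \<forall>y\<in>B. x * y \<in> B) \<and> (\<forall>x\<in>B. adj x \<in> B) \<and> closed B"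

definition cstar_generated :: "'a::cstar_algebra set \<Rightarrow> 'a set" where
  "cstar_generated X = \<Inter> {B. cstar_subalgebra B \<and> X \<subseteq> B}"

definition cstar_automorphism :: "'a::cstar_algebra set \<Rightarrow> ('a \<Rightarrow> 'a) \<Rightarrow> bool" where
  "cstar_automorphism B \<alpha> \<longleftrightarrow>
     bij_betw \<alpha> B B \<and>
     (\<forall>x\<in>B. \<forall>y\<in>B. \<alpha> (x + y) = \<alpha> x + \<alpha> y) \<and>
     (\<forall>c. \<forall>x\<in>B. \<alpha> (c *C x) = c *C \<alpha> x) \<and>
     (\<forall>x\<in>B. \<forall>y\<in>B. \<alpha> (x * y) = \<alpha> x * \<alpha> y) \<and>
     (\<forall>x\<in>B. \<alpha> (adj x) = adj (\<alpha> x))"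


section \<open>The Cuntz algebra and its diagonal\<close>

text \<open>
  The type \<open>'a\<close> itself is the Cuntz algebra; by Cuntz's uniqueness theorem
  all realisations are isomorphic.
  Only the values \<open>S 1, \<dots>, S n\<close> matter.
\<close>

definition is_cuntz_algebra :: "nat \<Rightarrow> (nat \<Rightarrow> 'a::cstar_algebra) \<Rightarrow> bool" where
  "is_cuntz_algebra n S \<longleftrightarrow>
     (\<forall>i\<in>{1..n}. adj (S i) * S i = 1) \<and>
     (\<Sum>i=1..n. S i * adj (S i)) = 1 \<and>
     cstar_generated (S ` {1..n}) = UNIV"

definition words :: "nat \<Rightarrow> nat \<Rightarrow> nat list set" where
  "words n k = {\<mu>. length \<mu> = k \<and> set \<mu> \<subseteq> {1..n}}"

definition word_isometry :: "(nat \<Rightarrow> 'a::cstar_algebra) \<Rightarrow> nat list \<Rightarrow> 'a" where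
  "word_isometry S \<mu> = prod_list (map S \<mu>)"

definition word_proj :: "(nat \<Rightarrow> 'a::cstar_algebra) \<Rightarrow> nat list \<Rightarrow> 'a" where
  "word_proj S \<mu> = word_isometry S \<mu> * adj (word_isometry S \<mu>)"

definition diagonal :: "nat \<Rightarrow> (nat \<Rightarrow> 'a::cstar_algebra) \<Rightarrow> 'a set" where
  "diagonal n S = cstar_generated (\<Union>k. word_proj S ` words n k)"

definition diagonal_level :: "nat \<Rightarrow> (nat \<Rightarrow> 'a::cstar_algebra) \<Rightarrow> nat \<Rightarrow> 'a set" where
  "diagonal_level n S k = complex_vector.span (word_proj S ` words n k)"

definition perm_unitaries :: "nat \<Rightarrow> (nat \<Rightarrow> 'a::cstar_algebra) \<Rightarrow> 'a set" where
  "perm_unitaries n S =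
     (\<Union>k. {\<Sum>\<mu>\<in>words n k. word_isometry S (\<pi> \<mu>) * adj (word_isometry S \<mu>) | \<pi>.
             bij_betw \<pi> (words n k) (words n k)})"

definition canonical_shift :: "nat \<Rightarrow> (nat \<Rightarrow> 'a::cstar_algebra) \<Rightarrow> 'a \<Rightarrow> 'a" where
  "canonical_shift n S x = (\<Sum>i=1..n. S i * x * adj (S i))"

definition property_P :: "nat \<Rightarrow> (nat \<Rightarrow> 'a::cstar_algebra) \<Rightarrow> ('a \<Rightarrow> 'a) \<Rightarrow> bool" where
  "property_P n S \<alpha> \<longleftrightarrow>
     (\<exists>m. \<forall>k\<ge>m. \<forall>x\<in>diagonal_level n S 1.
        \<alpha> ((canonical_shift n S ^^ k) x) =
        (canonical_shift n S ^^ (k - m)) (\<alpha> ((canonical_shift n S ^^ m) x)))"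

text \<open>
  As in \<^const>\<open>BijGroup\<close>, maps on a set are represented by extensional functions, so that
  equality in the groups below is equality of maps; multiplication is composition.
\<close>

definition G_group :: "nat \<Rightarrow> (nat \<Rightarrow> 'a::cstar_algebra) \<Rightarrow> ('a \<Rightarrow> 'a) monoid" where
  "G_group n S = (BijGroup (diagonal n S))
     \<lparr>carrier := {\<alpha> \<in> Bij (diagonal n S). cstar_automorphism (diagonal n S) \<alpha> \<and>
        property_P n S \<alpha> \<and> property_P n S (inv_into (diagonal n S) \<alpha>)}\<rparr>"

definition IG_subgroup :: "nat \<Rightarrow> (nat \<Rightarrow> 'a::cstar_algebra) \<Rightarrow> ('a \<Rightarrow> 'a) set" where
  "IG_subgroup n S = {restrict (\<lambda>x. u * x * adj u) (diagonal n S) | u. u \<in> perm_unitaries n S}"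


section \<open>The full two-sided shift\<close>

definition full_shift :: "nat \<Rightarrow> (int \<Rightarrow> nat) topology" where
  "full_shift n = product_topology (\<lambda>_. discrete_topology {1..n}) UNIV"

definition shift_map :: "nat \<Rightarrow> (int \<Rightarrow> nat) \<Rightarrow> (int \<Rightarrow> nat)" where
  "shift_map n = restrict (\<lambda>x i. x (i + 1)) (topspace (full_shift n))"

definition shift_Aut :: "nat \<Rightarrow> ((int \<Rightarrow> nat) \<Rightarrow> (int \<Rightarrow> nat)) monoid" where
  "shift_Aut n = (BijGroup (topspace (full_shift n)))
     \<lparr>carrier := {f \<in> Bij (topspace (full_shift n)).
        homeomorphic_map (full_shift n) (full_shift n) f \<and>
        (\<forall>x\<in>topspace (full_shift n). f (shift_map n x) = shift_map n (f x))}\<rparr>"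

end

(*
  The diagonal D_n is C(X) for X the space of one-sided infinite words, so an automorphism of D_n
  is a homeomorphism f of X.  Since the canonical shift acts as composition with the one-sided
  shift s, property (P) for both the automorphism and its inverse says that f and its inverse
  eventually commute with s: for some m, s^m f s = s^(m+1) f, and similarly for the inverse.
  Far to the right f is then a sliding block code, and this code defines an automorphism "bar f"
  of the two-sided shift.  The map f |-> bar f is a homomorphism; bar f is the identity exactly
  when f permutes prefixes of a fixed length, that is, when the automorphism is Ad(u) with u in
  P_n; and bar f is a power of the shift only for the exponent 0, by counting preimages.

  Conversely, after composing with a power of the shift, an automorphism of the two-sided shift and
  its inverse induce one-sided codes g and h with g h = h g = s^a.  All fibres of g have the same
  cardinality, a divisor of n^a; for n prime it is a power n^m, and labelling each fibre by the
  words of length m turns g into a homeomorphism f with s^m f = g.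
*)

theory Submission
  imports Defs "HOL-Library.Omega_Words_Fun"
begin


section \<open>Infinite words and eventually shift-commuting homeomorphisms\<close>

text \<open>The identification of \<open>diagonal n S\<close> with C(X) is built from the C*-axioms
  and the Cuntz relations alone, without positivity or spectral theory. Orthogonality of the ranges
  of the \<open>S i\<close> is not part of \<open>is_cuntz_algebra\<close>: it is extracted from the
  range projections summing to 1, and the substitute for positivity is that 1 is an extreme point of
  the unit ball. Finite sums of the projections \<open>P \<mu>\<close> then get the supremum norm of
  their coefficients, limits give C(X), and a character is located at the one branch of words whose
  projections it does not kill. On the dynamical side, nothing controls the first m output letters
  of f. Hence \<open>bar f\<close> takes coordinate i from letter m of f applied to the tail that
  starts m places before i; what is lost are prefixes of bounded length, which is why the kernel is
  inner. Undoing the loss means inserting m letters that tell the points of a fibre apart,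
  continuously and with the same number n^m of points in every fibre. That count is where primality
  helps: 2 divides 4, yet is not the number of words of any length over four letters.\<close>

definition iwords :: "nat \<Rightarrow> nat word set" where
  "iwords n = {\<omega>. range \<omega> \<subseteq> {1..n}}"

lemma prefix_eq_iff: "prefix m \<omega> = prefix m \<eta> \<longleftrightarrow> (\<forall>i<m. \<omega> i = \<eta> i)"
  by (auto simp: subsequence_def)

lemma prefix_eq_mono: "prefix m \<omega> = prefix m \<eta> \<Longrightarrow> k \<le> m \<Longrightarrow> prefix k \<omega> = prefix k \<eta>"
  by (simp add: prefix_eq_iff)

lemma suffix_conc_length [simp]: "length \<mu> = k \<Longrightarrow> suffix k (\<mu> \<frown> \<omega>) = \<omega>"
  by (auto simp: fun_eq_iff)

lemma prefix_conc_length: "length \<mu> = k \<Longrightarrow> prefix k (\<mu> \<frown> \<omega>) = \<mu>"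
  by (auto simp: subsequence_def intro: nth_equalityI)

lemma finite_words [simp, intro]: "finite (words n k)"
  unfolding words_def using finite_lists_length_eq[of "{1..n}" k] by (simp add: conj_commute)

lemma card_words: "card (words n k) = n ^ k"
  unfolding words_def using card_lists_length_eq[of "{1..n}" k] by (simp add: conj_commute)

lemma words_length: "\<mu> \<in> words n k \<Longrightarrow> length \<mu> = k"
  by (simp add: words_def)

lemma iwords_conc: "\<mu> \<in> words n k \<Longrightarrow> \<omega> \<in> iwords n \<Longrightarrow> \<mu> \<frown> \<omega> \<in> iwords n"
  by (simp add: iwords_def words_def)

lemma iwords_suffix: "\<omega> \<in> iwords n \<Longrightarrow> suffix k \<omega> \<in> iwords n"
  by (auto simp: iwords_def)

lemma words_prefix: "\<omega> \<in> iwords n \<Longrightarrow> prefix k \<omega> \<in> words n k"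
  by (auto simp: iwords_def words_def)

text \<open>Any word of length k may precede a given tail, so the k-th power of the one-sided shift
  is n^k-to-one. Every later count of fibres rests on this.\<close>

lemma bij_betw_conc_suffix_fibre:
  assumes "\<eta> \<in> iwords n"
  shows "bij_betw (\<lambda>\<mu>. \<mu> \<frown> \<eta>) (words n k) {\<omega> \<in> iwords n. suffix k \<omega> = \<eta>}"
proof (rule bij_betw_byWitness[where f' = "prefix k"])
  show "\<forall>\<mu>\<in>words n k. prefix k (\<mu> \<frown> \<eta>) = \<mu>"
    by (simp add: prefix_conc_length words_length)
  show "\<forall>\<omega>\<in>{\<omega> \<in> iwords n. suffix k \<omega> = \<eta>}. prefix k \<omega> \<frown> \<eta> = \<omega>"
    by auto
  show "(\<lambda>\<mu>. \<mu> \<frown> \<eta>) ` words n k \<subseteq> {\<omega> \<in> iwords n. suffix k \<omega> = \<eta>}"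
    using assms by (auto simp: iwords_conc words_length)
  show "prefix k ` {\<omega> \<in> iwords n. suffix k \<omega> = \<eta>} \<subseteq> words n k"
    by (auto simp: words_prefix)
qed

lemma suffix_fibre:
  assumes "\<eta> \<in> iwords n"
  shows "finite {\<omega> \<in> iwords n. suffix k \<omega> = \<eta>}" and "card {\<omega> \<in> iwords n. suffix k \<omega> = \<eta>} = n ^ k"
  using bij_betw_finite[OF bij_betw_conc_suffix_fibre[OF assms]]
    bij_betw_same_card[OF bij_betw_conc_suffix_fibre[OF assms, of k]]
  by (auto simp: card_words)

locale alphabet =
  fixes n :: nat
  assumes n_ge_2: "n \<ge> 2"
begin

abbreviation X where "X \<equiv> iwords n"
abbreviation W where "W \<equiv> words n"

definition ones :: "nat word" where "ones = (\<lambda>_. 1)"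

lemma ones_in: "ones \<in> X"
  using n_ge_2 by (auto simp: ones_def iwords_def)

text \<open>Since X is compact, this uniform condition is ordinary continuity: each finite part of
  the output depends on a finite part of the input, of a length that is the same for all
  words.\<close>

definition word_cont :: "(nat word \<Rightarrow> nat word) \<Rightarrow> bool" where
  "word_cont f \<longleftrightarrow> (\<forall>k. \<exists>m. \<forall>\<omega>\<in>X. \<forall>\<eta>\<in>X. prefix m \<omega> = prefix m \<eta> \<longrightarrow> prefix k (f \<omega>) = prefix k (f \<eta>))"

lemma word_contD:
  assumes "word_cont f"
  obtains m where "m \<ge> l" "\<And>\<omega> \<eta>. \<omega> \<in> X \<Longrightarrow> \<eta> \<in> X \<Longrightarrow> prefix m \<omega> = prefix m \<eta> \<Longrightarrow> prefix k (f \<omega>) = prefix k (f \<eta>)"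
proof -
  obtain m where m: "\<forall>\<omega>\<in>X. \<forall>\<eta>\<in>X. prefix m \<omega> = prefix m \<eta> \<longrightarrow> prefix k (f \<omega>) = prefix k (f \<eta>)"
    using assms unfolding word_cont_def by blast
  show ?thesis
  proof (rule that[of "max l m"])
    fix \<omega> \<eta> :: "nat word"
    assume "\<omega> \<in> X" "\<eta> \<in> X" "prefix (max l m) \<omega> = prefix (max l m) \<eta>"
    then show "prefix k (f \<omega>) = prefix k (f \<eta>)"
      using m prefix_eq_mono[of \<omega> "max l m" \<eta> m] by (meson max.cobounded2)
  qed simp
qed

lemma word_cont_comp:
  assumes f: "word_cont f" and g: "word_cont g" and gX: "g ` X \<subseteq> X"
  shows "word_cont (f \<circ> g)"
  unfolding word_cont_def
proof
  fix k
  obtain l where l: "\<And>\<omega> \<eta>. \<omega> \<in> X \<Longrightarrow> \<eta> \<in> X \<Longrightarrow> prefix l \<omega> = prefix l \<eta> \<Longrightarrow> prefix k (f \<omega>) = prefix k (f \<eta>)"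
    using word_contD[OF f] by metis
  obtain m where m: "\<And>\<omega> \<eta>. \<omega> \<in> X \<Longrightarrow> \<eta> \<in> X \<Longrightarrow> prefix m \<omega> = prefix m \<eta> \<Longrightarrow> prefix l (g \<omega>) = prefix l (g \<eta>)"
    using word_contD[OF g] by metis
  show "\<exists>m. \<forall>\<omega>\<in>X. \<forall>\<eta>\<in>X. prefix m \<omega> = prefix m \<eta> \<longrightarrow> prefix k ((f \<circ> g) \<omega>) = prefix k ((f \<circ> g) \<eta>)"
    using l m gX unfolding o_apply image_subset_iff by (intro exI[of _ m]) blast
qed

lemma word_cont_cong: "word_cont f \<Longrightarrow> (\<And>\<omega>. \<omega> \<in> X \<Longrightarrow> f \<omega> = g \<omega>) \<Longrightarrow> word_cont g"
  unfolding word_cont_def by metis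

definition commutes_from :: "nat \<Rightarrow> (nat word \<Rightarrow> nat word) \<Rightarrow> bool" where
  "commutes_from m f \<longleftrightarrow> (\<forall>\<omega>\<in>X. suffix m (f (suffix 1 \<omega>)) = suffix (Suc m) (f \<omega>))"

lemma commutes_fromD:
  assumes "commutes_from m f" "\<omega> \<in> X"
  shows "suffix m (f (suffix k \<omega>)) = suffix (m + k) (f \<omega>)"
  using assms(2)
proof (induction k arbitrary: \<omega>)
  case (Suc k)
  have "suffix m (f (suffix (Suc k) \<omega>)) = suffix m (f (suffix 1 (suffix k \<omega>)))"
    by simp
  also have "\<dots> = suffix (Suc m) (f (suffix k \<omega>))"
    using assms(1) iwords_suffix[OF Suc.prems] unfolding commutes_from_def by blast
  also have "\<dots> = suffix 1 (suffix m (f (suffix k \<omega>)))"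
    by simp
  also have "\<dots> = suffix (m + Suc k) (f \<omega>)"
    by (subst Suc.IH[OF Suc.prems]) simp
  finally show ?case .
qed simp

text \<open>Delays add: g is controlled only after m letters, so f has to be applied to that tail,
  and f then loses l letters of its own.\<close>

lemma commutes_from_comp:
  assumes f: "commutes_from l f" and g: "commutes_from m g" and gX: "g ` X \<subseteq> X"
  shows "commutes_from (l + m) (f \<circ> g)"
  unfolding commutes_from_def
proof
  fix \<omega> assume w: "\<omega> \<in> X"
  have gw: "g \<omega> \<in> X" "g (suffix 1 \<omega>) \<in> X"
    using w gX iwords_suffix by blast+
  have "suffix (l + m) (f (g (suffix 1 \<omega>))) = suffix l (f (suffix m (g (suffix 1 \<omega>))))"
    by (subst commutes_fromD[OF f gw(2)]) simp
  also have "suffix m (g (suffix 1 \<omega>)) = suffix (m + 1) (g \<omega>)"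
    by (rule commutes_fromD[OF g w])
  also have "suffix l (f (suffix (m + 1) (g \<omega>))) = suffix (l + (m + 1)) (f (g \<omega>))"
    by (rule commutes_fromD[OF f gw(1)])
  finally show "suffix (l + m) ((f \<circ> g) (suffix 1 \<omega>)) = suffix (Suc (l + m)) ((f \<circ> g) \<omega>)"
    by (simp only: o_apply add_Suc_right add_0_right One_nat_def)
qed

lemma commutes_from_cong:
  "commutes_from m f \<Longrightarrow> (\<And>\<omega>. \<omega> \<in> X \<Longrightarrow> f \<omega> = g \<omega>) \<Longrightarrow> commutes_from m g"
  unfolding commutes_from_def using iwords_suffix by metis

text \<open>These are the point maps of the elements of \<open>G_group n S\<close>; the link is made
  in \<open>G_carrier_iff\<close>.\<close>

definition G_homeos :: "(nat word \<Rightarrow> nat word) set" where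
  "G_homeos = {f. bij_betw f X X \<and> word_cont f \<and> word_cont (inv_into X f) \<and>
     (\<exists>m. commutes_from m f) \<and> (\<exists>m. commutes_from m (inv_into X f))}"

text \<open>Any inverse on X serves as \<open>f'\<close>: it agrees there with
  \<open>inv_into X f\<close>, and continuity and delay look only at values on X.\<close>

lemma G_homeosI:
  assumes "f ` X \<subseteq> X" "f' ` X \<subseteq> X" "\<And>\<omega>. \<omega> \<in> X \<Longrightarrow> f' (f \<omega>) = \<omega>" "\<And>\<omega>. \<omega> \<in> X \<Longrightarrow> f (f' \<omega>) = \<omega>"
    and "word_cont f" "word_cont f'" "commutes_from m f" "commutes_from m' f'"
  shows "f \<in> G_homeos"
proof -
  have bij: "bij_betw f X X"
    by (rule bij_betw_byWitness[where f' = f']) (use assms(1-4) in auto)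
  have eq: "f' \<omega> = inv_into X f \<omega>" if "\<omega> \<in> X" for \<omega>
    using bij assms(2,4) that by (intro inv_into_f_eq[symmetric]) (auto simp: bij_betw_def)
  have "word_cont (inv_into X f)" using assms(6) eq by (rule word_cont_cong)
  moreover have "commutes_from m' (inv_into X f)" using assms(8) eq by (rule commutes_from_cong)
  ultimately show ?thesis
    using bij assms(5,7) unfolding G_homeos_def by blast
qed

lemma G_homeos_image: "f \<in> G_homeos \<Longrightarrow> f ` X = X"
  by (simp add: G_homeos_def bij_betw_def)

lemma G_homeos_in: "f \<in> G_homeos \<Longrightarrow> \<omega> \<in> X \<Longrightarrow> f \<omega> \<in> X"
  using G_homeos_image by blast

lemma G_homeos_inv:
  assumes "f \<in> G_homeos" shows "inv_into X f \<in> G_homeos"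
proof -
  have b: "bij_betw f X X" using assms by (simp add: G_homeos_def)
  obtain m m' where "commutes_from m f" "commutes_from m' (inv_into X f)"
    using assms by (auto simp: G_homeos_def)
  then show ?thesis
    using assms b bij_betw_inv_into[OF b] bij_betw_inv_into_left[OF b] bij_betw_inv_into_right[OF b]
    by (intro G_homeosI[of _ f m' m]) (auto simp: G_homeos_def bij_betw_def)
qed

lemma G_homeos_comp:
  assumes "f \<in> G_homeos" "g \<in> G_homeos" shows "f \<circ> g \<in> G_homeos"
proof -
  note fX = G_homeos_image[OF assms(1)] G_homeos_image[OF assms(2)]
    G_homeos_image[OF G_homeos_inv[OF assms(1)]] G_homeos_image[OF G_homeos_inv[OF assms(2)]]
  have b: "bij_betw f X X" "bij_betw g X X" using assms by (simp_all add: G_homeos_def)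
  obtain m m' l l' where c: "commutes_from m f" "commutes_from m' (inv_into X f)"
    "commutes_from l g" "commutes_from l' (inv_into X g)"
    using assms by (auto simp: G_homeos_def)
  show ?thesis
  proof (rule G_homeosI)
    show "(f \<circ> g) ` X \<subseteq> X" "(inv_into X g \<circ> inv_into X f) ` X \<subseteq> X"
      by (simp_all only: image_comp[symmetric] fX order_refl)
    show "(inv_into X g \<circ> inv_into X f) ((f \<circ> g) \<omega>) = \<omega>" if "\<omega> \<in> X" for \<omega>
      using that by (simp add: bij_betw_inv_into_left[OF b(1)] bij_betw_inv_into_left[OF b(2)] G_homeos_in assms)
    show "(f \<circ> g) ((inv_into X g \<circ> inv_into X f) \<omega>) = \<omega>" if "\<omega> \<in> X" for \<omega>
      using that by (simp add: bij_betw_inv_into_right[OF b(1)] bij_betw_inv_into_right[OF b(2)]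
          G_homeos_in G_homeos_inv assms)
    show "word_cont (f \<circ> g)" "word_cont (inv_into X g \<circ> inv_into X f)"
      using assms fX by (auto intro!: word_cont_comp simp: G_homeos_def)
    show "commutes_from (m + l) (f \<circ> g)" "commutes_from (l' + m') (inv_into X g \<circ> inv_into X f)"
      using c fX by (auto intro!: commutes_from_comp)
  qed
qed

end

section \<open>Sliding block codes on the two-sided shift\<close>

definition tail :: "int \<Rightarrow> (int \<Rightarrow> nat) \<Rightarrow> nat word" where
  "tail a x = (\<lambda>j. x (a + int j))"

definition zshift :: "int \<Rightarrow> (int \<Rightarrow> nat) \<Rightarrow> (int \<Rightarrow> nat)" where
  "zshift j x = (\<lambda>i. x (i + j))"

text \<open>The past is filled with the letter 1 arbitrarily; only nonnegative coordinates are ever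
  read off through \<open>tail_lift\<close>.\<close>

definition lift :: "nat word \<Rightarrow> (int \<Rightarrow> nat)" where
  "lift \<omega> = (\<lambda>i. if i < 0 then 1 else \<omega> (nat i))"

abbreviation Sig :: "nat \<Rightarrow> (int \<Rightarrow> nat) set" where
  "Sig n \<equiv> topspace (full_shift n)"

lemma Sig_iff: "x \<in> Sig n \<longleftrightarrow> (\<forall>i. x i \<in> {1..n})"
  by (auto simp: full_shift_def PiE_iff)

lemma suffix_tail [simp]: "suffix k (tail a x) = tail (a + int k) x"
  by (auto simp: tail_def fun_eq_iff add.assoc)

lemma tail_zshift [simp]: "tail a (zshift j x) = tail (a + j) x"
  by (auto simp: tail_def zshift_def fun_eq_iff algebra_simps)

lemma tail_lift [simp]: "tail (int k) (lift \<omega>) = suffix k \<omega>"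
  by (auto simp: tail_def lift_def fun_eq_iff nat_add_distrib)

lemma tail_in: "x \<in> Sig n \<Longrightarrow> tail a x \<in> iwords n"
  by (auto simp: Sig_iff tail_def iwords_def)

lemma zshift_in: "x \<in> Sig n \<Longrightarrow> zshift j x \<in> Sig n"
  by (auto simp: Sig_iff zshift_def)

lemma zshift_0 [simp]: "zshift 0 x = x"
  by (simp add: zshift_def)

lemma zshift_zshift [simp]: "zshift i (zshift j x) = zshift (i + j) x"
  by (simp add: zshift_def algebra_simps)

lemma tail_eqI:
  assumes "\<And>a. tail (a + b) x = tail (a + b) y"
  shows "x = y"
proof
  fix i
  show "x i = y i"
    using fun_cong[OF assms[of "i - b"], of 0] by (simp add: tail_def)
qed

lemma openin_cylinder:
  assumes "finite I"
  shows "openin (full_shift n) {y \<in> Sig n. \<forall>i\<in>I. y i = x i}"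
  using assms
proof (induction I rule: finite_induct)
  case (insert i I)
  have "continuous_map (full_shift n) (discrete_topology {1..n}) (\<lambda>y. y i)"
    unfolding full_shift_def by (rule continuous_map_product_projection) simp
  then have "openin (full_shift n) {y \<in> Sig n. y i \<in> {x i} \<inter> {1..n}}"
    by (rule openin_continuous_map_preimage) simp
  moreover have "{y \<in> Sig n. \<forall>i\<in>insert i I. y i = x i} =
      {y \<in> Sig n. y i \<in> {x i} \<inter> {1..n}} \<inter> {y \<in> Sig n. \<forall>i\<in>I. y i = x i}"
    by (auto simp: Sig_iff)
  ultimately show ?case using insert.IH by auto
qed simp

text \<open>The sliding block condition of Curtis, Hedlund and Lyndon, stated at coordinate 0 only;
  for maps commuting with the shift it carries over to every coordinate.\<close>

definition local_code :: "nat \<Rightarrow> nat \<Rightarrow> ((int \<Rightarrow> nat) \<Rightarrow> int \<Rightarrow> nat) \<Rightarrow> bool" where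
  "local_code n r \<psi> \<longleftrightarrow> (\<forall>x\<in>Sig n. \<forall>y\<in>Sig n. (\<forall>i. \<bar>i\<bar> \<le> int r \<longrightarrow> x i = y i) \<longrightarrow> \<psi> x 0 = \<psi> y 0)"

lemma local_code_mono: "local_code n r \<psi> \<Longrightarrow> r \<le> s \<Longrightarrow> local_code n s \<psi>"
  unfolding local_code_def by (meson order_trans of_nat_mono)

lemma commute_zshift:
  assumes \<psi>: "\<psi> \<in> Sig n \<rightarrow> Sig n"
    and com: "\<And>x. x \<in> Sig n \<Longrightarrow> \<psi> (shift_map n x) = shift_map n (\<psi> x)"
    and x: "x \<in> Sig n"
  shows "\<psi> (zshift j x) = zshift j (\<psi> x)"
proof -
  have com1: "\<psi> (zshift 1 x) = zshift 1 (\<psi> x)" if "x \<in> Sig n" for x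
    using com[OF that] that \<psi> by (auto simp: shift_map_def zshift_def)
  have nat: "\<psi> (zshift (int k) x) = zshift (int k) (\<psi> x)" if "x \<in> Sig n" for x k
  proof (induction k)
    case (Suc k)
    have "\<psi> (zshift (int (Suc k)) x) = \<psi> (zshift 1 (zshift (int k) x))"
      by simp
    also have "\<dots> = zshift 1 (zshift (int k) (\<psi> x))"
      using com1[of "zshift (int k) x"] that Suc zshift_in by simp
    finally show ?case by simp
  qed simp
  show ?thesis
  proof (cases "j \<ge> 0")
    case True
    then show ?thesis using nat[OF x, of "nat j"] by simp
  next
    case False
    \<comment> \<open>For negative j, the case of exponent -j is applied to
      \<open>zshift j x\<close> and the shift is then undone.\<close>
    have "zshift j (\<psi> (zshift (int (nat (- j))) (zshift j x))) = \<psi> (zshift j x)"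
      using False nat[of "zshift j x" "nat (- j)"] x zshift_in by simp
    then show ?thesis using False by simp
  qed
qed

lemma inv_into_zshift:
  assumes b: "bij_betw \<psi> (Sig n) (Sig n)"
    and com: "\<forall>x\<in>Sig n. \<forall>j. \<psi> (zshift j x) = zshift j (\<psi> x)" and x: "x \<in> Sig n"
  shows "inv_into (Sig n) \<psi> (zshift j x) = zshift j (inv_into (Sig n) \<psi> x)"
proof -
  let ?y = "inv_into (Sig n) \<psi> x"
  have y: "?y \<in> Sig n" using bij_betwE[OF bij_betw_inv_into[OF b]] x by blast
  have "\<psi> (zshift j ?y) = zshift j x" using com y bij_betw_inv_into_right[OF b x] by simp
  then show ?thesis using bij_betw_inv_into_left[OF b zshift_in[OF y, of j]] by simp
qed

text \<open>Moving coordinate k to the origin shows that \<open>\<psi> x k\<close> depends only on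
  coordinates k - r to k + r, so preimages of sets of letters are unions of open cylinders.\<close>

lemma continuous_map_local_code:
  assumes \<psi>: "\<psi> \<in> Sig n \<rightarrow> Sig n"
    and com: "\<And>x j. x \<in> Sig n \<Longrightarrow> \<psi> (zshift j x) = zshift j (\<psi> x)"
    and code: "local_code n r \<psi>"
  shows "continuous_map (full_shift n) (full_shift n) \<psi>"
  unfolding full_shift_def[of n, THEN eq_reflection] continuous_map_componentwise_UNIV
  unfolding full_shift_def[of n, symmetric]
proof (intro allI, unfold continuous_map, intro conjI allI impI)
  fix k
  show im: "(\<lambda>x. \<psi> x k) ` Sig n \<subseteq> topspace (discrete_topology {1..n})"
    using \<psi> Sig_iff by (auto dest!: funcset_mem simp del: atLeastAtMost_iff)
  fix V assume "openin (discrete_topology {1..n}) V"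
  show "openin (full_shift n) {x \<in> Sig n. \<psi> x k \<in> V}"
  proof (subst openin_subopen, intro ballI)
    fix x assume x: "x \<in> {x \<in> Sig n. \<psi> x k \<in> V}"
    let ?T = "{y \<in> Sig n. \<forall>i\<in>{k - int r..k + int r}. y i = x i}"
    have eq: "\<psi> y k = \<psi> x k" if "y \<in> ?T" for y
    proof -
      have "zshift k y i = zshift k x i" if "\<bar>i\<bar> \<le> int r" for i
        using \<open>y \<in> ?T\<close> that by (auto simp: zshift_def abs_le_iff dest!: bspec[of _ _ "i + k"])
      then have "\<psi> (zshift k y) 0 = \<psi> (zshift k x) 0"
        using code that x unfolding local_code_def by (simp add: zshift_in)
      then show ?thesis
        using com that x by (simp add: zshift_def)
    qed
    have "?T \<subseteq> {x \<in> Sig n. \<psi> x k \<in> V}"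
    proof
      fix y assume y: "y \<in> ?T"
      show "y \<in> {x \<in> Sig n. \<psi> x k \<in> V}" using eq[OF y] x y by simp
    qed
    then show "\<exists>T. openin (full_shift n) T \<and> x \<in> T \<and> T \<subseteq> {x \<in> Sig n. \<psi> x k \<in> V}"
      using openin_cylinder[of "{k - int r..k + int r}" n x] x by blast
  qed
qed

text \<open>Continuity gives each point a window radius of its own; compactness of the full shift
  makes one radius work for all points.\<close>

lemma local_code_continuous_map:
  assumes "continuous_map (full_shift n) (full_shift n) \<psi>"
  obtains r where "local_code n r \<psi>"
proof -
  let ?C = "\<lambda>r x. {y \<in> Sig n. \<forall>i\<in>{- int r..int r}. y i = x i}"
  have proj: "continuous_map (full_shift n) (discrete_topology {1..n}) (\<lambda>y. \<psi> y 0)"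
    using assms unfolding full_shift_def[of n] continuous_map_componentwise_UNIV by blast
  have "\<exists>r. \<forall>y\<in>?C r x. \<psi> y 0 = \<psi> x 0" if x: "x \<in> Sig n" for x
  proof -
    let ?U = "{y \<in> Sig n. \<psi> y 0 \<in> {\<psi> x 0} \<inter> {1..n}}"
    have "openin (full_shift n) ?U"
      by (rule openin_continuous_map_preimage[OF proj]) simp
    moreover have "x \<in> ?U"
      using x continuous_map_funspace[OF assms] Sig_iff by (auto dest!: funcset_mem simp del: atLeastAtMost_iff)
    ultimately have "\<exists>B. finite {i \<in> UNIV. B i \<noteq> topspace (discrete_topology {1..n})} \<and>
        (\<forall>i\<in>UNIV. openin (discrete_topology {1..n}) (B i)) \<and> x \<in> PiE UNIV B \<and> PiE UNIV B \<subseteq> ?U"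
      unfolding full_shift_def openin_product_topology_alt by blast
    then obtain B where fin: "finite {i. B i \<noteq> {1..n}}"
      and B: "x \<in> PiE UNIV B" "PiE UNIV B \<subseteq> ?U"
      by (auto simp del: atLeastAtMost_iff)
    obtain r where r: "\<bar>i\<bar> \<le> int r" if "B i \<noteq> {1..n}" for i
    proof
      fix i assume "B i \<noteq> {1..n}"
      then have "nat \<bar>i\<bar> \<le> (\<Sum>i\<in>{i. B i \<noteq> {1..n}}. nat \<bar>i\<bar>)"
        using fin by (intro member_le_sum) auto
      then show "\<bar>i\<bar> \<le> int (\<Sum>i\<in>{i. B i \<noteq> {1..n}}. nat \<bar>i\<bar>)" by linarith
    qed
    have "y \<in> PiE UNIV B" if "y \<in> ?C r x" for y
    proof (intro PiE_I)
      fix i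
      show "y i \<in> B i"
      proof (cases "B i = {1..n}")
        case True
        then show ?thesis using that by (auto simp: Sig_iff)
      next
        case False
        then have "i \<in> {- int r..int r}" using r[of i] by auto
        then have "y i = x i" using that by blast
        then show ?thesis using B(1) by auto
      qed
    qed auto
    then show ?thesis using B(2) by blast
  qed
  then have "\<forall>x\<in>Sig n. \<exists>r. \<forall>y\<in>?C r x. \<psi> y 0 = \<psi> x 0" by blast
  then obtain \<rho> where \<rho>: "\<forall>x\<in>Sig n. \<forall>y\<in>?C (\<rho> x) x. \<psi> y 0 = \<psi> x 0"
    by (rule bchoice[THEN exE])
  have "compact_space (full_shift n)"
    unfolding full_shift_def by (intro compact_space_product_topology[THEN iffD2] disjI2 ballI)
      (simp add: compact_space_discrete_topology)
  then have "compactin (full_shift n) (Sig n)" by (simp add: compact_space_def)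
  moreover have "Sig n \<subseteq> \<Union> ((\<lambda>x. ?C (\<rho> x) x) ` Sig n)" by blast
  moreover have "openin (full_shift n) U" if "U \<in> (\<lambda>x. ?C (\<rho> x) x) ` Sig n" for U
    using that openin_cylinder[of "{- int r..int r}" n for r] by blast
  ultimately obtain \<F> where \<F>: "finite \<F>" "\<F> \<subseteq> (\<lambda>x. ?C (\<rho> x) x) ` Sig n" "Sig n \<subseteq> \<Union>\<F>"
    unfolding compactin_def by meson
  then obtain F where F: "finite F" "F \<subseteq> Sig n" "\<F> = (\<lambda>x. ?C (\<rho> x) x) ` F"
    by (meson finite_subset_image)
  \<comment> \<open>The sum of the radii over the finite cover is a common upper bound for them,
    defined even if the cover is empty.\<close>
  have "local_code n (\<Sum>x\<in>F. \<rho> x) \<psi>"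
    unfolding local_code_def
  proof (intro ballI impI)
    fix x y assume xy: "x \<in> Sig n" "y \<in> Sig n" "\<forall>i. \<bar>i\<bar> \<le> int (\<Sum>x\<in>F. \<rho> x) \<longrightarrow> x i = y i"
    obtain z where z: "z \<in> F" "x \<in> ?C (\<rho> z) z" using xy(1) \<F>(3) F(3) by blast
    have "\<rho> z \<le> (\<Sum>x\<in>F. \<rho> x)" using z(1) F(1) by (intro member_le_sum) auto
    have "x i = y i" if i: "i \<in> {- int (\<rho> z)..int (\<rho> z)}" for i
    proof -
      have "\<bar>i\<bar> \<le> int (\<rho> z)" using i by auto
      also have "\<dots> \<le> int (\<Sum>x\<in>F. \<rho> x)" using \<open>\<rho> z \<le> _\<close> by (rule of_nat_mono)
      finally show ?thesis using xy(3) by blast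
    qed
    then have "\<forall>i\<in>{- int (\<rho> z)..int (\<rho> z)}. y i = z i" using z(2) by simp
    then have "y \<in> ?C (\<rho> z) z" using xy(2) by blast
    moreover have "z \<in> Sig n" using z(1) F(2) by blast
    ultimately have "\<psi> y 0 = \<psi> z 0" "\<psi> x 0 = \<psi> z 0" using \<rho> z(2) by blast+
    then show "\<psi> x 0 = \<psi> y 0" by simp
  qed
  then show ?thesis by (rule that)
qed

text \<open>The Curtis-Hedlund-Lyndon theorem, applied to the map and to its inverse, makes
  membership in \<open>shift_Aut n\<close> a combinatorial condition.\<close>

lemma shift_Aut_iff:
  "\<psi> \<in> carrier (shift_Aut n) \<longleftrightarrow>
     \<psi> \<in> Bij (Sig n) \<and> (\<forall>x\<in>Sig n. \<forall>j. \<psi> (zshift j x) = zshift j (\<psi> x)) \<and>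
     (\<exists>r. local_code n r \<psi>) \<and> (\<exists>r. local_code n r (inv_into (Sig n) \<psi>))"
  (is "?L \<longleftrightarrow> ?R")
proof
  assume L: ?L
  then have B: "\<psi> \<in> Bij (Sig n)" and h: "homeomorphic_map (full_shift n) (full_shift n) \<psi>"
    and com: "\<And>x. x \<in> Sig n \<Longrightarrow> \<psi> (shift_map n x) = shift_map n (\<psi> x)"
    by (auto simp: shift_Aut_def)
  obtain \<psi>' where \<psi>': "homeomorphic_maps (full_shift n) (full_shift n) \<psi> \<psi>'"
    using h by (auto simp: homeomorphic_map_maps)
  have "\<psi>' x = inv_into (Sig n) \<psi> x" if "x \<in> Sig n" for x
    using \<psi>' B that unfolding homeomorphic_maps_def
    by (intro inv_into_f_eq[symmetric]) (auto simp: Bij_def bij_betw_def continuous_map_def)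
  then have "continuous_map (full_shift n) (full_shift n) (inv_into (Sig n) \<psi>)"
    using \<psi>' continuous_map_eq unfolding homeomorphic_maps_def by blast
  then have "\<exists>r. local_code n r (inv_into (Sig n) \<psi>)" by (meson local_code_continuous_map)
  moreover have "\<exists>r. local_code n r \<psi>"
    using \<psi>' local_code_continuous_map unfolding homeomorphic_maps_def by meson
  ultimately show ?R
    using B commute_zshift[OF Bij_imp_funcset[OF B] com] by simp
next
  assume R: ?R
  then have B: "\<psi> \<in> Bij (Sig n)" and com: "\<And>x j. x \<in> Sig n \<Longrightarrow> \<psi> (zshift j x) = zshift j (\<psi> x)"
    by auto
  let ?\<phi> = "inv_into (Sig n) \<psi>"
  have b: "bij_betw \<psi> (Sig n) (Sig n)" using B by (simp add: Bij_def)
  have \<phi>: "?\<phi> \<in> Sig n \<rightarrow> Sig n" using bij_betw_inv_into[OF b] by (rule bij_betw_imp_funcset)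
  have "?\<phi> (zshift j x) = zshift j (?\<phi> x)" if "x \<in> Sig n" for x j
    using inv_into_zshift[OF b _ that] com by blast
  then have "continuous_map (full_shift n) (full_shift n) ?\<phi>"
    using continuous_map_local_code[OF \<phi>] R by blast
  moreover have "continuous_map (full_shift n) (full_shift n) \<psi>"
    using continuous_map_local_code[OF Bij_imp_funcset[OF B] com] R by blast
  ultimately have "homeomorphic_maps (full_shift n) (full_shift n) \<psi> ?\<phi>"
    using bij_betw_inv_into_left[OF b] bij_betw_inv_into_right[OF b] by (simp add: homeomorphic_maps_def)
  moreover have "\<psi> (shift_map n x) = shift_map n (\<psi> x)" if "x \<in> Sig n" for x
    using com[OF that, of 1] that Bij_imp_funcset[OF B] by (auto simp: shift_map_def zshift_def)
  ultimately show ?L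
    using B by (auto simp: shift_Aut_def homeomorphic_map_maps)
qed

section \<open>From one-sided homeomorphisms to automorphisms of the full shift\<close>

context alphabet
begin

text \<open>By \<open>bar_tail\<close> below, every \<open>m\<close> from which \<open>f\<close> commutes with the shift defines the same map.\<close>

definition bar :: "(nat word \<Rightarrow> nat word) \<Rightarrow> (int \<Rightarrow> nat) \<Rightarrow> (int \<Rightarrow> nat)" where
  "bar f = (\<lambda>x\<in>Sig n. \<lambda>i. let m = LEAST m. commutes_from m f in f (tail (i - int m) x) m)"

lemma bar_tail:
  assumes f: "commutes_from m f" and x: "x \<in> Sig n"
  shows "suffix m (f (tail a x)) = tail (a + int m) (bar f x)"
proof
  fix j
  define l where "l = (LEAST m. commutes_from m f)"
  have l: "commutes_from l f" "l \<le> m"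
    using f by (auto simp: l_def intro: LeastI Least_le)
  \<comment> \<open>\<open>bar\<close> is defined with the least delay l, whereas m is an arbitrary
    delay. Letter m + j of the output for \<open>tail a x\<close> is letter l of the output once the
    tail has been moved right by m - l + j.\<close>
  have "suffix l (f (suffix (m - l + j) (tail a x))) 0 = suffix (l + (m - l + j)) (f (tail a x)) 0"
    using commutes_fromD[OF l(1)] x tail_in by metis
  then show "suffix m (f (tail a x)) j = tail (a + int m) (bar f x) j"
    using x l(2) unfolding tail_def[of "a + int m" "bar f x"]
    by (simp add: bar_def algebra_simps flip: l_def)
qed

text \<open>The tails at all positions determine a two-sided word, so this property characterises
  \<open>bar f x\<close>. Identities for \<open>bar\<close> are proved by checking it.\<close>

lemma bar_unique:
  assumes f: "commutes_from m f" and x: "x \<in> Sig n"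
    and y: "\<And>a. suffix m (f (tail a x)) = tail (a + int m) y"
  shows "bar f x = y"
  by (rule tail_eqI[of "int m"]) (metis bar_tail[OF f x] y)

lemma bar_comp:
  assumes f: "commutes_from m f" and g: "commutes_from l g" and gX: "g ` X \<subseteq> X"
    and x: "x \<in> Sig n" "bar g x \<in> Sig n"
  shows "bar (f \<circ> g) x = bar f (bar g x)"
proof (rule bar_unique[OF commutes_from_comp[OF f g gX] x(1)])
  fix a
  have gt: "g (tail a x) \<in> X" using gX tail_in[OF x(1)] by blast
  have "suffix (m + l) ((f \<circ> g) (tail a x)) = suffix m (f (suffix l (g (tail a x))))"
    by (subst commutes_fromD[OF f gt]) simp
  also have "\<dots> = suffix m (f (tail (a + int l) (bar g x)))"
    by (simp only: bar_tail[OF g x(1)])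
  also have "\<dots> = tail (a + int l + int m) (bar f (bar g x))"
    by (rule bar_tail[OF f x(2)])
  finally show "suffix (m + l) ((f \<circ> g) (tail a x)) = tail (a + int (m + l)) (bar f (bar g x))"
    by (simp add: algebra_simps)
qed

lemma bar_in:
  assumes f: "f ` X \<subseteq> X" and x: "x \<in> Sig n"
  shows "bar f x \<in> Sig n"
  unfolding Sig_iff
proof
  fix i
  have "f (tail b x) \<in> X" for b using f tail_in[OF x] by blast
  then have "f (tail b x) k \<in> {1..n}" for b k unfolding iwords_def by blast
  then show "bar f x i \<in> {1..n}" using x by (simp add: bar_def Let_def)
qed

lemma bar_cong:
  assumes "\<And>\<omega>. \<omega> \<in> X \<Longrightarrow> f \<omega> = g \<omega>" shows "bar f = bar g"
proof -
  have "commutes_from m f \<longleftrightarrow> commutes_from m g" for m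
    using commutes_from_cong[of m f g] commutes_from_cong[of m g f] assms by auto
  then show ?thesis
    unfolding bar_def using assms tail_in by (intro restrict_ext) simp
qed

lemma commutes_from_id: "commutes_from 0 (\<lambda>\<omega>. \<omega>)"
  by (simp add: commutes_from_def)

lemma bar_id: "x \<in> Sig n \<Longrightarrow> bar (\<lambda>\<omega>. \<omega>) x = x"
  by (rule bar_unique[OF commutes_from_id]) auto

lemma bar_zshift:
  assumes f: "commutes_from m f" and x: "x \<in> Sig n"
  shows "bar f (zshift j x) = zshift j (bar f x)"
proof (rule bar_unique[OF f zshift_in[OF x]])
  fix a
  show "suffix m (f (tail a (zshift j x))) = tail (a + int m) (zshift j (bar f x))"
    using bar_tail[OF f x, of "a + j"] by (simp add: algebra_simps)
qed

lemma bar_local_code: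
  assumes f: "commutes_from m f" and c: "word_cont f"
  shows "\<exists>r. local_code n r (bar f)"
proof -
  obtain r where r: "\<And>\<omega> \<eta>. \<omega> \<in> X \<Longrightarrow> \<eta> \<in> X \<Longrightarrow> prefix r \<omega> = prefix r \<eta> \<Longrightarrow> prefix (Suc m) (f \<omega>) = prefix (Suc m) (f \<eta>)"
    using word_contD[OF c] by metis
  \<comment> \<open>Coordinate 0 of the image is letter m of f applied to the tail starting at -m,
    and that letter is determined by r letters of the tail; all of them lie within distance m + r of
    the origin.\<close>
  have "local_code n (m + r) (bar f)"
    unfolding local_code_def
  proof (intro ballI impI)
    fix x y assume xy: "x \<in> Sig n" "y \<in> Sig n" "\<forall>i. \<bar>i\<bar> \<le> int (m + r) \<longrightarrow> x i = y i"
    have "prefix r (tail (- int m) x) = prefix r (tail (- int m) y)"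
      using xy(3) by (auto simp: prefix_eq_iff tail_def)
    then have "prefix (Suc m) (f (tail (- int m) x)) = prefix (Suc m) (f (tail (- int m) y))"
      by (intro r tail_in xy)
    then have "suffix m (f (tail (- int m) x)) 0 = suffix m (f (tail (- int m) y)) 0"
      unfolding prefix_eq_iff by simp
    then have "tail 0 (bar f x) 0 = tail 0 (bar f y) 0"
      using bar_tail[OF f xy(1), of "- int m"] bar_tail[OF f xy(2), of "- int m"] by simp
    then show "bar f x 0 = bar f y 0" by (simp add: tail_def)
  qed
  then show ?thesis ..
qed

lemma G_homeosE:
  assumes "f \<in> G_homeos"
  obtains m where "commutes_from m f" "word_cont f" "f ` X \<subseteq> X"
  using assms G_homeos_image[OF assms] by (auto simp: G_homeos_def)

lemma bar_comp_G_homeos: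
  assumes "f \<in> G_homeos" "g \<in> G_homeos" "x \<in> Sig n"
  shows "bar (f \<circ> g) x = bar f (bar g x)"
  using assms bar_comp bar_in by (meson G_homeosE)

lemma bar_inv_left:
  assumes f: "f \<in> G_homeos" and x: "x \<in> Sig n"
  shows "bar (inv_into X f) (bar f x) = x"
proof -
  have "bij_betw f X X" using f by (simp add: G_homeos_def)
  from bij_betw_inv_into_left[OF this]
  have "bar (inv_into X f \<circ> f) = bar (\<lambda>\<omega>. \<omega>)" by (intro bar_cong) simp
  then show ?thesis using bar_comp_G_homeos[OF G_homeos_inv[OF f] f x] bar_id[OF x] by simp
qed

lemma bar_inv_right:
  assumes f: "f \<in> G_homeos" and x: "x \<in> Sig n"
  shows "bar f (bar (inv_into X f) x) = x"
proof -
  have "bij_betw f X X" using f by (simp add: G_homeos_def)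
  from bij_betw_inv_into_right[OF this]
  have "bar (f \<circ> inv_into X f) = bar (\<lambda>\<omega>. \<omega>)" by (intro bar_cong) simp
  then show ?thesis using bar_comp_G_homeos[OF f G_homeos_inv[OF f] x] bar_id[OF x] by simp
qed

lemma bar_shift_Aut:
  assumes f: "f \<in> G_homeos"
  shows "bar f \<in> carrier (shift_Aut n)"
  unfolding shift_Aut_iff
proof (intro conjI ballI allI)
  have b: "bij_betw (bar f) (Sig n) (Sig n)"
    using f G_homeos_inv[OF f] bar_in G_homeos_image
    by (intro bij_betw_byWitness[where f' = "bar (inv_into X f)"])
      (auto simp: bar_inv_left bar_inv_right)
  then show "bar f \<in> Bij (Sig n)"
    by (auto simp: Bij_def bar_def)
  obtain m where m: "commutes_from m f" "word_cont f" by (rule G_homeosE[OF f])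
  show "bar f (zshift j x) = zshift j (bar f x)" if "x \<in> Sig n" for x j
    by (rule bar_zshift[OF m(1) that])
  show "\<exists>r. local_code n r (bar f)" by (rule bar_local_code[OF m])
  have "bar (inv_into X f) x = inv_into (Sig n) (bar f) x" if "x \<in> Sig n" for x
    using b that bar_inv_right[OF f that] bar_in G_homeos_image[OF G_homeos_inv[OF f]]
    by (intro inv_into_f_eq[symmetric]) (auto simp: bij_betw_def)
  moreover have "\<exists>r. local_code n r (bar (inv_into X f))"
    using G_homeosE[OF G_homeos_inv[OF f]] bar_local_code by metis
  ultimately show "\<exists>r. local_code n r (inv_into (Sig n) (bar f))"
    unfolding local_code_def by metis
qed

section \<open>Which maps \<open>bar f\<close> are powers of the shift, and the kernel of
  \<open>bar\<close>\<close>

lemma lift_in: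
  assumes "\<omega> \<in> X" shows "lift \<omega> \<in> Sig n"
proof -
  have "\<omega> i \<in> {1..n}" for i using assms unfolding iwords_def by blast
  then show ?thesis using n_ge_2 by (auto simp: Sig_iff lift_def)
qed

text \<open>The assumption says that dropping m letters of \<open>f \<omega>\<close> gives the same
  as dropping m + j letters of \<omega>. So the injective f maps a fibre with n^(m+j) points into
  one with n^m points.\<close>

lemma bar_power_of_shift_nonneg:
  assumes f: "f \<in> G_homeos" and "\<And>x. x \<in> Sig n \<Longrightarrow> bar f x = zshift (int j) x"
  shows "j = 0"
proof -
  obtain m where m: "commutes_from m f" by (rule G_homeosE[OF f])
  have eq: "suffix m (f \<omega>) = suffix (m + j) \<omega>" if "\<omega> \<in> X" for \<omega>
    using bar_tail[OF m lift_in[OF that], of 0] assms(2)[OF lift_in[OF that]] tail_lift[of 0 \<omega>]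
      tail_lift[of "m + j" \<omega>] by simp
  have "inj_on f X" using f by (simp add: G_homeos_def bij_betw_def)
  then have "inj_on f {\<omega> \<in> X. suffix (m + j) \<omega> = ones}" by (rule inj_on_subset) auto
  moreover have "f ` {\<omega> \<in> X. suffix (m + j) \<omega> = ones} \<subseteq> {\<omega> \<in> X. suffix m \<omega> = ones}"
    using eq G_homeos_in[OF f] by auto
  ultimately have "card {\<omega> \<in> X. suffix (m + j) \<omega> = ones} \<le> card {\<omega> \<in> X. suffix m \<omega> = ones}"
    using suffix_fibre(1)[OF ones_in] by (rule card_inj_on_le)
  then have "n ^ (m + j) \<le> n ^ m" by (simp add: suffix_fibre(2) ones_in)
  then show ?thesis using n_ge_2 power_increasing_iff[of n "m + j" m] by simp
qed

lemma bar_power_of_shift: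
  assumes f: "f \<in> G_homeos" and bar: "\<And>x. x \<in> Sig n \<Longrightarrow> bar f x = zshift j x"
  shows "j = 0"
proof (cases "j \<ge> 0")
  case True
  then show ?thesis using bar_power_of_shift_nonneg[OF f, of "nat j"] bar by simp
next
  case False
  \<comment> \<open>A negative exponent becomes positive for the inverse homeomorphism.\<close>
  have "bar (inv_into X f) x = zshift (- j) x" if "x \<in> Sig n" for x
    using bar_inv_left[OF f zshift_in[OF that, of "- j"]] bar[OF zshift_in[OF that]] by simp
  then have "nat (- j) = 0"
    using False by (intro bar_power_of_shift_nonneg[OF G_homeos_inv[OF f]]) simp
  then show ?thesis using False by simp
qed

definition prefix_perm :: "nat \<Rightarrow> (nat list \<Rightarrow> nat list) \<Rightarrow> nat word \<Rightarrow> nat word" where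
  "prefix_perm k \<pi> \<omega> = \<pi> (prefix k \<omega>) \<frown> suffix k \<omega>"

text \<open>If \<open>bar f\<close> is trivial, f leaves all letters from position m on untouched,
  and by continuity its first m output letters depend on some k \<ge> m input letters. Hence f only
  rewrites prefixes of length k, and injectivity makes the rewriting a permutation of the finite set
  \<open>W k\<close>.\<close>

lemma bar_eq_idD:
  assumes f: "f \<in> G_homeos" and bar: "\<And>x. x \<in> Sig n \<Longrightarrow> bar f x = x"
  obtains k \<pi> where "bij_betw \<pi> (W k) (W k)" "\<And>\<omega>. \<omega> \<in> X \<Longrightarrow> f \<omega> = prefix_perm k \<pi> \<omega>"
proof -
  obtain m where m: "commutes_from m f" "word_cont f" by (rule G_homeosE[OF f])
  have eq: "suffix m (f \<omega>) = suffix m \<omega>" if "\<omega> \<in> X" for \<omega>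
    using bar_tail[OF m(1) lift_in[OF that], of 0] bar[OF lift_in[OF that]] tail_lift[of 0 \<omega>]
      tail_lift[of m \<omega>] by simp
  obtain k where k: "m \<le> k" "\<And>\<omega> \<eta>. \<omega> \<in> X \<Longrightarrow> \<eta> \<in> X \<Longrightarrow> prefix k \<omega> = prefix k \<eta> \<Longrightarrow> prefix m (f \<omega>) = prefix m (f \<eta>)"
    using word_contD[OF m(2)] by metis
  have eqk: "f \<omega> i = \<omega> i" if "\<omega> \<in> X" "i \<ge> m" for \<omega> i
    using fun_cong[OF eq[OF that(1)], of "i - m"] that(2) by simp
  have pre: "prefix k (f \<omega>) = prefix k (f \<eta>)" if "\<omega> \<in> X" "\<eta> \<in> X" "prefix k \<omega> = prefix k \<eta>" for \<omega> \<eta>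
  proof -
    have "f \<omega> i = f \<eta> i" if "i < k" for i
    proof (cases "i < m")
      case True
      then show ?thesis using k(2)[OF \<open>\<omega> \<in> X\<close> \<open>\<eta> \<in> X\<close>] \<open>prefix k \<omega> = _\<close> by (simp add: prefix_eq_iff)
    next
      case False
      then show ?thesis using eqk \<open>\<omega> \<in> X\<close> \<open>\<eta> \<in> X\<close> \<open>prefix k \<omega> = _\<close> that by (simp add: prefix_eq_iff)
    qed
    then show ?thesis by (simp add: prefix_eq_iff)
  qed
  define \<pi> where "\<pi> \<mu> = prefix k (f (\<mu> \<frown> ones))" for \<mu>
  have ext: "\<mu> \<frown> ones \<in> X" if "\<mu> \<in> W k" for \<mu> using that ones_in by (rule iwords_conc)
  have \<pi>: "f \<omega> = prefix_perm k \<pi> \<omega>" if "\<omega> \<in> X" for \<omega>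
  proof -
    have "prefix k (f \<omega>) = \<pi> (prefix k \<omega>)"
      unfolding \<pi>_def using that
      by (intro pre) (simp_all add: ext words_prefix prefix_conc_length)
    moreover have "suffix k (f \<omega>) = suffix k \<omega>" using eqk[OF that] k(1) by auto
    ultimately show ?thesis unfolding prefix_perm_def by (metis prefix_suffix)
  qed
  have "inj_on \<pi> (W k)"
  proof (rule inj_onI)
    fix \<mu> \<nu> assume mn: "\<mu> \<in> W k" "\<nu> \<in> W k" "\<pi> \<mu> = \<pi> \<nu>"
    then have "f (\<mu> \<frown> ones) = f (\<nu> \<frown> ones)"
      by (simp add: \<pi> ext prefix_perm_def prefix_conc_length words_length)
    moreover have "inj_on f X" using f by (simp add: G_homeos_def bij_betw_def)
    ultimately have "\<mu> \<frown> ones = \<nu> \<frown> ones" using ext mn by (meson inj_onD)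
    then show "\<mu> = \<nu>" using mn by (metis prefix_conc_length words_length)
  qed
  moreover have "\<pi> ` W k \<subseteq> W k"
    using G_homeos_in[OF f] ext by (auto simp: \<pi>_def words_prefix)
  ultimately have "bij_betw \<pi> (W k) (W k)"
    by (simp add: bij_betw_def endo_inj_surj)
  then show ?thesis using \<pi> by (rule that)
qed

lemma prefix_perm_in: "\<pi> ` W k \<subseteq> W k \<Longrightarrow> prefix_perm k \<pi> ` X \<subseteq> X"
  by (auto simp: prefix_perm_def image_subset_iff intro!: iwords_conc iwords_suffix words_prefix)

lemma prefix_perm_suffix:
  assumes "\<pi> ` W k \<subseteq> W k" "\<omega> \<in> X"
  shows "suffix k (prefix_perm k \<pi> \<omega>) = suffix k \<omega>" "prefix k (prefix_perm k \<pi> \<omega>) = \<pi> (prefix k \<omega>)"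
proof -
  have "length (\<pi> (prefix k \<omega>)) = k"
    using assms words_prefix words_length by blast
  then show "suffix k (prefix_perm k \<pi> \<omega>) = suffix k \<omega>" "prefix k (prefix_perm k \<pi> \<omega>) = \<pi> (prefix k \<omega>)"
    by (simp_all only: prefix_perm_def suffix_conc_length prefix_conc_length)
qed

text \<open>The prefix \<open>p \<omega>\<close> is locally constant, so near a given word only the
  continuity of q matters. This covers prefix permutations as well as the labelled maps built from
  fibres.\<close>

lemma word_cont_conc:
  assumes p: "\<And>\<omega> \<eta>. \<omega> \<in> X \<Longrightarrow> \<eta> \<in> X \<Longrightarrow> prefix l \<omega> = prefix l \<eta> \<Longrightarrow> p \<omega> = p \<eta>"
    and q: "word_cont q"
  shows "word_cont (\<lambda>\<omega>. p \<omega> \<frown> q \<omega>)"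
  unfolding word_cont_def
proof
  fix k
  obtain m where m: "m \<ge> l" "\<And>\<omega> \<eta>. \<omega> \<in> X \<Longrightarrow> \<eta> \<in> X \<Longrightarrow> prefix m \<omega> = prefix m \<eta> \<Longrightarrow> prefix k (q \<omega>) = prefix k (q \<eta>)"
    by (rule word_contD[OF q, of l k]) blast
  have "prefix k (p \<omega> \<frown> q \<omega>) = prefix k (p \<eta> \<frown> q \<eta>)"
    if "\<omega> \<in> X" "\<eta> \<in> X" "prefix m \<omega> = prefix m \<eta>" for \<omega> \<eta>
  proof -
    have "p \<omega> = p \<eta>" using p[OF that(1,2)] prefix_eq_mono[OF that(3) m(1)] by blast
    moreover have "q \<omega> i = q \<eta> i" if "i < k" for i
      using m(2)[OF \<open>\<omega> \<in> X\<close> \<open>\<eta> \<in> X\<close> \<open>prefix m \<omega> = _\<close>] that by (simp add: prefix_eq_iff)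
    ultimately show ?thesis by (simp add: prefix_eq_iff conc_def)
  qed
  then show "\<exists>m. \<forall>\<omega>\<in>X. \<forall>\<eta>\<in>X. prefix m \<omega> = prefix m \<eta> \<longrightarrow>
      prefix k (p \<omega> \<frown> q \<omega>) = prefix k (p \<eta> \<frown> q \<eta>)"
    by (intro exI[of _ m]) blast
qed

lemma word_cont_suffix: "word_cont (suffix k)"
  unfolding word_cont_def
proof
  fix l
  have "prefix l (suffix k \<omega>) = prefix l (suffix k \<eta>)" if "prefix (k + l) \<omega> = prefix (k + l) \<eta>"
    for \<omega> \<eta> :: "nat word"
    using that unfolding prefix_eq_iff by simp
  then show "\<exists>m. \<forall>\<omega>\<in>X. \<forall>\<eta>\<in>X. prefix m \<omega> = prefix m \<eta> \<longrightarrow> prefix l (suffix k \<omega>) = prefix l (suffix k \<eta>)"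
    by (intro exI[of _ "k + l"]) blast
qed

lemma prefix_perm_cont: "word_cont (prefix_perm k \<pi>)"
  unfolding prefix_perm_def by (rule word_cont_conc[OF _ word_cont_suffix, of k]) simp

lemma prefix_perm_commutes:
  assumes "\<pi> ` W k \<subseteq> W k" shows "commutes_from k (prefix_perm k \<pi>)"
  unfolding commutes_from_def
proof
  fix \<omega> assume w: "\<omega> \<in> X"
  have "suffix (Suc k) (prefix_perm k \<pi> \<omega>) = suffix 1 (suffix k (prefix_perm k \<pi> \<omega>))" by simp
  then show "suffix k (prefix_perm k \<pi> (suffix 1 \<omega>)) = suffix (Suc k) (prefix_perm k \<pi> \<omega>)"
    using w by (simp add: prefix_perm_suffix(1)[OF assms] iwords_suffix del: suffix_suffix) simp
qed

lemma prefix_perm_inverse: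
  assumes "\<pi> ` W k \<subseteq> W k" "\<And>\<mu>. \<mu> \<in> W k \<Longrightarrow> \<pi>' (\<pi> \<mu>) = \<mu>" "\<omega> \<in> X"
  shows "prefix_perm k \<pi>' (prefix_perm k \<pi> \<omega>) = \<omega>"
  unfolding prefix_perm_def[of k \<pi>']
  using assms by (simp add: prefix_perm_suffix words_prefix)

lemma prefix_perm_G_homeos:
  assumes "bij_betw \<pi> (W k) (W k)"
  shows "prefix_perm k \<pi> \<in> G_homeos"
proof -
  let ?\<pi>' = "inv_into (W k) \<pi>"
  have im: "\<pi> ` W k \<subseteq> W k" "?\<pi>' ` W k \<subseteq> W k"
    using assms bij_betw_inv_into[OF assms] by (simp_all add: bij_betw_def)
  show ?thesis
    by (rule G_homeosI[OF im[THEN prefix_perm_in] _ _ prefix_perm_cont prefix_perm_cont im[THEN prefix_perm_commutes]])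
      (simp_all add: prefix_perm_inverse im bij_betw_inv_into_left[OF assms] bij_betw_inv_into_right[OF assms])
qed

lemma bar_prefix_perm:
  assumes "bij_betw \<pi> (W k) (W k)" "x \<in> Sig n"
  shows "bar (prefix_perm k \<pi>) x = x"
proof -
  have im: "\<pi> ` W k \<subseteq> W k" using assms(1) by (simp add: bij_betw_def)
  show ?thesis
    by (rule bar_unique[OF prefix_perm_commutes[OF im] assms(2)])
      (simp add: prefix_perm_suffix(1)[OF im] tail_in assms(2))
qed

end

section \<open>Lifting shift automorphisms when the alphabet size is prime\<close>

context alphabet
begin

section \<open>Fibres of a one-sided code g that has a partner h with both composites equal to the
  a-th power of the shift\<close>

context
  fixes g h :: "nat word \<Rightarrow> nat word" and a :: nat
  assumes gX_ball: "\<forall>\<omega>\<in>X. g \<omega> \<in> X" and hX_ball: "\<forall>\<omega>\<in>X. h \<omega> \<in> X"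
    and g_cont: "word_cont g" and h_cont: "word_cont h"
    and g_com: "commutes_from 0 g" and h_com: "commutes_from 0 h"
    and hg_ball: "\<forall>\<omega>\<in>X. h (g \<omega>) = suffix a \<omega>"
    and gh_ball: "\<forall>\<omega>\<in>X. g (h \<omega>) = suffix a \<omega>"
begin

lemmas gX = gX_ball[rule_format] and hX = hX_ball[rule_format]
  and hg = hg_ball[rule_format] and gh = gh_ball[rule_format]

text \<open>If \<open>g \<omega> = \<eta>\<close>, then
  \<open>suffix a \<omega> = h (g \<omega>) = h \<eta>\<close>. So a preimage of \<eta> has only its
  first a letters free, and these are the possible choices.\<close>

definition fibre_prefixes :: "nat word \<Rightarrow> nat list set" where
  "fibre_prefixes \<eta> = {p \<in> W a. g (p \<frown> h \<eta>) = \<eta>}"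

lemma bij_betw_fibre_prefixes:
  assumes "\<eta> \<in> X"
  shows "bij_betw (\<lambda>p. p \<frown> h \<eta>) (fibre_prefixes \<eta>) {\<omega> \<in> X. g \<omega> = \<eta>}"
proof (rule bij_betw_byWitness[where f' = "prefix a"])
  show "\<forall>p\<in>fibre_prefixes \<eta>. prefix a (p \<frown> h \<eta>) = p"
    by (auto simp: fibre_prefixes_def intro: prefix_conc_length words_length)
  show 1: "\<forall>\<omega>\<in>{\<omega> \<in> X. g \<omega> = \<eta>}. prefix a \<omega> \<frown> h \<eta> = \<omega>"
    using hg by auto
  show "(\<lambda>p. p \<frown> h \<eta>) ` fibre_prefixes \<eta> \<subseteq> {\<omega> \<in> X. g \<omega> = \<eta>}"
    using assms hX by (auto simp: fibre_prefixes_def iwords_conc)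
  show "prefix a ` {\<omega> \<in> X. g \<omega> = \<eta>} \<subseteq> fibre_prefixes \<eta>"
    using 1 by (auto simp: fibre_prefixes_def words_prefix)
qed

lemma finite_fibre_prefixes: "finite (fibre_prefixes \<eta>)"
  unfolding fibre_prefixes_def by simp

lemma fibre:
  assumes "\<eta> \<in> X"
  shows "finite {\<omega> \<in> X. g \<omega> = \<eta>}" "card {\<omega> \<in> X. g \<omega> = \<eta>} = card (fibre_prefixes \<eta>)"
  using bij_betw_finite[OF bij_betw_fibre_prefixes[OF assms]]
    bij_betw_same_card[OF bij_betw_fibre_prefixes[OF assms]] finite_fibre_prefixes by auto

lemma g_suffix: "\<omega> \<in> X \<Longrightarrow> g (suffix k \<omega>) = suffix k (g \<omega>)"
  using commutes_fromD[OF g_com] by simp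

lemma h_suffix: "\<omega> \<in> X \<Longrightarrow> h (suffix k \<omega>) = suffix k (h \<omega>)"
  using commutes_fromD[OF h_com] by simp

text \<open>For any p in \<open>W a\<close>, the words \<open>g (p \<frown> h \<eta>)\<close> and
  \<eta> agree after a letters, because \<open>g (h \<eta>) = suffix a \<eta>\<close>. Membership of
  p is thus decided by the first a letters, which depend on a bounded prefix of \<eta>.\<close>

lemma fibre_prefixes_locally_constant:
  obtains K where "\<And>\<eta> \<eta>'. \<eta> \<in> X \<Longrightarrow> \<eta>' \<in> X \<Longrightarrow> prefix K \<eta> = prefix K \<eta>' \<Longrightarrow>
    fibre_prefixes \<eta> = fibre_prefixes \<eta>'"
proof -
  have eq: "fibre_prefixes \<eta> = {p \<in> W a. prefix a (g (p \<frown> h \<eta>)) = prefix a \<eta>}" if \<eta>: "\<eta> \<in> X" for \<eta>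
  proof -
    have "g (p \<frown> h \<eta>) = \<eta>" if p: "p \<in> W a" and eq: "prefix a (g (p \<frown> h \<eta>)) = prefix a \<eta>" for p
    proof -
      have "suffix a (g (p \<frown> h \<eta>)) = g (suffix a (p \<frown> h \<eta>))"
        using p \<eta> hX iwords_conc g_suffix by simp
      also have "\<dots> = suffix a \<eta>" using p gh[OF \<eta>] words_length by simp
      finally show ?thesis using eq by (metis prefix_suffix)
    qed
    then show ?thesis by (auto simp: fibre_prefixes_def)
  qed
  obtain l where l: "\<And>\<omega> \<eta>. \<omega> \<in> X \<Longrightarrow> \<eta> \<in> X \<Longrightarrow> prefix l \<omega> = prefix l \<eta> \<Longrightarrow> prefix a (g \<omega>) = prefix a (g \<eta>)"
    using word_contD[OF g_cont] by metis
  obtain K where K: "K \<ge> a" "\<And>\<omega> \<eta>. \<omega> \<in> X \<Longrightarrow> \<eta> \<in> X \<Longrightarrow> prefix K \<omega> = prefix K \<eta> \<Longrightarrow> prefix l (h \<omega>) = prefix l (h \<eta>)"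
    by (rule word_contD[OF h_cont, of a l]) blast
  show ?thesis
  proof (rule that[of K])
    fix \<eta> \<eta>' assume e: "\<eta> \<in> X" "\<eta>' \<in> X" "prefix K \<eta> = prefix K \<eta>'"
    have "prefix a (g (p \<frown> h \<eta>)) = prefix a (g (p \<frown> h \<eta>'))" if "p \<in> W a" for p
    proof (rule l)
      show "prefix l (p \<frown> h \<eta>) = prefix l (p \<frown> h \<eta>')"
        using K(2)[OF e] by (auto simp: prefix_eq_iff conc_def)
    qed (use that hX e in \<open>auto intro: iwords_conc\<close>)
    then show "fibre_prefixes \<eta> = fibre_prefixes \<eta>'"
      unfolding eq[OF e(1)] eq[OF e(2)] using prefix_eq_mono[OF e(3) K(1)] by auto
  qed
qed

lemma letter_in: "i \<in> {1..n} \<Longrightarrow> \<eta> \<in> X \<Longrightarrow> [i] \<frown> \<eta> \<in> X"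
  using iwords_conc[of "[i]" n 1] by (simp add: words_def)

text \<open>Double counting of the words \<omega> for which \<open>g \<omega>\<close> shifted once
  is \<eta>: they are sorted by the first letter of \<open>g \<omega>\<close>, and then, since g
  commutes with the shift, by \<open>suffix 1 \<omega>\<close>, which lies in the fibre of \<eta>
  and takes each value n times.\<close>

lemma sum_card_fibre_prefixes:
  assumes \<eta>: "\<eta> \<in> X"
  shows "(\<Sum>i=1..n. card (fibre_prefixes ([i] \<frown> \<eta>))) = n * card (fibre_prefixes \<eta>)"
proof -
  let ?S = "{\<omega> \<in> X. suffix 1 (g \<omega>) = \<eta>}"
  have eq: "?S = (\<Union>i\<in>{1..n}. {\<omega> \<in> X. g \<omega> = [i] \<frown> \<eta>})"
  proof (intro equalityI subsetI)
    fix \<omega> assume w: "\<omega> \<in> ?S"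
    have "g \<omega> = [g \<omega> 0] \<frown> \<eta>"
      using w prefix_suffix[of "g \<omega>" 1] by (simp add: subsequence_def)
    moreover have "g \<omega> 0 \<in> {1..n}" using gX[of \<omega>] w unfolding iwords_def by blast
    ultimately show "\<omega> \<in> (\<Union>i\<in>{1..n}. {\<omega> \<in> X. g \<omega> = [i] \<frown> \<eta>})" using w by blast
  qed (auto simp: fun_eq_iff)
  have "card ?S = (\<Sum>i=1..n. card {\<omega> \<in> X. g \<omega> = [i] \<frown> \<eta>})"
    unfolding eq
  proof (rule card_UN_disjoint)
    show "\<forall>i\<in>{1..n}. \<forall>j\<in>{1..n}. i \<noteq> j \<longrightarrow> {\<omega> \<in> X. g \<omega> = [i] \<frown> \<eta>} \<inter> {\<omega> \<in> X. g \<omega> = [j] \<frown> \<eta>} = {}"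
      by (auto dest!: fun_cong[where x = 0])
  qed (use fibre(1) letter_in \<eta> in auto)
  also have "\<dots> = (\<Sum>i=1..n. card (fibre_prefixes ([i] \<frown> \<eta>)))"
    using fibre(2) letter_in \<eta> by (intro sum.cong) auto
  finally have 1: "card ?S = (\<Sum>i=1..n. card (fibre_prefixes ([i] \<frown> \<eta>)))" .
  have eq: "?S = (\<Union>\<zeta>\<in>{\<omega> \<in> X. g \<omega> = \<eta>}. {\<omega> \<in> X. suffix 1 \<omega> = \<zeta>})"
    using g_suffix[of _ 1] iwords_suffix by auto
  have "card ?S = (\<Sum>\<zeta>\<in>{\<omega> \<in> X. g \<omega> = \<eta>}. card {\<omega> \<in> X. suffix 1 \<omega> = \<zeta>})"
    unfolding eq
  proof (rule card_UN_disjoint)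
    show "finite {\<omega> \<in> X. g \<omega> = \<eta>}" by (rule fibre(1)[OF \<eta>])
    show "\<forall>\<zeta>\<in>{\<omega> \<in> X. g \<omega> = \<eta>}. finite {\<omega> \<in> X. suffix 1 \<omega> = \<zeta>}"
      using suffix_fibre(1) by blast
  qed blast
  also have "\<dots> = (\<Sum>\<zeta>\<in>{\<omega> \<in> X. g \<omega> = \<eta>}. n)"
  proof (rule sum.cong[OF refl])
    fix \<zeta> assume "\<zeta> \<in> {\<omega> \<in> X. g \<omega> = \<eta>}"
    then have "\<zeta> \<in> X" by blast
    from suffix_fibre(2)[OF this, of 1] show "card {\<omega> \<in> X. suffix 1 \<omega> = \<zeta>} = n"
      by (simp only: power_one_right)
  qed
  also have "\<dots> = n * card (fibre_prefixes \<eta>)" by (simp add: fibre(2)[OF \<eta>])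
  finally show ?thesis by (rule trans[OF 1[symmetric]])
qed

text \<open>The fibre cardinality is harmonic for the one-letter extensions, so its maximum propagates to
  all words ending in a maximising one; these are dense, and the cardinality is locally constant.\<close>

lemma card_fibre_prefixes_constant:
  obtains M where "\<And>\<eta>. \<eta> \<in> X \<Longrightarrow> card (fibre_prefixes \<eta>) = M"
proof -
  let ?R = "\<lambda>\<eta>. card (fibre_prefixes \<eta>)"
  have bound: "?R \<eta> \<le> n ^ a" for \<eta>
    using card_mono[of "W a" "fibre_prefixes \<eta>"] by (auto simp: fibre_prefixes_def card_words)
  obtain \<eta>0 where \<eta>0: "\<eta>0 \<in> X" "\<And>\<eta>. \<eta> \<in> X \<Longrightarrow> ?R \<eta> \<le> ?R \<eta>0"
    using ex_has_greatest_nat[of "\<lambda>\<eta>. \<eta> \<in> X" ones ?R "Suc (n ^ a)"] ones_in bound by (auto simp: less_Suc_eq_le)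
  have step: "?R ([i] \<frown> \<eta>) = ?R \<eta>0" if "\<eta> \<in> X" "?R \<eta> = ?R \<eta>0" "i \<in> {1..n}" for \<eta> i
  proof (rule ccontr)
    assume "?R ([i] \<frown> \<eta>) \<noteq> ?R \<eta>0"
    then have "?R ([i] \<frown> \<eta>) < ?R \<eta>0" using \<eta>0(2)[OF letter_in[OF that(3,1)]] by simp
    then have "(\<Sum>i=1..n. ?R ([i] \<frown> \<eta>)) < (\<Sum>i=1..n. ?R \<eta>0)"
      using \<eta>0(2) letter_in that by (intro sum_strict_mono_ex1) auto
    then show False using sum_card_fibre_prefixes[OF that(1)] that(2) by simp
  qed
  have all: "?R (\<mu> \<frown> \<eta>0) = ?R \<eta>0" if "set \<mu> \<subseteq> {1..n}" for \<mu>
    using that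
  proof (induction \<mu>)
    case (Cons i \<mu>)
    have "\<mu> \<frown> \<eta>0 \<in> X"
      using Cons.prems \<eta>0(1) iwords_conc[of \<mu> n "length \<mu>"] by (simp add: words_def)
    then have "?R ([i] \<frown> \<mu> \<frown> \<eta>0) = ?R \<eta>0" using Cons by (intro step) auto
    then show ?case by simp
  qed simp
  obtain K where K: "\<And>\<eta> \<eta>'. \<eta> \<in> X \<Longrightarrow> \<eta>' \<in> X \<Longrightarrow> prefix K \<eta> = prefix K \<eta>' \<Longrightarrow>
      fibre_prefixes \<eta> = fibre_prefixes \<eta>'"
    by (rule fibre_prefixes_locally_constant) blast
  have "?R \<eta> = ?R \<eta>0" if "\<eta> \<in> X" for \<eta>
  proof -
    have p: "prefix K \<eta> \<in> W K" using that by (rule words_prefix)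
    have "?R \<eta> = ?R (prefix K \<eta> \<frown> \<eta>0)"
      using K[OF that iwords_conc[OF p \<eta>0(1)]] by (simp add: prefix_conc_length)
    also have "\<dots> = ?R \<eta>0" using p by (intro all) (simp add: words_def)
    finally show ?thesis .
  qed
  then show ?thesis by (rule that)
qed

text \<open>The composite of g and h is the a-th power of the shift, so its fibre over
  \<open>ones\<close> has n^a points; it splits into fibres of g, one for each point that h sends to
  \<open>ones\<close>.\<close>

lemma card_fibre_prefixes_dvd:
  assumes M: "\<And>\<eta>. \<eta> \<in> X \<Longrightarrow> card (fibre_prefixes \<eta>) = M"
  shows "M dvd n ^ a"
proof -
  let ?F = "{\<eta> \<in> X. h \<eta> = ones}"
  have "suffix a \<eta> = g ones" if "\<eta> \<in> ?F" for \<eta>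
    using gh[of \<eta>] that by simp
  then have "?F \<subseteq> {\<eta> \<in> X. suffix a \<eta> = g ones}" by auto
  then have fin: "finite ?F" using suffix_fibre(1)[OF gX[OF ones_in]] finite_subset by blast
  have eq: "{\<zeta> \<in> X. suffix a \<zeta> = ones} = (\<Union>\<eta>\<in>?F. {\<omega> \<in> X. g \<omega> = \<eta>})"
    using hg gX by auto
  have "n ^ a = card {\<zeta> \<in> X. suffix a \<zeta> = ones}" using suffix_fibre(2)[OF ones_in] by simp
  also have "\<dots> = (\<Sum>\<eta>\<in>?F. card {\<omega> \<in> X. g \<omega> = \<eta>})"
    unfolding eq
  proof (rule card_UN_disjoint[OF fin])
    show "\<forall>\<eta>\<in>?F. finite {\<omega> \<in> X. g \<omega> = \<eta>}" using fibre(1) by blast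
  qed blast
  also have "\<dots> = (\<Sum>\<eta>\<in>?F. M)" 
  proof (rule sum.cong[OF refl])
    fix \<eta> assume "\<eta> \<in> ?F"
    then have "\<eta> \<in> X" by blast
    then show "card {\<omega> \<in> X. g \<omega> = \<eta>} = M" by (simp only: fibre(2) M)
  qed
  finally show ?thesis by simp
qed

lemma label_fibres:
  assumes "prime n"
  obtains f m where "f \<in> G_homeos" "\<And>\<omega>. \<omega> \<in> X \<Longrightarrow> suffix m (f \<omega>) = g \<omega>"
proof -
  obtain M where M: "\<And>\<eta>. \<eta> \<in> X \<Longrightarrow> card (fibre_prefixes \<eta>) = M"
    by (rule card_fibre_prefixes_constant) blast
  \<comment> \<open>Primality enters here: a divisor of a power of n is again a power of n, so a
    fibre has as many points as there are words of some length m.\<close>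
  obtain m where m: "M = n ^ m"
    using card_fibre_prefixes_dvd[OF M] divides_primepow_nat[OF assms] by blast
  \<comment> \<open>The labelling is chosen for each set of prefixes, not for each point \<eta>. It
    therefore inherits the local constancy of \<open>fibre_prefixes\<close>, which is what makes f
    and its inverse continuous.\<close>
  define L where "L B = (SOME \<phi>. bij_betw \<phi> B (W m))" for B :: "nat list set"
  have L: "bij_betw (L (fibre_prefixes \<eta>)) (fibre_prefixes \<eta>) (W m)" if "\<eta> \<in> X" for \<eta>
    unfolding L_def using M[OF that] m finite_fibre_prefixes
    by (intro someI_ex[OF finite_same_card_bij]) (simp_all add: card_words)
  define f where "f \<omega> = L (fibre_prefixes (g \<omega>)) (prefix a \<omega>) \<frown> g \<omega>" for \<omega>
  \<comment> \<open>The inverse decodes: \<open>suffix m \<omega>\<close> is the value of g, the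
    first m letters are the label of a point in its fibre, and h supplies that point from letter a
    on.\<close>
  define f' where "f' \<omega> = inv_into (fibre_prefixes (suffix m \<omega>)) (L (fibre_prefixes (suffix m \<omega>))) (prefix m \<omega>)
      \<frown> h (suffix m \<omega>)" for \<omega>
  obtain K where K: "\<And>\<eta> \<eta>'. \<eta> \<in> X \<Longrightarrow> \<eta>' \<in> X \<Longrightarrow> prefix K \<eta> = prefix K \<eta>' \<Longrightarrow>
      fibre_prefixes \<eta> = fibre_prefixes \<eta>'"
    by (rule fibre_prefixes_locally_constant) blast
  have pre: "prefix a \<omega> \<in> fibre_prefixes (g \<omega>)" if "\<omega> \<in> X" for \<omega>
    using that by (simp add: fibre_prefixes_def words_prefix hg)
  have Lpre: "L (fibre_prefixes (g \<omega>)) (prefix a \<omega>) \<in> W m" if "\<omega> \<in> X" for \<omega>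
    using L[OF gX[OF that]] pre[OF that] by (rule bij_betwE[rule_format])
  have f_suffix: "suffix m (f \<omega>) = g \<omega>" if "\<omega> \<in> X" for \<omega>
    using Lpre[OF that] by (simp add: f_def words_length)
  have f_prefix: "prefix m (f \<omega>) = L (fibre_prefixes (g \<omega>)) (prefix a \<omega>)" if "\<omega> \<in> X" for \<omega>
    using Lpre[OF that] by (simp add: f_def words_length prefix_conc_length)
  have inv: "inv_into (fibre_prefixes (suffix m \<omega>)) (L (fibre_prefixes (suffix m \<omega>))) (prefix m \<omega>)
      \<in> fibre_prefixes (suffix m \<omega>)" if "\<omega> \<in> X" for \<omega>
    using bij_betw_inv_into[OF L[OF iwords_suffix[OF that]]] words_prefix[OF that] by (rule bij_betwE[rule_format])
  then have invW: "inv_into (fibre_prefixes (suffix m \<omega>)) (L (fibre_prefixes (suffix m \<omega>))) (prefix m \<omega>) \<in> W a"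
    if "\<omega> \<in> X" for \<omega>
    using that unfolding fibre_prefixes_def[of "suffix m \<omega>"] by (auto simp: fibre_prefixes_def)
  have f'_suffix: "suffix a (f' \<omega>) = h (suffix m \<omega>)" if "\<omega> \<in> X" for \<omega>
    using invW[OF that] by (simp add: f'_def words_length)
  have g_f': "g (f' \<omega>) = suffix m \<omega>" if "\<omega> \<in> X" for \<omega>
    using inv[OF that] by (auto simp: f'_def fibre_prefixes_def)
  have f'X: "f' \<omega> \<in> X" if "\<omega> \<in> X" for \<omega>
    unfolding f'_def using invW[OF that] hX iwords_suffix[OF that] by (auto intro: iwords_conc)
  have fX: "f \<omega> \<in> X" if "\<omega> \<in> X" for \<omega>
    unfolding f_def using Lpre[OF that] gX[OF that] by (rule iwords_conc)
  have "f \<in> G_homeos"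
  proof (rule G_homeosI)
    show "f ` X \<subseteq> X" "f' ` X \<subseteq> X" using fX f'X by auto
    show "f' (f \<omega>) = \<omega>" if "\<omega> \<in> X" for \<omega>
      unfolding f'_def f_suffix[OF that] f_prefix[OF that]
      using bij_betw_inv_into_left[OF L[OF gX[OF that]] pre[OF that]] by (simp add: hg that)
    show "f (f' \<omega>) = \<omega>" if "\<omega> \<in> X" for \<omega>
    proof -
      have "prefix a (f' \<omega>) = inv_into (fibre_prefixes (suffix m \<omega>)) (L (fibre_prefixes (suffix m \<omega>))) (prefix m \<omega>)"
        using invW[OF that] by (simp add: f'_def words_length prefix_conc_length)
      then show ?thesis
        unfolding f_def g_f'[OF that]
        using bij_betw_inv_into_right[OF L[OF iwords_suffix[OF that]] words_prefix[OF that]] by simp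
    qed
    obtain l where l: "l \<ge> a" "\<And>\<omega> \<eta>. \<omega> \<in> X \<Longrightarrow> \<eta> \<in> X \<Longrightarrow> prefix l \<omega> = prefix l \<eta> \<Longrightarrow> prefix K (g \<omega>) = prefix K (g \<eta>)"
      by (rule word_contD[OF g_cont, of a K]) blast
    show "word_cont f"
      unfolding f_def[abs_def]
    proof (rule word_cont_conc[OF _ g_cont])
      fix \<omega> \<eta> assume e: "\<omega> \<in> X" "\<eta> \<in> X" "prefix l \<omega> = prefix l \<eta>"
      have "fibre_prefixes (g \<omega>) = fibre_prefixes (g \<eta>)" using e by (intro K gX l(2))
      moreover have "prefix a \<omega> = prefix a \<eta>" by (rule prefix_eq_mono[OF e(3) l(1)])
      ultimately show "L (fibre_prefixes (g \<omega>)) (prefix a \<omega>) = L (fibre_prefixes (g \<eta>)) (prefix a \<eta>)"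
        by (simp only:)
    qed
    show "word_cont f'"
      unfolding f'_def[abs_def]
    proof (rule word_cont_conc)
      show "word_cont (\<lambda>\<omega>. h (suffix m \<omega>))"
        using word_cont_comp[OF h_cont word_cont_suffix[of m]] iwords_suffix by (auto simp: o_def)
      fix \<omega> \<eta> assume e: "\<omega> \<in> X" "\<eta> \<in> X" "prefix (m + K) \<omega> = prefix (m + K) \<eta>"
      then have "prefix K (suffix m \<omega>) = prefix K (suffix m \<eta>)" "prefix m \<omega> = prefix m \<eta>"
        unfolding prefix_eq_iff by auto
      moreover from this have "fibre_prefixes (suffix m \<omega>) = fibre_prefixes (suffix m \<eta>)"
        using e by (intro K iwords_suffix)
      ultimately show "inv_into (fibre_prefixes (suffix m \<omega>)) (L (fibre_prefixes (suffix m \<omega>))) (prefix m \<omega>) =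
          inv_into (fibre_prefixes (suffix m \<eta>)) (L (fibre_prefixes (suffix m \<eta>))) (prefix m \<eta>)"
        by (simp only:)
    qed
    show "commutes_from m f"
      unfolding commutes_from_def
    proof
      fix \<omega> assume w: "\<omega> \<in> X"
      have "suffix (Suc m) (f \<omega>) = suffix 1 (suffix m (f \<omega>))" by simp
      then show "suffix m (f (suffix 1 \<omega>)) = suffix (Suc m) (f \<omega>)"
        unfolding f_suffix[OF w] f_suffix[OF iwords_suffix[OF w]] g_suffix[OF w] by simp
    qed
    show "commutes_from a f'"
      unfolding commutes_from_def
    proof
      fix \<omega> assume w: "\<omega> \<in> X"
      have "suffix (Suc a) (f' \<omega>) = suffix 1 (suffix a (f' \<omega>))" by simp
      then show "suffix a (f' (suffix 1 \<omega>)) = suffix (Suc a) (f' \<omega>)"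
        unfolding f'_suffix[OF w] f'_suffix[OF iwords_suffix[OF w]] h_suffix[OF iwords_suffix[OF w], symmetric]
        by (simp add: add.commute)
    qed
  qed
  then show ?thesis using f_suffix by (rule that)
qed

end

text \<open>A coordinate of the image needs r coordinates on either side. Reading the image from
  coordinate r on therefore uses nonnegative coordinates only, and the invented past in
  \<open>lift\<close> has no influence.\<close>

definition one_sided :: "nat \<Rightarrow> ((int \<Rightarrow> nat) \<Rightarrow> int \<Rightarrow> nat) \<Rightarrow> nat word \<Rightarrow> nat word" where
  "one_sided r \<psi> \<omega> = tail (int r) (\<psi> (lift \<omega>))"

lemma one_sided_tail:
  assumes code: "local_code n r \<psi>"
    and com: "\<forall>x\<in>Sig n. \<forall>j. \<psi> (zshift j x) = zshift j (\<psi> x)"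
    and x: "x \<in> Sig n"
  shows "one_sided r \<psi> (tail b x) = tail (b + int r) (\<psi> x)"
proof
  fix i
  let ?y = "lift (tail b x)"
  have y: "?y \<in> Sig n" using x by (intro lift_in tail_in)
  \<comment> \<open>Coordinate r + i of the image reads coordinates i to i + 2r, all nonnegative,
    and there \<open>?y\<close> agrees with x shifted by b.\<close>
  have "zshift (int r + int i) ?y t = zshift (b + int r + int i) x t" if "\<bar>t\<bar> \<le> int r" for t
    using that by (auto simp: zshift_def lift_def tail_def algebra_simps)
  then have "\<psi> (zshift (int r + int i) ?y) 0 = \<psi> (zshift (b + int r + int i) x) 0"
    using code zshift_in[OF x] zshift_in[OF y] unfolding local_code_def by blast
  then have "zshift (int r + int i) (\<psi> ?y) 0 = zshift (b + int r + int i) (\<psi> x) 0"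
    by (simp add: com x y)
  then show "one_sided r \<psi> (tail b x) i = tail (b + int r) (\<psi> x) i"
    by (simp add: one_sided_def tail_def zshift_def)
qed

lemma one_sided_props:
  assumes code: "local_code n r \<psi>"
    and com: "\<forall>x\<in>Sig n. \<forall>j. \<psi> (zshift j x) = zshift j (\<psi> x)"
    and \<psi>: "\<psi> \<in> Sig n \<rightarrow> Sig n"
  shows "\<forall>\<omega>\<in>X. one_sided r \<psi> \<omega> \<in> X" "word_cont (one_sided r \<psi>)" "commutes_from 0 (one_sided r \<psi>)"
proof -
  show "\<forall>\<omega>\<in>X. one_sided r \<psi> \<omega> \<in> X"
    unfolding one_sided_def using \<psi> lift_in tail_in by blast
  show "commutes_from 0 (one_sided r \<psi>)"
    unfolding commutes_from_def
  proof
    fix \<omega> assume w: "\<omega> \<in> X"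
    have "one_sided r \<psi> (tail 1 (lift \<omega>)) = suffix 1 (one_sided r \<psi> \<omega>)"
      unfolding one_sided_tail[OF code com lift_in[OF w]] by (simp add: one_sided_def[of r \<psi> \<omega>] add.commute)
    then show "suffix 0 (one_sided r \<psi> (suffix 1 \<omega>)) = suffix (Suc 0) (one_sided r \<psi> \<omega>)"
      using tail_lift[of 1 \<omega>] by simp
  qed
  show "word_cont (one_sided r \<psi>)"
    unfolding word_cont_def
  proof
    fix k
    \<comment> \<open>Output letter i reads input letters i to i + 2r, so k output letters are
      settled by k + 2r input letters.\<close>
    have "prefix k (one_sided r \<psi> \<omega>) = prefix k (one_sided r \<psi> \<eta>)"
      if e: "\<omega> \<in> X" "\<eta> \<in> X" "prefix (k + 2 * r) \<omega> = prefix (k + 2 * r) \<eta>" for \<omega> \<eta>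
      unfolding prefix_eq_iff
    proof (intro allI impI)
      fix i assume "i < k"
      then have "zshift (int (r + i)) (lift \<omega>) t = zshift (int (r + i)) (lift \<eta>) t" if "\<bar>t\<bar> \<le> int r" for t
        using that e(3) by (auto simp: zshift_def lift_def prefix_eq_iff)
      then have "\<psi> (zshift (int (r + i)) (lift \<omega>)) 0 = \<psi> (zshift (int (r + i)) (lift \<eta>)) 0"
        using code zshift_in lift_in e(1,2) unfolding local_code_def by blast
      then show "one_sided r \<psi> \<omega> i = one_sided r \<psi> \<eta> i"
        using com lift_in e(1,2) by (simp add: one_sided_def tail_def zshift_def)
    qed
    then show "\<exists>m. \<forall>\<omega>\<in>X. \<forall>\<eta>\<in>X. prefix m \<omega> = prefix m \<eta> \<longrightarrow>
        prefix k (one_sided r \<psi> \<omega>) = prefix k (one_sided r \<psi> \<eta>)"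
      by (intro exI[of _ "k + 2 * r"]) blast
  qed
qed

text \<open>Each of the two codes starts reading r places late, so the delays add up to 2r although
  the two-sided maps cancel.\<close>

lemma one_sided_compose:
  assumes code: "local_code n r \<phi>"
    and com: "\<forall>x\<in>Sig n. \<forall>j. \<phi> (zshift j x) = zshift j (\<phi> x)"
    and \<psi>: "\<psi> \<in> Sig n \<rightarrow> Sig n" and inv: "\<forall>x\<in>Sig n. \<phi> (\<psi> x) = x"
  shows "\<forall>\<omega>\<in>X. one_sided r \<phi> (one_sided r \<psi> \<omega>) = suffix (2 * r) \<omega>"
proof
  fix \<omega> assume w: "\<omega> \<in> X"
  have "\<psi> (lift \<omega>) \<in> Sig n" using \<psi> lift_in[OF w] by blast
  then have "one_sided r \<phi> (tail (int r) (\<psi> (lift \<omega>))) = tail (int r + int r) (\<phi> (\<psi> (lift \<omega>)))"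
    by (rule one_sided_tail[OF code com])
  then show "one_sided r \<phi> (one_sided r \<psi> \<omega>) = suffix (2 * r) \<omega>"
    using inv[rule_format, OF lift_in[OF w]] tail_lift[of "2 * r" \<omega>] by (simp add: one_sided_def)
qed

text \<open>The labelled homeomorphism has the code of \<psi> as its m-th suffix. The code is
  displaced by r and the labels take m letters, so the lifted map is \<psi> followed by the shift to
  the power r - m.\<close>

lemma bar_surj_mod_shift:
  assumes "prime n" and \<psi>: "\<psi> \<in> carrier (shift_Aut n)"
  obtains f j where "f \<in> G_homeos" "\<And>x. x \<in> Sig n \<Longrightarrow> bar f x = zshift j (\<psi> x)"
proof -
  let ?\<phi> = "inv_into (Sig n) \<psi>"
  have B: "\<psi> \<in> Bij (Sig n)" and com: "\<forall>x\<in>Sig n. \<forall>j. \<psi> (zshift j x) = zshift j (\<psi> x)"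
    using \<psi> by (auto simp: shift_Aut_iff)
  obtain r1 r2 where "local_code n r1 \<psi>" "local_code n r2 ?\<phi>"
    using \<psi> by (auto simp: shift_Aut_iff)
  then obtain r where r: "local_code n r \<psi>" "local_code n r ?\<phi>"
    \<comment> \<open>One radius for \<psi> and its inverse makes both composites of their codes the
      same power 2r of the shift.\<close>
    using local_code_mono by (meson max.cobounded1 max.cobounded2)
  have b: "bij_betw \<psi> (Sig n) (Sig n)" using B by (simp add: Bij_def)
  have fs: "\<psi> \<in> Sig n \<rightarrow> Sig n" "?\<phi> \<in> Sig n \<rightarrow> Sig n"
    using b bij_betw_inv_into[OF b] by (simp_all add: bij_betw_imp_funcset)
  have com': "\<forall>x\<in>Sig n. \<forall>j. ?\<phi> (zshift j x) = zshift j (?\<phi> x)"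
    using inv_into_zshift[OF b com] by blast
  have inv: "\<forall>x\<in>Sig n. ?\<phi> (\<psi> x) = x" "\<forall>x\<in>Sig n. \<psi> (?\<phi> x) = x"
    using bij_betw_inv_into_left[OF b] bij_betw_inv_into_right[OF b] by blast+
  note P = one_sided_props[OF r(1) com fs(1)] and P' = one_sided_props[OF r(2) com' fs(2)]
  obtain f m where f: "f \<in> G_homeos" "\<And>\<omega>. \<omega> \<in> X \<Longrightarrow> suffix m (f \<omega>) = one_sided r \<psi> \<omega>"
    using label_fibres[where g = "one_sided r \<psi>" and h = "one_sided r ?\<phi>" and a = "2 * r", OF P(1) P'(1) P(2) P'(2) P(3) P'(3)
        one_sided_compose[OF r(2) com' fs(1) inv(1)] one_sided_compose[OF r(1) com fs(2) inv(2)] assms(1)]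
    by blast
  have "commutes_from m f"
    unfolding commutes_from_def
  proof
    fix \<omega> assume w: "\<omega> \<in> X"
    have "suffix (Suc m) (f \<omega>) = suffix 1 (suffix m (f \<omega>))" by simp
    also have "\<dots> = suffix m (f (suffix 1 \<omega>))"
      using f(2)[OF w] f(2)[OF iwords_suffix[OF w]] P(3) w by (simp add: commutes_from_def)
    finally show "suffix m (f (suffix 1 \<omega>)) = suffix (Suc m) (f \<omega>)" by simp
  qed
  then have "bar f x = zshift (int r - int m) (\<psi> x)" if "x \<in> Sig n" for x
  proof (rule bar_unique[OF _ that])
    fix b
    have "suffix m (f (tail b x)) = tail (b + int r) (\<psi> x)"
      unfolding f(2)[OF tail_in[OF that]] by (rule one_sided_tail[OF r(1) com that])
    then show "suffix m (f (tail b x)) = tail (b + int m) (zshift (int r - int m) (\<psi> x))"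
      by simp
  qed
  then show ?thesis by (rule that[OF f(1)])
qed

end

section \<open>Norm estimates in $C^*$-algebras\<close>

text \<open>The number 2j - N is a sum of N independent random signs, whose variance is N. The
  moments are those of the Bernstein polynomials at 1/2.\<close>

lemma sum_binomial_variance:
  "(\<Sum>j\<le>N. real (N choose j) * (2 * real j - real N)\<^sup>2) = real N * 2 ^ N"
proof -
  have B: "real (N choose j) = 2 ^ N * Bernstein N j (1/2)" if "j \<le> N" for j
    using that by (simp add: Bernstein_def power_add[symmetric] flip: power_mult_distrib)
  have "(\<Sum>j\<le>N. real (N choose j) * (2 * real j - real N)\<^sup>2)
      = (\<Sum>j\<le>N. 2 ^ N * (4 * (real j * (real j - 1) * Bernstein N j (1/2))
          + (4 - 4 * real N) * (real j * Bernstein N j (1/2)) + (real N)\<^sup>2 * Bernstein N j (1/2)))"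
    by (intro sum.cong refl) (simp add: B power2_eq_square algebra_simps)
  also have "\<dots> = 2 ^ N * (4 * (real N * (real N - 1) * (1/2)\<^sup>2) + (4 - 4 * real N) * (real N * (1/2)) + (real N)\<^sup>2)"
    by (simp only: sum_distrib_left[symmetric] sum.distrib sum_kk_Bernstein sum_k_Bernstein sum_Bernstein mult_1_right)
  also have "\<dots> = real N * 2 ^ N"
    by (simp add: power2_eq_square field_simps)
  finally show ?thesis .
qed

text \<open>This is the identity between coefficients behind exp(x + y) = exp(x) exp(y), with the
  factorials cleared.\<close>

lemma binomial_commuting:
  fixes x y :: "'a::{real_normed_algebra_1,banach}"
  assumes "x * y = y * x"
  shows "(x + y) ^ N = (\<Sum>j\<le>N. real (N choose j) *\<^sub>R (x ^ j * y ^ (N - j)))"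
proof -
  have "(x + y) ^ N = fact N *\<^sub>R ((x + y) ^ N /\<^sub>R fact N)" by simp
  also have "\<dots> = (\<Sum>j\<le>N. real (N choose j) *\<^sub>R (x ^ j * y ^ (N - j)))"
    unfolding exp_series_add_commuting[OF assms] scaleR_sum_right
    by (intro sum.cong refl) (simp add: binomial_fact field_simps)
  finally show ?thesis .
qed

text \<open>The unit is an extreme point of the unit ball: for $x = 1 + h$ and $y = 1 - h$, expanding
  $(x - y)(x + y)^{N}$ gives $h$ as an average of the contractions $x^j y^{M-j}$ with the centred
  weights $(2j - M)/M$ of a binomial distribution, whose first absolute moment tends to $0$.\<close>

lemma norm_one_plus_minus_le_oneD:
  fixes h :: "'a::{real_normed_algebra_1,banach}"
  assumes "norm (1 + h) \<le> 1" "norm (1 - h) \<le> 1"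
  shows "h = 0"
proof -
  define x y where "x = 1 + h" and "y = 1 - h"
  have xy: "x * y = y * x" "x + y = 2" "x - y = 2 *\<^sub>R h"
    by (auto simp: x_def y_def algebra_simps scaleR_2)
  have bound: "norm h \<le> 1 / real s" if s: "s > 0" for s :: nat
  proof -
    \<comment> \<open>With M = s^2 the first absolute moment is at most the square root s of the
      variance, and division by M leaves the bound 1/s.\<close>
    define N M where "N = s * s - 1" and "M = Suc N"
    have M: "real M = (real s)\<^sup>2" using s by (simp add: N_def M_def power2_eq_square flip: of_nat_mult)
    let ?t = "\<lambda>j. x ^ j * y ^ (M - j)"
    \<comment> \<open>These absorption identities rewrite the coefficients of x and of y times the
      N-th power in terms of row M; their difference is the centred weight 2j - M.\<close>
    have choose1: "real (M choose Suc j) * real (Suc j) = real M * real (N choose j)" for j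
      using Suc_times_binomial_eq[of N j] unfolding M_def by (simp only: of_nat_mult[symmetric])
    have choose2: "real (M choose j) * real (M - j) = real M * real (N choose j)" if "j \<le> N" for j
      using binomial_absorb_comp[of M j] unfolding M_def diff_Suc_1 of_nat_mult[symmetric]
      by (simp only: mult.commute)
    have shift: "x * (x ^ j * y ^ (N - j)) = ?t (Suc j)" "y * (x ^ j * y ^ (N - j)) = ?t j" if "j \<le> N" for j
    proof -
      show "x * (x ^ j * y ^ (N - j)) = ?t (Suc j)" by (simp add: M_def mult.assoc)
      have "y * x ^ j = x ^ j * y" using xy(1) by (simp add: power_commuting_commutes)
      then show "y * (x ^ j * y ^ (N - j)) = ?t j" using that by (simp add: M_def Suc_diff_le mult.assoc[symmetric])
    qed
    have two: "(2::'a) ^ N = 2 ^ N *\<^sub>R 1" by (simp add: scaleR_conv_of_real)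
    have "(2 ^ N * 2) *\<^sub>R h = 2 ^ N *\<^sub>R (x - y)" by (simp add: xy(3))
    also have "\<dots> = (x - y) * (x + y) ^ N"
      unfolding xy(2) two mult_scaleR_right by simp
    also have "\<dots> = (\<Sum>j\<le>N. real (N choose j) *\<^sub>R ?t (Suc j)) - (\<Sum>j\<le>N. real (N choose j) *\<^sub>R ?t j)"
      unfolding binomial_commuting[OF xy(1)] left_diff_distrib sum_distrib_left sum_subtractf
      by (intro arg_cong2[where f = "(-)"] sum.cong refl) (simp_all only: mult_scaleR_right shift atMost_iff)
    finally have "(real M * 2 ^ M) *\<^sub>R h =
        (\<Sum>j\<le>N. (real M * real (N choose j)) *\<^sub>R ?t (Suc j)) - (\<Sum>j\<le>N. (real M * real (N choose j)) *\<^sub>R ?t j)"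
      unfolding M_def[symmetric] scaleR_scaleR[symmetric] scaleR_sum_right[symmetric] scaleR_diff_right[symmetric]
      by (simp add: M_def mult.commute)
    also have "(\<Sum>j\<le>N. (real M * real (N choose j)) *\<^sub>R ?t (Suc j)) = (\<Sum>j\<le>M. (real (M choose j) * real j) *\<^sub>R ?t j)"
      unfolding M_def sum.atMost_Suc_shift by (simp add: choose1[unfolded M_def] del: binomial_Suc_Suc of_nat_Suc)
    also have "(\<Sum>j\<le>N. (real M * real (N choose j)) *\<^sub>R ?t j) = (\<Sum>j\<le>M. (real (M choose j) * real (M - j)) *\<^sub>R ?t j)"
      using choose2 by (simp add: M_def)
    also have "(\<Sum>j\<le>M. (real (M choose j) * real j) *\<^sub>R ?t j) - (\<Sum>j\<le>M. (real (M choose j) * real (M - j)) *\<^sub>R ?t j)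
        = (\<Sum>j\<le>M. (real (M choose j) * (2 * real j - real M)) *\<^sub>R ?t j)"
      unfolding sum_subtractf[symmetric] scaleR_diff_left[symmetric] right_diff_distrib[symmetric]
      by (intro sum.cong refl) (simp add: of_nat_diff)
    finally have "(real M * 2 ^ M) *\<^sub>R h = (\<Sum>j\<le>M. (real (M choose j) * (2 * real j - real M)) *\<^sub>R ?t j)" .
    then have "real M * 2 ^ M * norm h = norm (\<Sum>j\<le>M. (real (M choose j) * (2 * real j - real M)) *\<^sub>R ?t j)"
      by (metis abs_of_nonneg mult_nonneg_nonneg norm_scaleR of_nat_0_le_iff zero_le_numeral zero_le_power)
    also have "\<dots> \<le> (\<Sum>j\<le>M. real (M choose j) * \<bar>2 * real j - real M\<bar>)"
    proof (rule sum_norm_le)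
      fix j
      have "norm (?t j) \<le> norm x ^ j * norm y ^ (M - j)"
        by (meson norm_mult_ineq norm_power_ineq mult_mono norm_ge_zero order_trans zero_le_power)
      also have "\<dots> \<le> 1 * 1"
        using assms by (intro mult_mono power_le_one) (auto simp: x_def y_def)
      finally have "norm (?t j) \<le> 1" by simp
      then show "norm ((real (M choose j) * (2 * real j - real M)) *\<^sub>R ?t j) \<le> real (M choose j) * \<bar>2 * real j - real M\<bar>"
        using mult_left_mono[of "norm (?t j)" 1 "real (M choose j) * \<bar>2 * real j - real M\<bar>"] by (simp add: abs_mult)
    qed
    \<comment> \<open>The arithmetic-geometric mean inequality with parameter s trades the absolute
      value for the square, whose mean is known.\<close>
    also have "\<dots> \<le> (\<Sum>j\<le>M. real (M choose j) * (real s / 2 + (2 * real j - real M)\<^sup>2 / (2 * real s)))"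
    proof (intro sum_mono mult_left_mono)
      fix j
      have "0 \<le> (\<bar>2 * real j - real M\<bar> - real s)\<^sup>2" by simp
      then have "\<bar>2 * real j - real M\<bar> * (2 * real s) \<le> (real s)\<^sup>2 + (2 * real j - real M)\<^sup>2"
        by (simp add: power2_diff algebra_simps)
      then show "\<bar>2 * real j - real M\<bar> \<le> real s / 2 + (2 * real j - real M)\<^sup>2 / (2 * real s)"
        using s by (simp add: field_simps power2_eq_square)
    qed simp
    also have "\<dots> = real s / 2 * (\<Sum>j\<le>M. real (M choose j)) +
        (\<Sum>j\<le>M. real (M choose j) * (2 * real j - real M)\<^sup>2) / (2 * real s)"
      by (simp add: distrib_left sum.distrib sum_distrib_left sum_divide_distrib mult.commute)
    also have "(\<Sum>j\<le>M. real (M choose j)) = 2 ^ M"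
      using choose_row_sum[of M] by (simp flip: of_nat_sum)
    also have "real s / 2 * 2 ^ M + (\<Sum>j\<le>M. real (M choose j) * (2 * real j - real M)\<^sup>2) / (2 * real s) = 2 ^ M * real s"
      using s unfolding sum_binomial_variance by (simp add: M field_simps power2_eq_square)
    finally have "(real s)\<^sup>2 * norm h \<le> real s" unfolding M by (simp add: mult.assoc mult.left_commute)
    then show ?thesis using s by (simp add: field_simps power2_eq_square)
  qed
  have "norm h \<le> 0"
  proof (rule field_le_epsilon)
    fix e :: real assume "e > 0"
    then obtain s where "s > 0" "1 / real s < e" by (metis nat_approx_posE of_nat_Suc zero_less_Suc)
    then show "norm h \<le> 0 + e" using bound[of s] by simp
  qed
  then show ?thesis by simp
qed

lemma adj_zero [simp]: "adj (0::'a::cstar_algebra) = 0"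
  using adj_add[of 0 "0::'a"] by simp

lemma adj_scaleR: "adj (r *\<^sub>R x) = r *\<^sub>R adj (x::'a::cstar_algebra)"
  by (simp flip: scaleC_of_real add: adj_scaleC)

lemma adj_one [simp]: "adj (1::'a::cstar_algebra) = 1"
  by (metis adj_adj adj_mult mult.right_neutral)

lemma adj_minus: "adj (- x) = - adj (x::'a::cstar_algebra)"
  using adj_scaleR[of "-1" x] by simp

lemma adj_diff: "adj (x - y) = adj x - adj (y::'a::cstar_algebra)"
  using adj_add[of x "- y"] by (simp add: adj_minus)

lemma adj_sum: "adj (\<Sum>i\<in>I. f i) = (\<Sum>i\<in>I. adj (f i :: 'a::cstar_algebra))"
  by (induction I rule: infinite_finite_induct) (simp_all add: adj_add)

lemma norm_adj [simp]: "norm (adj x) = norm (x::'a::cstar_algebra)"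
proof -
  have le: "norm y \<le> norm (adj y)" for y :: 'a
  proof (cases "y = 0")
    case False
    have "norm y * norm y \<le> norm (adj y) * norm y"
      using cstar_identity[of y] norm_mult_ineq[of "adj y" y] by (simp add: power2_eq_square)
    then show ?thesis using False by simp
  qed simp
  show ?thesis using le[of x] le[of "adj x"] by (simp add: adj_adj)
qed

lemma bounded_linear_adj: "bounded_linear (adj :: 'a::cstar_algebra \<Rightarrow> 'a)"
  by (rule bounded_linear_intro[where K = 1]) (simp_all add: adj_add adj_scaleR)

lemma bounded_linear_scaleC: "bounded_linear ((*C) c :: 'a::cstar_algebra \<Rightarrow> 'a)"
  by (rule bounded_linear_intro[where K = "cmod c"])
    (simp_all add: scaleC_add_right norm_scaleC mult.commute scaleC_scaleC flip: scaleC_of_real)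

lemma scaleC_one [simp]: "1 *C x = (x::'a::cstar_algebra)"
  by (rule complex_vector.scale_one)

lemma adj_mult_self_eq_0_iff: "adj x * x = 0 \<longleftrightarrow> (x::'a::cstar_algebra) = 0"
  using cstar_identity[of x] by auto

lemma norm_projection_le_one:
  assumes "adj p = p" "p * p = (p::'a::cstar_algebra)"
  shows "norm p \<le> 1"
  using cstar_identity[of p] assms by (metis le_numeral_extra(4) mult_cancel_left1 power2_eq_square zero_le_one)

lemma norm_isometry:
  assumes "adj s * s = (1::'a::cstar_algebra)" shows "norm s = 1"
  using cstar_identity[of s] assms by (simp add: power2_eq_1_iff) (smt (verit) norm_ge_zero)

section \<open>Words in the Cuntz isometries\<close>

lemma sum_words_add:
  "(\<Sum>\<mu>\<in>words n (k + l). f \<mu>) = (\<Sum>\<mu>\<in>words n k. \<Sum>\<nu>\<in>words n l. f (\<mu> @ \<nu>))"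
proof -
  have "bij_betw (\<lambda>(\<mu>, \<nu>). \<mu> @ \<nu>) (words n k \<times> words n l) (words n (k + l))"
    by (rule bij_betw_byWitness[where f' = "\<lambda>\<mu>. (take k \<mu>, drop k \<mu>)"])
      (auto simp: words_def simp del: atLeastAtMost_iff dest: in_set_takeD in_set_dropD)
  from sum.reindex_bij_betw[OF this, of f] show ?thesis
    by (simp add: sum.cartesian_product case_prod_unfold)
qed

lemma words_1: "words n 1 = (\<lambda>i. [i]) ` {1..n}"
  by (auto simp: words_def length_Suc_conv)

lemma words_0 [simp]: "words n 0 = {[]}"
  by (auto simp: words_def)

lemma sum_words_Suc: "(\<Sum>\<mu>\<in>words n (Suc k). f \<mu>) = (\<Sum>i=1..n. \<Sum>\<mu>\<in>words n k. f (i # \<mu>))"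
  using sum_words_add[of f n 1 k] unfolding words_1
  by (subst (asm) sum.reindex) (simp_all add: inj_on_def)

locale cuntz = alphabet n for n :: nat +
  fixes S :: "nat \<Rightarrow> 'a::cstar_algebra"
  assumes is_cuntz: "is_cuntz_algebra n S"
begin

lemma isometry: "i \<in> {1..n} \<Longrightarrow> adj (S i) * S i = 1"
  using is_cuntz by (simp add: is_cuntz_algebra_def)

lemma sum_ranges: "(\<Sum>i=1..n. S i * adj (S i)) = 1"
  using is_cuntz by (simp add: is_cuntz_algebra_def)

text \<open>The elements \<open>h k\<close> are compressions of range projections, with total 1 and
  \<open>h j = 1\<close>, so those with k different from j sum to 0. Positivity would make each of
  them vanish; here \<open>h i\<close>, scaled by 1/n, is shown to perturb 1 within the unit ball in
  both directions, and 1 is extreme.\<close>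

lemma orthogonal:
  assumes i: "i \<in> {1..n}" and j: "j \<in> {1..n}" and "i \<noteq> j"
  shows "adj (S i) * S j = 0"
proof -
  define h where "h k = adj (S j) * (S k * adj (S k)) * S j" for k
  have h_eq: "h k = adj (adj (S k) * S j) * (adj (S k) * S j)" for k
    by (simp add: h_def adj_mult adj_adj mult.assoc)
  have norm_Sj: "norm (S j) = 1" by (rule norm_isometry[OF isometry[OF j]])
  have le: "norm (1 - h k) \<le> 1" if k: "k \<in> {1..n}" for k
  proof -
    have p: "(S k * adj (S k)) * (S k * adj (S k)) = S k * adj (S k)"
      using isometry[OF k] by (metis mult.assoc mult.left_neutral)
    have "1 - h k = adj (S j) * (1 - S k * adj (S k)) * S j"
      by (simp add: h_def algebra_simps isometry[OF j])
    also have "norm \<dots> \<le> norm (adj (S j)) * norm (1 - S k * adj (S k)) * norm (S j)"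
      by (meson norm_mult_ineq mult_right_mono norm_ge_zero order_trans)
    also have "\<dots> \<le> 1"
      using norm_projection_le_one[of "1 - S k * adj (S k)"] p
      by (simp add: norm_Sj adj_diff adj_mult adj_adj algebra_simps)
    finally show ?thesis .
  qed
  let ?I = "{1..n} - {j}"
  have "(\<Sum>k=1..n. h k) = 1"
    unfolding h_def sum_distrib_left[symmetric] sum_distrib_right[symmetric] sum_ranges
    by (simp add: isometry[OF j])
  moreover have "h j = 1" by (simp add: h_eq isometry[OF j])
  ultimately have "(\<Sum>k\<in>?I. h k) = 0" using j by (simp add: sum_diff1)
  then have hi: "h i = - (\<Sum>k\<in>?I - {i}. h k)" using i \<open>i \<noteq> j\<close> by (simp add: sum_diff1)
  \<comment> \<open>Since \<open>h i\<close> is minus the sum of the remaining \<open>h k\<close>,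
    this is an average of n contractions: the n - 2 elements \<open>1 - h k\<close> and the unit
    counted twice.\<close>
  have eq: "1 + h i /\<^sub>R real n = (1 / real n) *\<^sub>R ((\<Sum>k\<in>?I - {i}. 1 - h k) + 2)"
  proof -
    have card: "card (?I - {i}) = n - 2" using i j \<open>i \<noteq> j\<close> by (simp add: numeral_2_eq_2)
    have "(\<Sum>k\<in>?I - {i}. 1 - h k) = of_nat (n - 2) - (\<Sum>k\<in>?I - {i}. h k)"
      by (simp add: sum_subtractf card del: One_nat_def)
    also have "\<dots> = of_nat (n - 2) + h i" using hi by simp
    finally have "(\<Sum>k\<in>?I - {i}. 1 - h k) + 2 = real n *\<^sub>R 1 + h i"
      using n_ge_2 by (simp add: scaleR_conv_of_real of_nat_diff)
    then show ?thesis using n_ge_2 by (simp add: scaleR_right_distrib divide_inverse)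
  qed
  have "norm ((\<Sum>k\<in>?I - {i}. 1 - h k) + 2) \<le> (\<Sum>k\<in>?I - {i}. 1) + 2"
    by (rule norm_triangle_le, rule add_mono[OF sum_norm_le]) (use le in auto)
  also have "\<dots> = real n" using i j \<open>i \<noteq> j\<close> n_ge_2 by (simp add: of_nat_diff)
  finally have 1: "norm (1 + h i /\<^sub>R real n) \<le> 1"
    unfolding eq using n_ge_2 by (simp add: divide_simps)
  \<comment> \<open>The opposite direction is a convex combination of the contraction
    \<open>1 - h i\<close> and the unit.\<close>
  have "1 - h i /\<^sub>R real n = (1 / real n) *\<^sub>R (1 - h i) + (1 - 1 / real n) *\<^sub>R 1"
    by (simp add: scaleR_right_diff_distrib scaleR_left_diff_distrib divide_inverse)
  also have "norm \<dots> \<le> 1 / real n * norm (1 - h i) + (1 - 1 / real n)"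
    using n_ge_2 by (intro norm_triangle_le) simp
  also have "\<dots> \<le> 1 / real n * 1 + (1 - 1 / real n)"
    using le[OF i] by (intro add_right_mono mult_left_mono) auto
  finally have 2: "norm (1 - h i /\<^sub>R real n) \<le> 1" by simp
  have "h i /\<^sub>R real n = 0" using 1 2 by (rule norm_one_plus_minus_le_oneD)
  then have "h i = 0" using n_ge_2 by simp
  then show ?thesis unfolding h_eq adj_mult_self_eq_0_iff .
qed

abbreviation Sw where "Sw \<equiv> word_isometry S"
abbreviation P where "P \<equiv> word_proj S"

lemma word_isometry_Nil [simp]: "Sw [] = 1"
  by (simp add: word_isometry_def)

lemma word_isometry_Cons: "Sw (i # \<mu>) = S i * Sw \<mu>"
  by (simp add: word_isometry_def)

lemma word_isometry_append: "Sw (\<mu> @ \<nu>) = Sw \<mu> * Sw \<nu>"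
  by (simp add: word_isometry_def)

lemma adj_word_isometry_mult:
  "\<mu> \<in> W k \<Longrightarrow> \<nu> \<in> W k \<Longrightarrow> adj (Sw \<mu>) * Sw \<nu> = (if \<mu> = \<nu> then 1 else 0)"
proof (induction k arbitrary: \<mu> \<nu>)
  case (Suc k)
  obtain i \<mu>' j \<nu>' where eq: "\<mu> = i # \<mu>'" "\<nu> = j # \<nu>'"
    using Suc.prems by (auto simp: words_def length_Suc_conv)
  have ij: "i \<in> {1..n}" "j \<in> {1..n}" and "\<mu>' \<in> W k" "\<nu>' \<in> W k"
    using Suc.prems by (auto simp: words_def eq)
  have "adj (Sw \<mu>) * Sw \<nu> = adj (Sw \<mu>') * (adj (S i) * S j) * Sw \<nu>'"
    by (simp add: eq word_isometry_Cons adj_mult mult.assoc)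
  also have "adj (S i) * S j = (if i = j then 1 else 0)"
    using ij isometry orthogonal by auto
  finally show ?case
    using Suc.IH[OF \<open>\<mu>' \<in> W k\<close> \<open>\<nu>' \<in> W k\<close>] by (auto simp: eq)
qed simp

lemma word_proj_mult:
  assumes "\<mu> \<in> W k" "\<nu> \<in> W k"
  shows "P \<mu> * P \<nu> = (if \<mu> = \<nu> then P \<mu> else 0)"
proof -
  have "P \<mu> * P \<nu> = Sw \<mu> * (adj (Sw \<mu>) * Sw \<nu>) * adj (Sw \<nu>)"
    by (simp add: word_proj_def mult.assoc)
  then show ?thesis using adj_word_isometry_mult[OF assms] by (auto simp: word_proj_def)
qed

lemma adj_word_proj [simp]: "adj (P \<mu>) = P \<mu>"
  by (simp add: word_proj_def adj_mult adj_adj)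

lemma norm_word_isometry: "\<mu> \<in> W k \<Longrightarrow> norm (Sw \<mu>) = 1"
  using adj_word_isometry_mult[of \<mu> k \<mu>] by (intro norm_isometry) simp

lemma norm_word_proj: "\<mu> \<in> W k \<Longrightarrow> norm (P \<mu>) = 1"
  using norm_word_isometry[of \<mu> k] cstar_identity[of "adj (Sw \<mu>)"]
  by (simp add: word_proj_def adj_adj)

lemma word_proj_append: "P (\<mu> @ \<nu>) = Sw \<mu> * P \<nu> * adj (Sw \<mu>)"
  by (simp add: word_proj_def word_isometry_append adj_mult mult.assoc)

lemma sum_word_proj: "(\<Sum>\<mu>\<in>W k. P \<mu>) = 1"
proof (induction k)
  case (Suc k)
  have "(\<Sum>\<mu>\<in>W (Suc k). P \<mu>) = (\<Sum>i=1..n. \<Sum>\<mu>\<in>W k. S i * P \<mu> * adj (S i))"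
    unfolding sum_words_Suc
    by (intro sum.cong refl) (simp add: word_proj_def word_isometry_Cons adj_mult mult.assoc)
  also have "\<dots> = (\<Sum>i=1..n. S i * adj (S i))"
    unfolding sum_distrib_left[symmetric] sum_distrib_right[symmetric] Suc by simp
  finally show ?case by (simp only: sum_ranges)
qed (simp add: word_proj_def)

lemma sum_word_proj_append: "(\<Sum>\<nu>\<in>W l. P (\<mu> @ \<nu>)) = P \<mu>"
  unfolding word_proj_append sum_distrib_left[symmetric] sum_distrib_right[symmetric] sum_word_proj
  by (simp add: word_proj_def)

section \<open>Step functions on words and the supremum norm of the elements they represent\<close>

definition ext :: "nat list \<Rightarrow> nat word" where "ext \<mu> = \<mu> \<frown> ones"

lemma ext_in: "\<mu> \<in> W k \<Longrightarrow> ext \<mu> \<in> X"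
  unfolding ext_def using ones_in by (rule iwords_conc[rotated])

lemma prefix_ext: "\<mu> \<in> W k \<Longrightarrow> prefix k (ext \<mu>) = \<mu>"
  by (simp add: ext_def words_length prefix_conc_length)

text \<open>Each cylinder of length k contributes the value of F at one sample point, its word
  continued by ones. For continuous F these elements converge, see
  \<open>tendsto_\<Phi>\<close>.\<close>

definition step :: "nat \<Rightarrow> (nat word \<Rightarrow> complex) \<Rightarrow> 'a" where
  "step k F = (\<Sum>\<mu>\<in>W k. F (ext \<mu>) *C P \<mu>)"

lemma step_add: "step k (\<lambda>\<omega>. F \<omega> + G \<omega>) = step k F + step k G"
  by (simp add: step_def scaleC_add_left sum.distrib)

lemma step_diff: "step k (\<lambda>\<omega>. F \<omega> - G \<omega>) = step k F - step k G"
  by (simp add: step_def complex_vector.scale_left_diff_distrib sum_subtractf)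

lemma step_scale: "step k (\<lambda>\<omega>. c * F \<omega>) = c *C step k F"
  by (simp add: step_def complex_vector.scale_sum_right scaleC_scaleC)

lemma step_adj: "adj (step k F) = step k (\<lambda>\<omega>. cnj (F \<omega>))"
  by (simp add: step_def adj_sum adj_scaleC)

lemma step_one: "step k (\<lambda>\<omega>. 1) = 1"
  by (simp add: step_def sum_word_proj)

lemma step_cong: "(\<And>\<omega>. \<omega> \<in> X \<Longrightarrow> F \<omega> = G \<omega>) \<Longrightarrow> step k F = step k G"
  unfolding step_def by (intro sum.cong refl) (simp add: ext_in)

lemma step_mult_proj:
  assumes "\<nu> \<in> W k" shows "step k F * P \<nu> = F (ext \<nu>) *C P \<nu>"
proof -
  have "step k F * P \<nu> = (\<Sum>\<mu>\<in>W k. F (ext \<mu>) *C (if \<mu> = \<nu> then P \<mu> else 0))"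
    unfolding step_def sum_distrib_right
    by (intro sum.cong refl) (simp add: mult_scaleC_left word_proj_mult[OF _ assms])
  then show ?thesis using assms by (simp add: if_distrib[of "(*C) _"] sum.delta' cong: if_cong)
qed

lemma step_mult: "step k (\<lambda>\<omega>. F \<omega> * G \<omega>) = step k F * step k G"
proof -
  have "step k F * step k G = (\<Sum>\<nu>\<in>W k. G (ext \<nu>) *C (F (ext \<nu>) *C P \<nu>))"
    unfolding step_def[of k G] sum_distrib_left
    by (intro sum.cong refl) (simp add: mult_scaleC_right step_mult_proj)
  then show ?thesis by (simp add: step_def scaleC_scaleC mult.commute)
qed

text \<open>Each \<open>P \<mu>\<close> is the sum of the projections of its extensions. Keeping the
  coarse sample point lets elements of different levels be compared at a common level, which gives
  the Cauchy property.\<close>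

lemma step_refine: "step k F = step (k + l) (\<lambda>\<omega>. F (ext (prefix k \<omega>)))"
proof -
  have "step (k + l) (\<lambda>\<omega>. F (ext (prefix k \<omega>))) =
      (\<Sum>\<mu>\<in>W k. \<Sum>\<nu>\<in>W l. F (ext \<mu>) *C P (\<mu> @ \<nu>))"
    unfolding step_def sum_words_add
  proof (intro sum.cong refl)
    fix \<mu> \<nu> assume "\<mu> \<in> W k" "\<nu> \<in> W l"
    then have "prefix k (ext (\<mu> @ \<nu>)) = \<mu>"
      by (simp add: ext_def prefix_conc_length words_length flip: conc_conc)
    then show "F (ext (prefix k (ext (\<mu> @ \<nu>)))) *C P (\<mu> @ \<nu>) = F (ext \<mu>) *C P (\<mu> @ \<nu>)" by simp
  qed
  then show ?thesis
    by (simp add: step_def complex_vector.scale_sum_right[symmetric] sum_word_proj_append)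
qed

text \<open>Multiplication by \<open>P \<mu>\<close>, an element of norm 1, isolates the coefficient
  at \<mu>.\<close>

lemma le_norm_step: "\<mu> \<in> W k \<Longrightarrow> cmod (F (ext \<mu>)) \<le> norm (step k F)"
  using norm_mult_ineq[of "step k F" "P \<mu>"] norm_word_proj[of \<mu> k]
  by (simp add: step_mult_proj norm_scaleC)

text \<open>The crude triangle bound loses a factor $n^k$, which the $C^*$-identity removes by
  repeated squaring.\<close>

lemma norm_step_pow_le:
  assumes "\<And>\<omega>. \<omega> \<in> X \<Longrightarrow> cmod (F \<omega>) \<le> B"
  shows "norm (step k F) ^ (2 ^ m) \<le> real (n ^ k) * B ^ (2 ^ m)"
  using assms
proof (induction m arbitrary: F B)
  case 0
  have "norm (step k F) \<le> (\<Sum>\<mu>\<in>W k. B)"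
    unfolding step_def using 0 ext_in by (intro sum_norm_le) (simp add: norm_scaleC norm_word_proj)
  then show ?case by (simp add: card_words)
next
  case (Suc m)
  have "norm (step k F) ^ 2 = norm (step k (\<lambda>\<omega>. cnj (F \<omega>) * F \<omega>))"
    by (simp add: step_mult step_adj[symmetric] cstar_identity)
  moreover have "cmod (cnj (F \<omega>) * F \<omega>) \<le> B ^ 2" if "\<omega> \<in> X" for \<omega>
    using power_mono[OF Suc.prems[OF that] norm_ge_zero, of 2] by (simp add: norm_mult power2_eq_square)
  ultimately have "(norm (step k F) ^ 2) ^ (2 ^ m) \<le> real (n ^ k) * (B ^ 2) ^ (2 ^ m)"
    using Suc.IH[of "\<lambda>\<omega>. cnj (F \<omega>) * F \<omega>" "B ^ 2"] by simp
  then show ?case by (simp add: power_mult[symmetric])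
qed

lemma norm_step_le:
  assumes F: "\<And>\<omega>. \<omega> \<in> X \<Longrightarrow> cmod (F \<omega>) \<le> B"
  shows "norm (step k F) \<le> B"
proof (rule ccontr)
  assume "\<not> norm (step k F) \<le> B"
  moreover have "B \<ge> 0" using F[OF ones_in] norm_ge_zero order_trans by blast
  \<comment> \<open>A positive C strictly between B and the norm keeps the quotient below defined
    when B = 0; its powers would outgrow the constant n^k.\<close>
  ultimately obtain C where C: "B < C" "C < norm (step k F)" "C > 0"
    using dense[of B "norm (step k F)"] by auto
  let ?q = "norm (step k F) / C"
  have "?q > 1" using C by simp
  then obtain m where m: "real (n ^ k) < ?q ^ m" using real_arch_pow by blast
  also have "?q ^ m \<le> ?q ^ (2 ^ m)" using \<open>?q > 1\<close> by (intro power_increasing) auto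
  also have "\<dots> \<le> real (n ^ k)"
    using norm_step_pow_le[of F C k m] F C by (force simp: power_divide field_simps)
  finally show False by simp
qed

end

section \<open>Gelfand duality for the diagonal\<close>

context cuntz
begin

text \<open>$C(X)$; by compactness, continuity is the same as being uniformly approximated by functions of
  finite prefixes, and values outside \<open>X\<close> are irrelevant.\<close>

definition CX :: "(nat word \<Rightarrow> complex) set" where
  "CX = {F. \<forall>\<epsilon>>0. \<exists>k. \<forall>\<omega>\<in>X. \<forall>\<eta>\<in>X. prefix k \<omega> = prefix k \<eta> \<longrightarrow> cmod (F \<omega> - F \<eta>) < \<epsilon>}"

lemma CX_D:
  assumes "F \<in> CX" "\<epsilon> > 0"
  obtains k where "\<And>\<omega> \<eta> l. \<omega> \<in> X \<Longrightarrow> \<eta> \<in> X \<Longrightarrow> l \<ge> k \<Longrightarrow> prefix l \<omega> = prefix l \<eta> \<Longrightarrow> cmod (F \<omega> - F \<eta>) < \<epsilon>"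
proof -
  obtain k where k: "\<forall>\<omega>\<in>X. \<forall>\<eta>\<in>X. prefix k \<omega> = prefix k \<eta> \<longrightarrow> cmod (F \<omega> - F \<eta>) < \<epsilon>"
    using assms unfolding CX_def by blast
  show ?thesis by (rule that[of k]) (use k prefix_eq_mono in blast)
qed

lemma CX_I:
  assumes "\<And>\<epsilon>. \<epsilon> > 0 \<Longrightarrow> \<exists>k. \<forall>\<omega>\<in>X. \<forall>\<eta>\<in>X. prefix k \<omega> = prefix k \<eta> \<longrightarrow> cmod (F \<omega> - F \<eta>) < \<epsilon>"
  shows "F \<in> CX"
  using assms unfolding CX_def by blast

lemma CX_bounded:
  assumes "F \<in> CX" obtains B where "B > 0" "\<And>\<omega>. \<omega> \<in> X \<Longrightarrow> cmod (F \<omega>) \<le> B"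
proof -
  obtain k where k: "\<And>\<omega> \<eta> l. \<omega> \<in> X \<Longrightarrow> \<eta> \<in> X \<Longrightarrow> l \<ge> k \<Longrightarrow> prefix l \<omega> = prefix l \<eta> \<Longrightarrow> cmod (F \<omega> - F \<eta>) < 1"
    by (rule CX_D[OF assms zero_less_one]) blast
  let ?B = "(\<Sum>\<mu>\<in>W k. cmod (F (ext \<mu>))) + 1"
  have "cmod (F \<omega>) \<le> ?B" if "\<omega> \<in> X" for \<omega>
  proof -
    have p: "prefix k \<omega> \<in> W k" using that by (rule words_prefix)
    have "cmod (F \<omega> - F (ext (prefix k \<omega>))) < 1"
      using p that by (intro k[of _ _ k] ext_in) (auto simp: prefix_ext)
    moreover have "cmod (F (ext (prefix k \<omega>))) \<le> (\<Sum>\<mu>\<in>W k. cmod (F (ext \<mu>)))"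
      using p by (intro member_le_sum) auto
    ultimately show ?thesis using norm_triangle_sub[of "F \<omega>" "F (ext (prefix k \<omega>))"] by linarith
  qed
  moreover have "?B > 0" by (intro add_nonneg_pos sum_nonneg) auto
  ultimately show ?thesis using that by blast
qed

lemma CX_const: "(\<lambda>\<omega>. c) \<in> CX"
  by (rule CX_I) auto

lemma CX_local: "(\<lambda>\<omega>. c (prefix k \<omega>)) \<in> CX"
  by (rule CX_I, rule exI[of _ k]) auto

lemma CX_add:
  assumes "F \<in> CX" "G \<in> CX" shows "(\<lambda>\<omega>. F \<omega> + G \<omega>) \<in> CX"
proof (rule CX_I)
  fix \<epsilon> :: real assume "\<epsilon> > 0"
  then have e: "\<epsilon> / 2 > 0" by simp
  obtain k where k: "\<And>\<omega> \<eta> m. \<omega> \<in> X \<Longrightarrow> \<eta> \<in> X \<Longrightarrow> m \<ge> k \<Longrightarrow> prefix m \<omega> = prefix m \<eta> \<Longrightarrow> cmod (F \<omega> - F \<eta>) < \<epsilon> / 2"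
    by (rule CX_D[OF assms(1) e]) blast
  obtain l where l: "\<And>\<omega> \<eta> m. \<omega> \<in> X \<Longrightarrow> \<eta> \<in> X \<Longrightarrow> m \<ge> l \<Longrightarrow> prefix m \<omega> = prefix m \<eta> \<Longrightarrow> cmod (G \<omega> - G \<eta>) < \<epsilon> / 2"
    by (rule CX_D[OF assms(2) e]) blast
  show "\<exists>k. \<forall>\<omega>\<in>X. \<forall>\<eta>\<in>X. prefix k \<omega> = prefix k \<eta> \<longrightarrow> cmod (F \<omega> + G \<omega> - (F \<eta> + G \<eta>)) < \<epsilon>"
  proof (intro exI ballI impI)
    fix \<omega> \<eta> assume h: "\<omega> \<in> X" "\<eta> \<in> X" "prefix (max k l) \<omega> = prefix (max k l) \<eta>"
    show "cmod (F \<omega> + G \<omega> - (F \<eta> + G \<eta>)) < \<epsilon>"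
      using norm_diff_triangle_ineq[of "F \<omega>" "G \<omega>" "F \<eta>" "G \<eta>"]
        k[OF h(1,2) max.cobounded1 h(3)] l[OF h(1,2) max.cobounded2 h(3)] by linarith
  qed
qed

lemma CX_mult:
  assumes "F \<in> CX" "G \<in> CX" shows "(\<lambda>\<omega>. F \<omega> * G \<omega>) \<in> CX"
proof (rule CX_I)
  fix \<epsilon> :: real assume e: "\<epsilon> > 0"
  obtain A where A: "A > 0" "\<And>\<omega>. \<omega> \<in> X \<Longrightarrow> cmod (F \<omega>) \<le> A" by (rule CX_bounded[OF assms(1)]) blast
  obtain B where B: "B > 0" "\<And>\<omega>. \<omega> \<in> X \<Longrightarrow> cmod (G \<omega>) \<le> B" by (rule CX_bounded[OF assms(2)]) blast
  have "\<epsilon> / (2 * B) > 0" "\<epsilon> / (2 * A) > 0" using e A(1) B(1) by simp_all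
  obtain k where k: "\<And>\<omega> \<eta> m. \<omega> \<in> X \<Longrightarrow> \<eta> \<in> X \<Longrightarrow> m \<ge> k \<Longrightarrow> prefix m \<omega> = prefix m \<eta> \<Longrightarrow> cmod (F \<omega> - F \<eta>) < \<epsilon> / (2 * B)"
    by (rule CX_D[OF assms(1) \<open>\<epsilon> / (2 * B) > 0\<close>]) blast
  obtain l where l: "\<And>\<omega> \<eta> m. \<omega> \<in> X \<Longrightarrow> \<eta> \<in> X \<Longrightarrow> m \<ge> l \<Longrightarrow> prefix m \<omega> = prefix m \<eta> \<Longrightarrow> cmod (G \<omega> - G \<eta>) < \<epsilon> / (2 * A)"
    by (rule CX_D[OF assms(2) \<open>\<epsilon> / (2 * A) > 0\<close>]) blast
  show "\<exists>k. \<forall>\<omega>\<in>X. \<forall>\<eta>\<in>X. prefix k \<omega> = prefix k \<eta> \<longrightarrow> cmod (F \<omega> * G \<omega> - F \<eta> * G \<eta>) < \<epsilon>"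
  proof (intro exI ballI impI)
    fix \<omega> \<eta> assume h: "\<omega> \<in> X" "\<eta> \<in> X" "prefix (max k l) \<omega> = prefix (max k l) \<eta>"
    have "F \<omega> * G \<omega> - F \<eta> * G \<eta> = (F \<omega> - F \<eta>) * G \<omega> + F \<eta> * (G \<omega> - G \<eta>)" by (simp add: algebra_simps)
    then have "cmod (F \<omega> * G \<omega> - F \<eta> * G \<eta>) \<le> cmod (F \<omega> - F \<eta>) * cmod (G \<omega>) + cmod (F \<eta>) * cmod (G \<omega> - G \<eta>)"
      by (metis norm_mult norm_triangle_ineq)
    also have "\<dots> \<le> cmod (F \<omega> - F \<eta>) * B + A * cmod (G \<omega> - G \<eta>)"
      using A B h by (intro add_mono mult_left_mono mult_right_mono) auto
    also have "\<dots> < \<epsilon> / (2 * B) * B + A * (\<epsilon> / (2 * A))"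
      using A(1) B(1) k[OF h(1,2) max.cobounded1 h(3)] l[OF h(1,2) max.cobounded2 h(3)]
      by (intro add_strict_mono mult_strict_right_mono mult_strict_left_mono) auto
    also have "\<dots> = \<epsilon>" using A(1) B(1) by simp
    finally show "cmod (F \<omega> * G \<omega> - F \<eta> * G \<eta>) < \<epsilon>" .
  qed
qed

lemma CX_scale: "F \<in> CX \<Longrightarrow> (\<lambda>\<omega>. c * F \<omega>) \<in> CX"
  using CX_mult[OF CX_const] by blast

lemma CX_diff: "F \<in> CX \<Longrightarrow> G \<in> CX \<Longrightarrow> (\<lambda>\<omega>. F \<omega> - G \<omega>) \<in> CX"
  using CX_add[OF _ CX_scale[of G "-1"]] by simp

lemma CX_cnj: "F \<in> CX \<Longrightarrow> (\<lambda>\<omega>. cnj (F \<omega>)) \<in> CX"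
  unfolding CX_def by (simp flip: complex_cnj_diff)

lemma CX_inverse:
  assumes "F \<in> CX" "\<delta> > 0" "\<And>\<omega>. \<omega> \<in> X \<Longrightarrow> cmod (F \<omega>) \<ge> \<delta>"
  shows "(\<lambda>\<omega>. inverse (F \<omega>)) \<in> CX"
proof (rule CX_I)
  fix \<epsilon> :: real assume "\<epsilon> > 0"
  then have e: "\<epsilon> * \<delta>\<^sup>2 > 0" using assms(2) by simp
  obtain k where k: "\<And>\<omega> \<eta> m. \<omega> \<in> X \<Longrightarrow> \<eta> \<in> X \<Longrightarrow> m \<ge> k \<Longrightarrow> prefix m \<omega> = prefix m \<eta> \<Longrightarrow> cmod (F \<omega> - F \<eta>) < \<epsilon> * \<delta>\<^sup>2"
    by (rule CX_D[OF assms(1) e]) blast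
  show "\<exists>k. \<forall>\<omega>\<in>X. \<forall>\<eta>\<in>X. prefix k \<omega> = prefix k \<eta> \<longrightarrow> cmod (inverse (F \<omega>) - inverse (F \<eta>)) < \<epsilon>"
  proof (intro exI ballI impI)
    fix \<omega> \<eta> assume h: "\<omega> \<in> X" "\<eta> \<in> X" "prefix k \<omega> = prefix k \<eta>"
    have nz: "F \<omega> \<noteq> 0" "F \<eta> \<noteq> 0" using assms(2,3) h(1,2) by fastforce+
    then have "inverse (F \<omega>) - inverse (F \<eta>) = (F \<eta> - F \<omega>) / (F \<omega> * F \<eta>)" by (simp add: field_simps)
    then have "cmod (inverse (F \<omega>) - inverse (F \<eta>)) = cmod (F \<omega> - F \<eta>) / (cmod (F \<omega>) * cmod (F \<eta>))"
      by (simp add: norm_divide norm_mult norm_minus_commute)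
    also have "\<dots> \<le> cmod (F \<omega> - F \<eta>) / \<delta>\<^sup>2"
      using assms h by (intro divide_left_mono) (auto simp: power2_eq_square nz intro: mult_mono)
    also have "\<dots> < \<epsilon>" using k[OF h(1,2) order_refl h(3)] assms(2) by (simp add: divide_less_eq)
    finally show "cmod (inverse (F \<omega>) - inverse (F \<eta>)) < \<epsilon>" .
  qed
qed

lemma CX_comp:
  assumes F: "F \<in> CX" and g: "word_cont g" "g ` X \<subseteq> X"
  shows "(\<lambda>\<omega>. F (g \<omega>)) \<in> CX"
proof (rule CX_I)
  fix \<epsilon> :: real assume e: "\<epsilon> > 0"
  obtain k where k: "\<And>\<omega> \<eta> m. \<omega> \<in> X \<Longrightarrow> \<eta> \<in> X \<Longrightarrow> m \<ge> k \<Longrightarrow> prefix m \<omega> = prefix m \<eta> \<Longrightarrow> cmod (F \<omega> - F \<eta>) < \<epsilon>"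
    by (rule CX_D[OF F e]) blast
  obtain m where m: "\<And>\<omega> \<eta>. \<omega> \<in> X \<Longrightarrow> \<eta> \<in> X \<Longrightarrow> prefix m \<omega> = prefix m \<eta> \<Longrightarrow> prefix k (g \<omega>) = prefix k (g \<eta>)"
    by (rule word_contD[OF g(1), of 0 k]) blast
  show "\<exists>k. \<forall>\<omega>\<in>X. \<forall>\<eta>\<in>X. prefix k \<omega> = prefix k \<eta> \<longrightarrow> cmod (F (g \<omega>) - F (g \<eta>)) < \<epsilon>"
  proof (intro exI ballI impI)
    fix \<omega> \<eta> assume "\<omega> \<in> X" "\<eta> \<in> X" "prefix m \<omega> = prefix m \<eta>"
    then show "cmod (F (g \<omega>) - F (g \<eta>)) < \<epsilon>"
      using g(2) by (intro k[OF _ _ order_refl] m) blast+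
  qed
qed

text \<open>The inverse of the Gelfand transform; the limit exists for F in
  \<open>CX\<close>.\<close>

definition \<Phi> :: "(nat word \<Rightarrow> complex) \<Rightarrow> 'a" where
  "\<Phi> F = lim (\<lambda>k. step k F)"

lemma norm_step_diff_le:
  assumes "\<And>\<omega>. \<omega> \<in> X \<Longrightarrow> cmod (F \<omega> - G \<omega>) \<le> B"
  shows "norm (step k F - step k G) \<le> B"
  using norm_step_le[of "\<lambda>\<omega>. F \<omega> - G \<omega>" B k] assms by (simp add: step_diff)

lemma tendsto_\<Phi>:
  assumes "F \<in> CX" shows "(\<lambda>k. step k F) \<longlonglongrightarrow> \<Phi> F"
proof -
  have "Cauchy (\<lambda>k. step k F)"
  proof (rule CauchyI')
    fix e :: real assume "e > 0"
    then have e: "e / 2 > 0" by simp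
    obtain K where K: "\<And>\<omega> \<eta> l. \<omega> \<in> X \<Longrightarrow> \<eta> \<in> X \<Longrightarrow> l \<ge> K \<Longrightarrow> prefix l \<omega> = prefix l \<eta> \<Longrightarrow> cmod (F \<omega> - F \<eta>) < e / 2"
      by (rule CX_D[OF assms e]) blast
    have "norm (step k F - step (k + l) F) < e" if "k \<ge> K" for k l
    proof -
      have "cmod (F (ext (prefix k \<omega>)) - F \<omega>) \<le> e / 2" if "\<omega> \<in> X" for \<omega>
        using that \<open>k \<ge> K\<close> words_prefix[OF that]
        by (intro K[of _ _ k, THEN less_imp_le]) (auto simp: prefix_ext intro: ext_in)
      then have "norm (step k F - step (k + l) F) \<le> e / 2"
        unfolding step_refine[of k F l] by (rule norm_step_diff_le)
      then show ?thesis using \<open>e > 0\<close> by simp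
    qed
    then show "\<exists>M. \<forall>i\<ge>M. \<forall>j>i. dist (step i F) (step j F) < e"
      unfolding dist_norm by (metis less_imp_add_positive)
  qed
  then show ?thesis unfolding \<Phi>_def by (simp add: Cauchy_convergent_iff convergent_LIMSEQ_iff)
qed

lemma \<Phi>_eqI: "F \<in> CX \<Longrightarrow> (\<lambda>k. step k F) \<longlonglongrightarrow> x \<Longrightarrow> \<Phi> F = x"
  using tendsto_\<Phi> LIMSEQ_unique by blast

lemma \<Phi>_cong: "(\<And>\<omega>. \<omega> \<in> X \<Longrightarrow> F \<omega> = G \<omega>) \<Longrightarrow> \<Phi> F = \<Phi> G"
  unfolding \<Phi>_def using step_cong[of F G] by simp

lemma \<Phi>_add: "F \<in> CX \<Longrightarrow> G \<in> CX \<Longrightarrow> \<Phi> (\<lambda>\<omega>. F \<omega> + G \<omega>) = \<Phi> F + \<Phi> G"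
  by (rule \<Phi>_eqI[OF CX_add]) (auto simp: step_add intro: tendsto_add tendsto_\<Phi>)

lemma \<Phi>_mult: "F \<in> CX \<Longrightarrow> G \<in> CX \<Longrightarrow> \<Phi> (\<lambda>\<omega>. F \<omega> * G \<omega>) = \<Phi> F * \<Phi> G"
  by (rule \<Phi>_eqI[OF CX_mult]) (auto simp: step_mult intro: tendsto_mult tendsto_\<Phi>)

lemma \<Phi>_scale: "F \<in> CX \<Longrightarrow> \<Phi> (\<lambda>\<omega>. c * F \<omega>) = c *C \<Phi> F"
  by (rule \<Phi>_eqI[OF CX_scale])
    (auto simp: step_scale intro: bounded_linear.tendsto[OF bounded_linear_scaleC] tendsto_\<Phi>)

lemma \<Phi>_diff: "F \<in> CX \<Longrightarrow> G \<in> CX \<Longrightarrow> \<Phi> (\<lambda>\<omega>. F \<omega> - G \<omega>) = \<Phi> F - \<Phi> G"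
  by (rule \<Phi>_eqI[OF CX_diff]) (auto simp: step_diff intro: tendsto_diff tendsto_\<Phi>)

lemma \<Phi>_adj: "F \<in> CX \<Longrightarrow> \<Phi> (\<lambda>\<omega>. cnj (F \<omega>)) = adj (\<Phi> F)"
  by (rule \<Phi>_eqI[OF CX_cnj])
    (auto simp: step_adj[symmetric] intro: bounded_linear.tendsto[OF bounded_linear_adj] tendsto_\<Phi>)

lemma \<Phi>_one: "\<Phi> (\<lambda>\<omega>. 1) = 1"
  by (rule \<Phi>_eqI[OF CX_const]) (simp add: step_one)

lemma norm_\<Phi>_le: "F \<in> CX \<Longrightarrow> (\<And>\<omega>. \<omega> \<in> X \<Longrightarrow> cmod (F \<omega>) \<le> B) \<Longrightarrow> norm (\<Phi> F) \<le> B"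
  by (rule Lim_bounded[OF tendsto_norm[OF tendsto_\<Phi>], of _ 0]) (auto intro: norm_step_le)

lemma le_norm_\<Phi>:
  assumes F: "F \<in> CX" and w: "\<omega> \<in> X"
  shows "cmod (F \<omega>) \<le> norm (\<Phi> F)"
proof (rule LIMSEQ_le[OF _ tendsto_norm[OF tendsto_\<Phi>[OF F]]])
  have "(\<lambda>k. F (ext (prefix k \<omega>))) \<longlonglongrightarrow> F \<omega>"
    unfolding lim_sequentially dist_norm
  proof (intro allI impI)
    fix e :: real assume e: "e > 0"
    obtain K where K: "\<And>\<omega> \<eta> l. \<omega> \<in> X \<Longrightarrow> \<eta> \<in> X \<Longrightarrow> l \<ge> K \<Longrightarrow> prefix l \<omega> = prefix l \<eta> \<Longrightarrow> cmod (F \<omega> - F \<eta>) < e"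
      by (rule CX_D[OF F e]) blast
    have "cmod (F (ext (prefix k \<omega>)) - F \<omega>) < e" if "k \<ge> K" for k
      using that words_prefix[OF w, of k] w by (intro K[of _ _ k]) (auto simp: prefix_ext intro: ext_in)
    then show "\<exists>no. \<forall>k\<ge>no. cmod (F (ext (prefix k \<omega>)) - F \<omega>) < e" by blast
  qed
  then show "(\<lambda>k. cmod (F (ext (prefix k \<omega>)))) \<longlonglongrightarrow> cmod (F \<omega>)" by (rule tendsto_norm)
  show "\<exists>N. \<forall>k\<ge>N. cmod (F (ext (prefix k \<omega>))) \<le> norm (step k F)"
    using le_norm_step words_prefix[OF w] by blast
qed

lemma \<Phi>_eq_iff:
  assumes "F \<in> CX" "G \<in> CX"
  shows "\<Phi> F = \<Phi> G \<longleftrightarrow> (\<forall>\<omega>\<in>X. F \<omega> = G \<omega>)"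
proof
  assume "\<Phi> F = \<Phi> G"
  then have "\<Phi> (\<lambda>\<omega>. F \<omega> - G \<omega>) = 0" by (simp add: \<Phi>_diff assms)
  then show "\<forall>\<omega>\<in>X. F \<omega> = G \<omega>" using le_norm_\<Phi>[OF CX_diff[OF assms]] by fastforce
qed (auto intro: \<Phi>_cong)

lemma \<Phi>_local: "\<Phi> (\<lambda>\<omega>. c (prefix k \<omega>)) = (\<Sum>\<mu>\<in>W k. c \<mu> *C P \<mu>)"
proof (rule \<Phi>_eqI[OF CX_local])
  let ?F = "\<lambda>\<omega>. c (prefix k \<omega>)"
  have eq: "step k ?F = step (k + l) ?F" for l
    unfolding step_refine[of k ?F l] by (intro step_cong) (simp add: prefix_ext words_prefix)
  have k: "step k ?F = (\<Sum>\<mu>\<in>W k. c \<mu> *C P \<mu>)"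
    unfolding step_def by (intro sum.cong refl) (simp add: prefix_ext)
  have "eventually (\<lambda>m. step m ?F = (\<Sum>\<mu>\<in>W k. c \<mu> *C P \<mu>)) sequentially"
    unfolding eventually_sequentially using eq k by (intro exI[of _ k] allI impI) (metis le_add_diff_inverse)
  then show "(\<lambda>m. step m ?F) \<longlonglongrightarrow> (\<Sum>\<mu>\<in>W k. c \<mu> *C P \<mu>)" by (rule tendsto_eventually)
qed

definition cyl :: "nat list \<Rightarrow> nat word \<Rightarrow> complex" where
  "cyl \<mu> \<omega> = (if prefix (length \<mu>) \<omega> = \<mu> then 1 else 0)"

lemma CX_cyl: "cyl \<mu> \<in> CX"
  using CX_local[of "\<lambda>\<nu>. if \<nu> = \<mu> then 1 else 0" "length \<mu>"] by (simp add: cyl_def[abs_def])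

lemma \<Phi>_cyl: "\<mu> \<in> W k \<Longrightarrow> \<Phi> (cyl \<mu>) = P \<mu>"
  using \<Phi>_local[of "\<lambda>\<nu>. if \<nu> = \<mu> then 1 else 0" k]
  by (simp add: cyl_def[abs_def] words_length if_distrib[of "\<lambda>c. c *C _"] sum.delta' cong: if_cong)

abbreviation D where "D \<equiv> diagonal n S"

text \<open>Closedness is the substantial part: by \<open>le_norm_\<Phi>\<close> a norm convergent
  sequence of images comes from a uniformly Cauchy sequence of functions, and its uniform limit is
  again in \<open>CX\<close>.\<close>

lemma cstar_subalgebra_range: "cstar_subalgebra (\<Phi> ` CX)"
  unfolding cstar_subalgebra_def
proof (intro conjI ballI)
  have "0 = 0 *C \<Phi> (\<lambda>\<omega>. 1)" by simp
  then have "0 \<in> \<Phi> ` CX" using \<Phi>_scale[OF CX_const] CX_scale[OF CX_const] by (metis image_eqI)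
  then show "complex_vector.subspace (\<Phi> ` CX)"
    by (rule complex_vector.subspaceI) (auto simp: \<Phi>_add[symmetric] \<Phi>_scale[symmetric] intro: CX_add CX_scale)
  show "x * y \<in> \<Phi> ` CX" if "x \<in> \<Phi> ` CX" "y \<in> \<Phi> ` CX" for x y
    using that by (auto simp: \<Phi>_mult[symmetric] intro: CX_mult)
  show "adj x \<in> \<Phi> ` CX" if "x \<in> \<Phi> ` CX" for x
    using that by (auto simp: \<Phi>_adj[symmetric] intro: CX_cnj)
  show "closed (\<Phi> ` CX)"
    unfolding closed_sequential_limits
  proof (intro allI impI, elim conjE)
    fix y x assume y: "\<forall>j. y j \<in> \<Phi> ` CX" and lim: "y \<longlonglongrightarrow> x"
    have "\<forall>j. \<exists>F. F \<in> CX \<and> y j = \<Phi> F" using y by blast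
    from choice[OF this] obtain F where F: "\<And>j. F j \<in> CX" "\<And>j. y j = \<Phi> (F j)" by blast
    have le: "cmod (F i \<omega> - F j \<omega>) \<le> norm (y i - y j)" if "\<omega> \<in> X" for i j \<omega>
      using le_norm_\<Phi>[OF CX_diff[OF F(1) F(1)] that, of i j] by (simp add: F \<Phi>_diff)
    define G where "G \<omega> = lim (\<lambda>j. F j \<omega>)" for \<omega>
    have cauchy: "Cauchy y" using lim by (rule LIMSEQ_imp_Cauchy)
    have G: "(\<lambda>j. F j \<omega>) \<longlonglongrightarrow> G \<omega>" if w: "\<omega> \<in> X" for \<omega>
    proof -
      have "Cauchy (\<lambda>j. F j \<omega>)"
        using cauchy le[OF w] unfolding Cauchy_iff by (meson le_less_trans)
      then show ?thesis unfolding G_def by (simp add: Cauchy_convergent_iff convergent_LIMSEQ_iff)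
    qed
    have unif: "\<exists>N. \<forall>j\<ge>N. \<forall>\<omega>\<in>X. cmod (F j \<omega> - G \<omega>) \<le> e" if "e > 0" for e
    proof -
      obtain N where N: "\<And>i j. i \<ge> N \<Longrightarrow> j \<ge> N \<Longrightarrow> norm (y i - y j) < e"
        using cauchy \<open>e > 0\<close> unfolding Cauchy_iff by blast
      have "cmod (F j \<omega> - G \<omega>) \<le> e" if "j \<ge> N" "\<omega> \<in> X" for j \<omega>
      proof (rule Lim_bounded[of "\<lambda>i. cmod (F j \<omega> - F i \<omega>)" _ N])
        show "(\<lambda>i. cmod (F j \<omega> - F i \<omega>)) \<longlonglongrightarrow> cmod (F j \<omega> - G \<omega>)"
          by (intro tendsto_intros G that)
        show "\<forall>i\<ge>N. cmod (F j \<omega> - F i \<omega>) \<le> e"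
          using le[OF that(2)] N[OF that(1)] by (meson less_imp_le order_trans)
      qed
      then show ?thesis by blast
    qed
    have GC: "G \<in> CX"
    proof (rule CX_I)
      fix e :: real assume "e > 0"
      then have e: "e / 4 > 0" by simp
      obtain N where N: "\<forall>j\<ge>N. \<forall>\<omega>\<in>X. cmod (F j \<omega> - G \<omega>) \<le> e / 4" using unif[OF e] by blast
      obtain k where k: "\<And>\<omega> \<eta> l. \<omega> \<in> X \<Longrightarrow> \<eta> \<in> X \<Longrightarrow> l \<ge> k \<Longrightarrow> prefix l \<omega> = prefix l \<eta> \<Longrightarrow> cmod (F N \<omega> - F N \<eta>) < e / 4"
        by (rule CX_D[OF F(1)[of N] e]) blast
      have "cmod (G \<omega> - G \<eta>) < e" if h: "\<omega> \<in> X" "\<eta> \<in> X" "prefix k \<omega> = prefix k \<eta>" for \<omega> \<eta>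
      proof -
        have "cmod (G \<omega> - G \<eta>) \<le> cmod (F N \<omega> - G \<omega>) + cmod (F N \<omega> - F N \<eta>) + cmod (F N \<eta> - G \<eta>)"
          using norm_triangle_ineq[of "G \<omega> - F N \<omega>" "F N \<omega> - G \<eta>"]
            norm_triangle_ineq[of "F N \<omega> - F N \<eta>" "F N \<eta> - G \<eta>"] by (simp add: norm_minus_commute)
        moreover have "cmod (F N \<omega> - G \<omega>) \<le> e / 4" "cmod (F N \<eta> - G \<eta>) \<le> e / 4" using N h by blast+
        ultimately show ?thesis using k[OF h(1,2) order_refl h(3)] e by linarith
      qed
      then show "\<exists>k. \<forall>\<omega>\<in>X. \<forall>\<eta>\<in>X. prefix k \<omega> = prefix k \<eta> \<longrightarrow> cmod (G \<omega> - G \<eta>) < e" by blast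
    qed
    have "y \<longlonglongrightarrow> \<Phi> G"
      unfolding LIMSEQ_iff
    proof (intro allI impI)
      fix e :: real assume "e > 0"
      then obtain N where N: "\<forall>j\<ge>N. \<forall>\<omega>\<in>X. cmod (F j \<omega> - G \<omega>) \<le> e / 2" using unif[of "e / 2"] by auto
      have "norm (y j - \<Phi> G) < e" if "j \<ge> N" for j
      proof -
        have "norm (\<Phi> (\<lambda>\<omega>. F j \<omega> - G \<omega>)) \<le> e / 2"
          using N that by (intro norm_\<Phi>_le CX_diff F GC) blast
        then show ?thesis using \<open>e > 0\<close> by (simp add: F \<Phi>_diff GC)
      qed
      then show "\<exists>N. \<forall>j\<ge>N. norm (y j - \<Phi> G) < e" by blast
    qed
    then have "x = \<Phi> G" using lim LIMSEQ_unique by blast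
    then show "x \<in> \<Phi> ` CX" using GC by blast
  qed
qed

text \<open>The range of \<Phi> is a C*-subalgebra containing all \<open>P \<mu>\<close>.
  Conversely, any such subalgebra contains the step elements and, being closed, their
  limits.\<close>

lemma diagonal_eq: "D = \<Phi> ` CX"
proof
  have "P \<mu> \<in> \<Phi> ` CX" if "\<mu> \<in> W k" for \<mu> k
    using \<Phi>_cyl[OF that] CX_cyl[of \<mu>] by (metis image_eqI)
  then have "(\<Union>k. P ` W k) \<subseteq> \<Phi> ` CX" by blast
  then show "D \<subseteq> \<Phi> ` CX"
    unfolding diagonal_def cstar_generated_def using cstar_subalgebra_range by blast
  show "\<Phi> ` CX \<subseteq> D"
    unfolding diagonal_def cstar_generated_def
  proof (intro subsetI InterI)
    fix x B assume "x \<in> \<Phi> ` CX" and "B \<in> {B. cstar_subalgebra B \<and> (\<Union>k. P ` W k) \<subseteq> B}"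
    then have sub: "cstar_subalgebra B" and PB: "(\<Union>k. P ` W k) \<subseteq> B" by simp_all
    obtain F where F: "F \<in> CX" "x = \<Phi> F" using \<open>x \<in> \<Phi> ` CX\<close> by blast
    have B: "complex_vector.subspace B" "closed B" using sub by (simp_all add: cstar_subalgebra_def)
    have PB': "P \<mu> \<in> B" if "\<mu> \<in> W k" for k \<mu> using PB that by blast
    have "step k F \<in> B" for k
      unfolding step_def using PB'
      by (intro complex_vector.subspace_sum[OF B(1)] complex_vector.subspace_scale[OF B(1)])
    then show "x \<in> B" using closed_sequentially[OF B(2) _ tendsto_\<Phi>[OF F(1)]] F(2) by blast
  qed
qed

text \<open>The function is chosen among those represented by x and is determined on X only, so
  statements about it are restricted to points of X.\<close>

definition gelfand :: "'a \<Rightarrow> nat word \<Rightarrow> complex" where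
  "gelfand x = (SOME F. F \<in> CX \<and> \<Phi> F = x)"

lemma gelfand:
  assumes "x \<in> D" shows "gelfand x \<in> CX" "\<Phi> (gelfand x) = x"
proof -
  have "\<exists>F. F \<in> CX \<and> \<Phi> F = x" using assms by (auto simp: diagonal_eq)
  then show "gelfand x \<in> CX" "\<Phi> (gelfand x) = x" unfolding gelfand_def by (metis (mono_tags, lifting) someI_ex)+
qed

lemma \<Phi>_in: "F \<in> CX \<Longrightarrow> \<Phi> F \<in> D"
  by (simp add: diagonal_eq)

lemma gelfand_\<Phi>: "F \<in> CX \<Longrightarrow> \<omega> \<in> X \<Longrightarrow> gelfand (\<Phi> F) \<omega> = F \<omega>"
  using gelfand[OF \<Phi>_in] \<Phi>_eq_iff by blast

lemma gelfand_eqI: "x \<in> D \<Longrightarrow> y \<in> D \<Longrightarrow> (\<And>\<omega>. \<omega> \<in> X \<Longrightarrow> gelfand x \<omega> = gelfand y \<omega>) \<Longrightarrow> x = y"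
  using \<Phi>_cong gelfand(2) by metis

lemma D_closed: 
  shows D_add: "x \<in> D \<Longrightarrow> y \<in> D \<Longrightarrow> x + y \<in> D"
    and D_mult: "x \<in> D \<Longrightarrow> y \<in> D \<Longrightarrow> x * y \<in> D"
    and D_scale: "x \<in> D \<Longrightarrow> c *C x \<in> D"
    and D_diff: "x \<in> D \<Longrightarrow> y \<in> D \<Longrightarrow> x - y \<in> D"
    and D_adj: "x \<in> D \<Longrightarrow> adj x \<in> D"
    and D_one: "1 \<in> D"
    and D_proj: "\<mu> \<in> W k \<Longrightarrow> P \<mu> \<in> D"
  using cstar_subalgebra_range \<Phi>_in[OF CX_const[of 1]] \<Phi>_in[OF CX_cyl[of \<mu>]]
  unfolding diagonal_eq[symmetric] cstar_subalgebra_def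
  by (auto simp: complex_vector.subspace_add complex_vector.subspace_scale complex_vector.subspace_diff \<Phi>_one \<Phi>_cyl)

lemma gelfand_hom:
  assumes "\<omega> \<in> X"
  shows gelfand_add: "x \<in> D \<Longrightarrow> y \<in> D \<Longrightarrow> gelfand (x + y) \<omega> = gelfand x \<omega> + gelfand y \<omega>"
    and gelfand_mult: "x \<in> D \<Longrightarrow> y \<in> D \<Longrightarrow> gelfand (x * y) \<omega> = gelfand x \<omega> * gelfand y \<omega>"
    and gelfand_scale: "x \<in> D \<Longrightarrow> gelfand (c *C x) \<omega> = c * gelfand x \<omega>"
    and gelfand_diff: "x \<in> D \<Longrightarrow> y \<in> D \<Longrightarrow> gelfand (x - y) \<omega> = gelfand x \<omega> - gelfand y \<omega>"
    and gelfand_adj: "x \<in> D \<Longrightarrow> gelfand (adj x) \<omega> = cnj (gelfand x \<omega>)"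
    and gelfand_one: "gelfand 1 \<omega> = 1"
    and gelfand_proj: "\<mu> \<in> W k \<Longrightarrow> gelfand (P \<mu>) \<omega> = (if prefix k \<omega> = \<mu> then 1 else 0)"
proof -
  have "gelfand (x + y) \<omega> = gelfand x \<omega> + gelfand y \<omega>" "gelfand (x * y) \<omega> = gelfand x \<omega> * gelfand y \<omega>" 
    "gelfand (x - y) \<omega> = gelfand x \<omega> - gelfand y \<omega>" if "x \<in> D" "y \<in> D" for x y
    using gelfand_\<Phi>[OF CX_add[OF gelfand(1) gelfand(1)], of x y \<omega>] gelfand_\<Phi>[OF CX_mult[OF gelfand(1) gelfand(1)], of x y \<omega>]
     gelfand_\<Phi>[OF CX_diff[OF gelfand(1) gelfand(1)], of x y \<omega>] assms that by (simp_all add: \<Phi>_add \<Phi>_mult \<Phi>_diff gelfand)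
  moreover have "gelfand (c *C x) \<omega> = c * gelfand x \<omega>" "gelfand (adj x) \<omega> = cnj (gelfand x \<omega>)" if "x \<in> D" for x c
    using gelfand_\<Phi>[OF CX_scale[OF gelfand(1)], of x \<omega> c] gelfand_\<Phi>[OF CX_cnj[OF gelfand(1)], of x \<omega>] assms that
    by (simp_all add: \<Phi>_scale \<Phi>_adj gelfand)
  moreover have "gelfand 1 \<omega> = 1" using gelfand_\<Phi>[OF CX_const assms, of 1] by (simp add: \<Phi>_one)
  moreover have "gelfand (P \<mu>) \<omega> = (if prefix k \<omega> = \<mu> then 1 else 0)" if "\<mu> \<in> W k" for \<mu> k
    using gelfand_\<Phi>[OF CX_cyl assms, of \<mu>] that by (simp add: \<Phi>_cyl cyl_def words_length)
  ultimately show "x \<in> D \<Longrightarrow> y \<in> D \<Longrightarrow> gelfand (x + y) \<omega> = gelfand x \<omega> + gelfand y \<omega>"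
    "x \<in> D \<Longrightarrow> y \<in> D \<Longrightarrow> gelfand (x * y) \<omega> = gelfand x \<omega> * gelfand y \<omega>"
    "x \<in> D \<Longrightarrow> gelfand (c *C x) \<omega> = c * gelfand x \<omega>"
    "x \<in> D \<Longrightarrow> y \<in> D \<Longrightarrow> gelfand (x - y) \<omega> = gelfand x \<omega> - gelfand y \<omega>"
    "x \<in> D \<Longrightarrow> gelfand (adj x) \<omega> = cnj (gelfand x \<omega>)"
    "gelfand 1 \<omega> = 1"
    "\<mu> \<in> W k \<Longrightarrow> gelfand (P \<mu>) \<omega> = (if prefix k \<omega> = \<mu> then 1 else 0)"
    by blast+
qed

lemma norm_le_gelfand: "x \<in> D \<Longrightarrow> (\<And>\<omega>. \<omega> \<in> X \<Longrightarrow> cmod (gelfand x \<omega>) \<le> B) \<Longrightarrow> norm x \<le> B"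
  using norm_\<Phi>_le[OF gelfand(1)] gelfand(2) by metis

lemma gelfand_separates:
  assumes "\<omega> \<in> X" "\<eta> \<in> X" "\<And>x. x \<in> D \<Longrightarrow> gelfand x \<omega> = gelfand x \<eta>"
  shows "\<omega> = \<eta>"
proof
  fix i
  have p: "prefix (Suc i) \<omega> \<in> W (Suc i)" using assms(1) by (rule words_prefix)
  have "gelfand (P (prefix (Suc i) \<omega>)) \<eta> = 1"
    using assms(3)[OF D_proj[OF p]] gelfand_proj[OF assms(1) p] by simp
  then have "prefix (Suc i) \<eta> = prefix (Suc i) \<omega>"
    using gelfand_proj[OF assms(2) p] by (simp only: if_split) (metis zero_neq_one)
  then show "\<omega> i = \<eta> i" unfolding prefix_eq_iff by simp
qed

end

section \<open>Automorphisms of the diagonal as homeomorphisms\<close>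

context cuntz
begin

text \<open>At each level the projections \<open>P \<mu>\<close> are orthogonal with sum 1, so a
  character is nonzero on exactly one of them. These words are nested and define \<omega>;
  boundedness of the character then forces its values to be those at \<omega>.\<close>

lemma character_point:
  assumes add: "\<And>x y. x \<in> D \<Longrightarrow> y \<in> D \<Longrightarrow> \<theta> (x + y) = \<theta> x + \<theta> y"
    and scale: "\<And>c x. x \<in> D \<Longrightarrow> \<theta> (c *C x) = c * \<theta> x"
    and mult: "\<And>x y. x \<in> D \<Longrightarrow> y \<in> D \<Longrightarrow> \<theta> (x * y) = \<theta> x * (\<theta> y :: complex)"
    and one: "\<theta> 1 = 1"
  obtains \<omega> where "\<omega> \<in> X" "\<And>x. x \<in> D \<Longrightarrow> \<theta> x = gelfand x \<omega>"
proof -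
  have diff: "\<theta> (x - y) = \<theta> x - \<theta> y" if "x \<in> D" "y \<in> D" for x y
    using add[OF that(1) D_scale[OF that(2)], of "-1"] scale[OF that(2), of "-1"] by simp
  have bound: "cmod (\<theta> x) \<le> norm x" if x: "x \<in> D" for x
  proof (rule ccontr)
    \<comment> \<open>Otherwise \<open>?F\<close> is bounded away from 0, hence
      \<open>?c *C 1 - x\<close> is invertible in the diagonal, while \<theta> sends it to
      0.\<close>
    assume less: "\<not> cmod (\<theta> x) \<le> norm x"
    let ?c = "\<theta> x" and ?F = "\<lambda>\<omega>. \<theta> x - gelfand x \<omega>"
    have F: "?F \<in> CX" using CX_diff[OF CX_const gelfand(1)[OF x]] .
    have "cmod (?F \<omega>) \<ge> cmod ?c - norm x" if "\<omega> \<in> X" for \<omega>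
      using le_norm_\<Phi>[OF gelfand(1)[OF x] that] gelfand(2)[OF x] norm_triangle_ineq2[of ?c "gelfand x \<omega>"] by simp
    with less have inv: "(\<lambda>\<omega>. inverse (?F \<omega>)) \<in> CX" and nz: "\<And>\<omega>. \<omega> \<in> X \<Longrightarrow> ?F \<omega> \<noteq> 0"
      using CX_inverse[OF F, of "cmod ?c - norm x"] by force+
    have F_eq: "\<Phi> ?F = ?c *C 1 - x"
      using \<Phi>_diff[OF CX_const gelfand(1)[OF x], of ?c] \<Phi>_scale[OF CX_const, of ?c 1] gelfand(2)[OF x] \<Phi>_one by simp
    have "\<Phi> (\<lambda>\<omega>. inverse (?F \<omega>)) * \<Phi> ?F = \<Phi> (\<lambda>\<omega>. inverse (?F \<omega>) * ?F \<omega>)"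
      by (rule \<Phi>_mult[symmetric, OF inv F])
    also have "\<dots> = \<Phi> (\<lambda>\<omega>. 1)" using nz by (intro \<Phi>_cong) simp
    finally have "\<Phi> (\<lambda>\<omega>. inverse (?F \<omega>)) * (?c *C 1 - x) = 1" by (simp only: F_eq \<Phi>_one)
    then have "\<theta> (\<Phi> (\<lambda>\<omega>. inverse (?F \<omega>))) * \<theta> (?c *C 1 - x) = 1"
      using mult[OF \<Phi>_in[OF inv] \<Phi>_in[OF F]] one F_eq by simp
    then show False using diff[OF D_scale[OF D_one] x, of ?c] scale[OF D_one, of ?c] one by simp
  qed
  have zero: "\<theta> 0 = 0" using scale[OF D_one, of 0] by simp
  have sum: "\<theta> (\<Sum>\<mu>\<in>M. P \<mu>) = (\<Sum>\<mu>\<in>M. \<theta> (P \<mu>)) \<and> (\<Sum>\<mu>\<in>M. P \<mu>) \<in> D"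
    if "finite M" "M \<subseteq> W k" for M k
    using that
  proof (induction M rule: finite_induct)
    case empty
    then show ?case using zero D_scale[OF D_one, of 0] by simp
  next
    case (insert \<mu> M)
    then have \<mu>: "\<mu> \<in> W k" by simp
    show ?case using insert add[OF D_proj[OF \<mu>]] D_add[OF D_proj[OF \<mu>]] by simp
  qed
  have "\<exists>\<mu>\<in>W k. \<theta> (P \<mu>) \<noteq> 0" for k
  proof (rule ccontr)
    assume "\<not> ?thesis"
    then have "(\<Sum>\<mu>\<in>W k. \<theta> (P \<mu>)) = 0" by simp
    then show False using sum[of "W k" k] one by (simp add: sum_word_proj)
  qed
  then obtain \<mu> where \<mu>: "\<And>k. \<mu> k \<in> W k" "\<And>k. \<theta> (P (\<mu> k)) \<noteq> 0" by metis
  have uniq: "\<nu> = \<mu> k" if "\<nu> \<in> W k" "\<theta> (P \<nu>) \<noteq> 0" for \<nu> k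
    using mult[OF D_proj[OF that(1)] D_proj[OF \<mu>(1)[of k]]] word_proj_mult[OF that(1) \<mu>(1)] zero that(2) \<mu>(2)
    by (auto split: if_splits)
  have one': "\<theta> (P (\<mu> k)) = 1" for k
    using mult[OF D_proj[OF \<mu>(1)] D_proj[OF \<mu>(1)], of k k] word_proj_mult[OF \<mu>(1) \<mu>(1), of k] \<mu>(2)[of k] by simp
  \<comment> \<open>The projection of an initial segment dominates that of the whole word, so
    \<theta> does not vanish on it, and uniqueness identifies it.\<close>
  have take: "take k (\<mu> l) = \<mu> k" if "k \<le> l" for k l
  proof (rule uniq)
    let ?a = "take k (\<mu> l)" and ?b = "drop k (\<mu> l)"
    show a: "?a \<in> W k" using \<mu>(1)[of l] that by (auto simp: words_def simp del: atLeastAtMost_iff dest: in_set_takeD)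
    have "P ?a * P (?a @ ?b) = Sw ?a * (adj (Sw ?a) * Sw ?a) * P ?b * adj (Sw ?a)"
      unfolding word_proj_append by (simp add: word_proj_def mult.assoc)
    also have "\<dots> = P (?a @ ?b)"
      using adj_word_isometry_mult[OF a a] by (simp add: word_proj_append del: append_take_drop_id)
    finally have "P ?a * P (\<mu> l) = P (\<mu> l)" by simp
    then show "\<theta> (P ?a) \<noteq> 0" using mult[OF D_proj[OF a] D_proj[OF \<mu>(1)[of l]]] \<mu>(2)[of l] by auto
  qed
  define \<omega> where "\<omega> i = \<mu> (Suc i) ! i" for i
  have pre: "prefix k \<omega> = \<mu> k" for k
  proof (rule nth_equalityI)
    show "length (prefix k \<omega>) = length (\<mu> k)" using \<mu>(1)[of k] by (simp add: words_length)
    fix i assume "i < length (prefix k \<omega>)"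
    then have "i < k" by simp
    then show "prefix k \<omega> ! i = \<mu> k ! i" using take[of "Suc i" k] by (simp add: \<omega>_def) (metis lessI nth_take)
  qed
  have \<omega>X: "\<omega> \<in> X"
  proof -
    have "\<omega> i \<in> {1..n}" for i
    proof -
      have "\<mu> (Suc i) ! i \<in> set (\<mu> (Suc i))" using words_length[OF \<mu>(1), of "Suc i"] by simp
      moreover have "set (\<mu> (Suc i)) \<subseteq> {1..n}" using \<mu>(1)[of "Suc i"] unfolding words_def by blast
      ultimately show ?thesis unfolding \<omega>_def by blast
    qed
    then show ?thesis unfolding iwords_def by blast
  qed
  have "\<theta> x = gelfand x \<omega>" if x: "x \<in> D" for x
  proof -
    let ?c = "gelfand x \<omega>"
    \<comment> \<open>Multiplying \<open>x - ?c *C 1\<close> by \<open>P (\<mu> k)\<close>, on which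
      \<theta> is 1, does not change its value under \<theta> and confines it to a cylinder around
      \<omega>, where it is small.\<close>
    have "cmod (\<theta> x - ?c) \<le> \<epsilon>" if "\<epsilon> > 0" for \<epsilon>
    proof -
      obtain k where k: "\<And>\<eta> \<zeta> l. \<eta> \<in> X \<Longrightarrow> \<zeta> \<in> X \<Longrightarrow> l \<ge> k \<Longrightarrow> prefix l \<eta> = prefix l \<zeta> \<Longrightarrow> cmod (gelfand x \<eta> - gelfand x \<zeta>) < \<epsilon>"
        by (rule CX_D[OF gelfand(1)[OF x] \<open>\<epsilon> > 0\<close>]) blast
      let ?y = "x - ?c *C 1"
      have y: "?y \<in> D" "?y * P (\<mu> k) \<in> D"
        using x D_diff D_scale D_one D_mult D_proj[OF \<mu>(1)[of k]] by blast+
      have "\<theta> x - ?c = \<theta> (?y * P (\<mu> k))"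
        using mult[OF y(1) D_proj[OF \<mu>(1)[of k]]] diff[OF x D_scale[OF D_one], of ?c] scale[OF D_one, of ?c] one one'[of k]
        by simp
      then have "cmod (\<theta> x - ?c) \<le> norm (?y * P (\<mu> k))" using bound[OF y(2)] by simp
      also have "\<dots> \<le> \<epsilon>"
      proof (rule norm_le_gelfand[OF y(2)])
        fix \<eta> assume \<eta>: "\<eta> \<in> X"
        have "gelfand (?y * P (\<mu> k)) \<eta> = (gelfand x \<eta> - ?c) * (if prefix k \<eta> = \<mu> k then 1 else 0)"
          using gelfand_mult[OF \<eta> y(1) D_proj[OF \<mu>(1)[of k]]] gelfand_diff[OF \<eta> x D_scale[OF D_one], of ?c]
            gelfand_scale[OF \<eta> D_one, of ?c] gelfand_one[OF \<eta>] gelfand_proj[OF \<eta> \<mu>(1)[of k]] by simp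
        moreover have "cmod (gelfand x \<eta> - ?c) \<le> \<epsilon>" if "prefix k \<eta> = \<mu> k"
          using k[OF \<eta> \<omega>X order_refl] that pre by simp
        ultimately show "cmod (gelfand (?y * P (\<mu> k)) \<eta>) \<le> \<epsilon>" using \<open>\<epsilon> > 0\<close> by (simp add: norm_mult)
      qed
      finally show ?thesis .
    qed
    then have "cmod (\<theta> x - ?c) \<le> 0" using field_le_epsilon[of "cmod (\<theta> x - ?c)" 0] by simp
    then show ?thesis by simp
  qed
  with \<omega>X show ?thesis by (rule that)
qed

lemma cstar_automorphism_in: "cstar_automorphism D \<alpha> \<Longrightarrow> x \<in> D \<Longrightarrow> \<alpha> x \<in> D"
  unfolding cstar_automorphism_def by (meson bij_betwE)

lemma cstar_automorphism_one: assumes "cstar_automorphism D \<alpha>" shows "\<alpha> 1 = 1"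
proof -
  obtain y where y: "y \<in> D" "\<alpha> y = 1"
    using assms D_one unfolding cstar_automorphism_def bij_betw_def by (metis imageE)
  then have "\<alpha> (y * 1) = \<alpha> y * \<alpha> 1" using assms D_one unfolding cstar_automorphism_def by blast
  then show ?thesis using y(2) by simp
qed

text \<open>Evaluation at \<omega> after \<alpha> is a character, hence evaluation at some point,
  which is taken as \<open>g \<omega>\<close>.\<close>

lemma aut_point_map:
  assumes \<alpha>: "cstar_automorphism D \<alpha>"
  obtains g where "g ` X \<subseteq> X" "word_cont g" "\<And>x \<omega>. x \<in> D \<Longrightarrow> \<omega> \<in> X \<Longrightarrow> gelfand (\<alpha> x) \<omega> = gelfand x (g \<omega>)"
proof -
  note in_D = cstar_automorphism_in[OF \<alpha>]
  have "\<exists>\<eta>\<in>X. \<forall>x\<in>D. gelfand (\<alpha> x) \<omega> = gelfand x \<eta>" if w: "\<omega> \<in> X" for \<omega>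
  proof (rule character_point[of "\<lambda>x. gelfand (\<alpha> x) \<omega>"])
    show "gelfand (\<alpha> (x + y)) \<omega> = gelfand (\<alpha> x) \<omega> + gelfand (\<alpha> y) \<omega>" if "x \<in> D" "y \<in> D" for x y
      using \<alpha> that gelfand_add[OF w in_D in_D] by (simp add: cstar_automorphism_def)
    show "gelfand (\<alpha> (c *C x)) \<omega> = c * gelfand (\<alpha> x) \<omega>" if "x \<in> D" for c x
      using \<alpha> that gelfand_scale[OF w in_D] by (simp add: cstar_automorphism_def)
    show "gelfand (\<alpha> (x * y)) \<omega> = gelfand (\<alpha> x) \<omega> * gelfand (\<alpha> y) \<omega>" if "x \<in> D" "y \<in> D" for x y
      using \<alpha> that gelfand_mult[OF w in_D in_D] by (simp add: cstar_automorphism_def)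
    show "gelfand (\<alpha> 1) \<omega> = 1" by (simp add: cstar_automorphism_one[OF \<alpha>] gelfand_one[OF w])
  qed blast
  then obtain g where g: "\<And>\<omega>. \<omega> \<in> X \<Longrightarrow> g \<omega> \<in> X" "\<And>x \<omega>. x \<in> D \<Longrightarrow> \<omega> \<in> X \<Longrightarrow> gelfand (\<alpha> x) \<omega> = gelfand x (g \<omega>)"
    by metis
  have "word_cont g"
    unfolding word_cont_def
  proof
    fix k
    \<comment> \<open>The transform of \<open>\<alpha> (P \<mu>)\<close> takes only the values 0 and
      1, so varying by less than 1 means being constant. It tells whether \<open>g \<omega>\<close>
      begins with \<mu>.\<close>
    have "\<exists>m. \<forall>\<omega>\<in>X. \<forall>\<eta>\<in>X. prefix m \<omega> = prefix m \<eta> \<longrightarrow> cmod (gelfand (\<alpha> (P \<mu>)) \<omega> - gelfand (\<alpha> (P \<mu>)) \<eta>) < 1"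
      if "\<mu> \<in> W k" for \<mu>
      using gelfand(1)[OF in_D[OF D_proj[OF that]]] unfolding CX_def by simp
    then obtain m where m: "\<And>\<mu> \<omega> \<eta>. \<mu> \<in> W k \<Longrightarrow> \<omega> \<in> X \<Longrightarrow> \<eta> \<in> X \<Longrightarrow> prefix (m \<mu>) \<omega> = prefix (m \<mu>) \<eta> \<Longrightarrow>
        cmod (gelfand (\<alpha> (P \<mu>)) \<omega> - gelfand (\<alpha> (P \<mu>)) \<eta>) < 1"
      by metis
    let ?M = "\<Sum>\<mu>\<in>W k. m \<mu>"
    have "prefix k (g \<omega>) = prefix k (g \<eta>)" if h: "\<omega> \<in> X" "\<eta> \<in> X" "prefix ?M \<omega> = prefix ?M \<eta>" for \<omega> \<eta>
    proof -
      let ?\<mu> = "prefix k (g \<omega>)"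
      have \<mu>: "?\<mu> \<in> W k" using g(1)[OF h(1)] by (rule words_prefix)
      then have "m ?\<mu> \<le> ?M" by (intro member_le_sum) auto
      then have "cmod (gelfand (\<alpha> (P ?\<mu>)) \<omega> - gelfand (\<alpha> (P ?\<mu>)) \<eta>) < 1"
        by (intro m \<mu> h(1,2) prefix_eq_mono[OF h(3)])
      then show ?thesis
        using g(2)[OF D_proj[OF \<mu>]] h gelfand_proj[OF g(1) \<mu>] by (auto split: if_splits)
    qed
    then show "\<exists>m. \<forall>\<omega>\<in>X. \<forall>\<eta>\<in>X. prefix m \<omega> = prefix m \<eta> \<longrightarrow> prefix k (g \<omega>) = prefix k (g \<eta>)"
      by blast
  qed
  then show ?thesis using g that by blast
qed

lemma cstar_automorphism_inv:
  assumes \<alpha>: "cstar_automorphism D \<alpha>" shows "cstar_automorphism D (inv_into D \<alpha>)"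
proof -
  have b: "bij_betw \<alpha> D D" using \<alpha> by (simp add: cstar_automorphism_def)
  have b': "bij_betw (inv_into D \<alpha>) D D" by (rule bij_betw_inv_into[OF b])
  have in_D: "inv_into D \<alpha> x \<in> D" if "x \<in> D" for x using bij_betwE[OF b'] that by blast
  have eq: "inv_into D \<alpha> x = y" if "y \<in> D" "\<alpha> y = x" for x y
    using bij_betw_inv_into_left[OF b that(1)] that(2) by simp
  note r = bij_betw_inv_into_right[OF b]
  show ?thesis
    unfolding cstar_automorphism_def
    using \<alpha> b' by (auto intro!: eq D_add D_scale D_mult D_adj in_D simp: cstar_automorphism_def r in_D)
qed

text \<open>Under this convention the assignment of \<open>f\<close> to \<open>\<alpha>\<close> is covariant, whereas
  precomposition of Gelfand transforms reverses the order.\<close>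

definition implements :: "('a \<Rightarrow> 'a) \<Rightarrow> (nat word \<Rightarrow> nat word) \<Rightarrow> bool" where
  "implements \<alpha> f \<longleftrightarrow> (\<forall>x\<in>D. \<forall>\<omega>\<in>X. gelfand (\<alpha> x) (f \<omega>) = gelfand x \<omega>)"

text \<open>The point map of the inverse automorphism is taken as f, which compensates for the
  contravariance of point maps.\<close>

lemma aut_homeo:
  assumes \<alpha>: "cstar_automorphism D \<alpha>"
  obtains f where "bij_betw f X X" "word_cont f" "word_cont (inv_into X f)" "implements \<alpha> f"
proof -
  have b: "bij_betw \<alpha> D D" using \<alpha> by (simp add: cstar_automorphism_def)
  obtain g where g: "g ` X \<subseteq> X" "word_cont g" "\<And>x \<omega>. x \<in> D \<Longrightarrow> \<omega> \<in> X \<Longrightarrow> gelfand (\<alpha> x) \<omega> = gelfand x (g \<omega>)"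
    by (rule aut_point_map[OF \<alpha>]) blast
  obtain f where f: "f ` X \<subseteq> X" "word_cont f"
    "\<And>x \<omega>. x \<in> D \<Longrightarrow> \<omega> \<in> X \<Longrightarrow> gelfand (inv_into D \<alpha> x) \<omega> = gelfand x (f \<omega>)"
    by (rule aut_point_map[OF cstar_automorphism_inv[OF \<alpha>]]) blast
  have fX: "f \<omega> \<in> X" "g \<omega> \<in> X" if "\<omega> \<in> X" for \<omega> using f(1) g(1) that by blast+
  note inv_D = cstar_automorphism_in[OF cstar_automorphism_inv[OF \<alpha>]]
  have gf: "g (f \<omega>) = \<omega>" if w: "\<omega> \<in> X" for \<omega>
  proof (rule gelfand_separates[OF fX(2)[OF fX(1)[OF w]] w])
    fix x assume x: "x \<in> D"
    show "gelfand x (g (f \<omega>)) = gelfand x \<omega>"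
      using g(3)[OF x fX(1)[OF w]] f(3)[OF cstar_automorphism_in[OF \<alpha> x] w] bij_betw_inv_into_left[OF b x] by simp
  qed
  have fg: "f (g \<omega>) = \<omega>" if w: "\<omega> \<in> X" for \<omega>
  proof (rule gelfand_separates[OF fX(1)[OF fX(2)[OF w]] w])
    fix x assume x: "x \<in> D"
    show "gelfand x (f (g \<omega>)) = gelfand x \<omega>"
      using f(3)[OF x fX(2)[OF w]] g(3)[OF inv_D[OF x] w] bij_betw_inv_into_right[OF b x] by simp
  qed
  have bf: "bij_betw f X X" by (rule bij_betw_byWitness[where f' = g]) (use f(1) g(1) gf fg in auto)
  have "word_cont (inv_into X f)"
    using g(2) by (rule word_cont_cong) (metis bf bij_betw_inv_into_left fg fX(2))
  moreover have "implements \<alpha> f" unfolding implements_def using g(3) fX(1) gf by simp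
  ultimately show ?thesis using bf f(2) that by blast
qed

lemma implements_inv:
  assumes "bij_betw f X X" "implements \<alpha> f" "x \<in> D" "\<omega> \<in> X"
  shows "gelfand (\<alpha> x) \<omega> = gelfand x (inv_into X f \<omega>)"
  using assms bij_betw_inv_into_right[OF assms(1,4)] bij_betwE[OF bij_betw_inv_into[OF assms(1)]]
  unfolding implements_def by metis

lemma implements_inv_into:
  assumes f: "bij_betw f X X" and \<alpha>: "bij_betw \<alpha> D D" and "implements \<alpha> f" "x \<in> D" "\<omega> \<in> X"
  shows "gelfand (inv_into D \<alpha> x) \<omega> = gelfand x (f \<omega>)"
  using assms bij_betw_inv_into_right[OF \<alpha> assms(4)] bij_betwE[OF bij_betw_inv_into[OF \<alpha>]]
  unfolding implements_def by metis

definition homeo_aut :: "(nat word \<Rightarrow> nat word) \<Rightarrow> 'a \<Rightarrow> 'a" where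
  "homeo_aut f = (\<lambda>x\<in>D. \<Phi> (\<lambda>\<omega>. gelfand x (inv_into X f \<omega>)))"

lemma homeo_aut:
  assumes f: "bij_betw f X X" "word_cont f" "word_cont (inv_into X f)"
  shows "cstar_automorphism D (homeo_aut f)" "implements (homeo_aut f) f"
proof -
  let ?g = "inv_into X f"
  have fX: "f ` X \<subseteq> X" "?g ` X \<subseteq> X" using f(1) bij_betw_inv_into[OF f(1)] by (auto simp: bij_betw_def)
  have C: "(\<lambda>\<omega>. gelfand x (?g \<omega>)) \<in> CX" "(\<lambda>\<omega>. gelfand x (f \<omega>)) \<in> CX" if "x \<in> D" for x
    using CX_comp[OF gelfand(1)[OF that]] f fX by blast+
  have in_D: "homeo_aut f x \<in> D" if "x \<in> D" for x using \<Phi>_in[OF C(1)[OF that]] that by (simp add: homeo_aut_def)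
  have gelfand_eq: "gelfand (homeo_aut f x) \<omega> = gelfand x (?g \<omega>)" if "x \<in> D" "\<omega> \<in> X" for x \<omega>
    using gelfand_\<Phi>[OF C(1)] that by (simp add: homeo_aut_def)
  have gX: "?g \<omega> \<in> X" if "\<omega> \<in> X" for \<omega> using fX that by blast
  show "implements (homeo_aut f) f"
    unfolding implements_def using gelfand_eq fX bij_betw_inv_into_left[OF f(1)] by (simp add: image_subset_iff)
  have "bij_betw (homeo_aut f) D D"
  proof (rule bij_betw_byWitness[where f' = "\<lambda>x. \<Phi> (\<lambda>\<omega>. gelfand x (f \<omega>))"])
    show "\<forall>x\<in>D. \<Phi> (\<lambda>\<omega>. gelfand (homeo_aut f x) (f \<omega>)) = x"
    proof
      fix x assume x: "x \<in> D"
      have "\<Phi> (\<lambda>\<omega>. gelfand (homeo_aut f x) (f \<omega>)) = \<Phi> (gelfand x)"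
        using gelfand_eq[OF x] fX bij_betw_inv_into_left[OF f(1)] by (intro \<Phi>_cong) auto
      then show "\<Phi> (\<lambda>\<omega>. gelfand (homeo_aut f x) (f \<omega>)) = x" by (simp add: gelfand(2)[OF x])
    qed
    show "\<forall>x\<in>D. homeo_aut f (\<Phi> (\<lambda>\<omega>. gelfand x (f \<omega>))) = x"
    proof
      fix x assume x: "x \<in> D"
      have y: "\<Phi> (\<lambda>\<omega>. gelfand x (f \<omega>)) \<in> D" by (rule \<Phi>_in[OF C(2)[OF x]])
      show "homeo_aut f (\<Phi> (\<lambda>\<omega>. gelfand x (f \<omega>))) = x"
        by (rule gelfand_eqI[OF in_D[OF y] x])
          (simp add: gelfand_eq[OF y] gelfand_\<Phi>[OF C(2)[OF x]] gX bij_betw_inv_into_right[OF f(1)])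
    qed
  qed (use in_D \<Phi>_in C(2) in auto)
  moreover have "homeo_aut f (x + y) = homeo_aut f x + homeo_aut f y"
    "homeo_aut f (x * y) = homeo_aut f x * homeo_aut f y" if "x \<in> D" "y \<in> D" for x y
    using that by (auto intro!: gelfand_eqI in_D D_add D_mult simp: gelfand_eq gelfand_add gelfand_mult in_D gX D_add D_mult)
  moreover have "homeo_aut f (c *C x) = c *C homeo_aut f x" "homeo_aut f (adj x) = adj (homeo_aut f x)"
    if "x \<in> D" for x c
    using that by (auto intro!: gelfand_eqI in_D D_scale D_adj simp: gelfand_eq gelfand_scale gelfand_adj in_D gX D_scale D_adj)
  ultimately show "cstar_automorphism D (homeo_aut f)" unfolding cstar_automorphism_def by blast
qed

section \<open>The canonical shift, property (P) and permutation unitaries in terms of functions on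
  X\<close>

lemma canonical_shift_\<Phi>:
  assumes F: "F \<in> CX" shows "canonical_shift n S (\<Phi> F) = \<Phi> (\<lambda>\<omega>. F (suffix 1 \<omega>))"
proof -
  \<comment> \<open>Conjugating \<open>P \<mu>\<close> by \<open>S i\<close> gives
    \<open>P (i # \<mu>)\<close>, and the shifted sample point of \<open>i # \<mu>\<close> is that
    of \<mu>. So step elements pass to the next level.\<close>
  have cs: "canonical_shift n S (step k F) = step (Suc k) (\<lambda>\<omega>. F (suffix 1 \<omega>))" for k
  proof -
    have suf: "suffix 1 (ext (i # \<mu>)) = ext \<mu>" for i \<mu> by (auto simp: ext_def fun_eq_iff conc_def)
    have "S i * (F (ext \<mu>) *C P \<mu>) * adj (S i) = F (suffix 1 (ext (i # \<mu>))) *C P (i # \<mu>)" for i \<mu>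
      by (simp add: suf[simplified] mult_scaleC_left mult_scaleC_right word_proj_def word_isometry_Cons adj_mult mult.assoc)
    then show ?thesis
      by (simp add: canonical_shift_def step_def sum_words_Suc sum_distrib_left sum_distrib_right)
  qed
  have FC: "(\<lambda>\<omega>. F (suffix 1 \<omega>)) \<in> CX"
    using iwords_suffix by (intro CX_comp[OF F word_cont_suffix]) auto
  have "(\<lambda>k. step (Suc k) (\<lambda>\<omega>. F (suffix 1 \<omega>))) \<longlonglongrightarrow> canonical_shift n S (\<Phi> F)"
    unfolding cs[symmetric] canonical_shift_def by (intro tendsto_intros tendsto_\<Phi>[OF F])
  then show ?thesis using LIMSEQ_Suc[OF tendsto_\<Phi>[OF FC]] LIMSEQ_unique by blast
qed

lemma gelfand_canonical_shift:
  assumes "x \<in> D"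
  shows "(canonical_shift n S ^^ k) x \<in> D \<and> (\<forall>\<omega>\<in>X. gelfand ((canonical_shift n S ^^ k) x) \<omega> = gelfand x (suffix k \<omega>))"
proof (induction k)
  case (Suc k)
  let ?y = "(canonical_shift n S ^^ k) x"
  have C: "(\<lambda>\<omega>. gelfand ?y (suffix 1 \<omega>)) \<in> CX"
    using iwords_suffix Suc by (intro CX_comp[OF gelfand(1) word_cont_suffix]) auto
  have eq: "canonical_shift n S ?y = \<Phi> (\<lambda>\<omega>. gelfand ?y (suffix 1 \<omega>))"
    using canonical_shift_\<Phi>[OF gelfand(1)[of ?y]] gelfand(2)[of ?y] Suc by simp
  have gelfand_eq: "gelfand (canonical_shift n S ?y) \<omega> = gelfand x (suffix (Suc k) \<omega>)" if "\<omega> \<in> X" for \<omega>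
  proof -
    have "gelfand (canonical_shift n S ?y) \<omega> = gelfand ?y (suffix 1 \<omega>)" using gelfand_\<Phi>[OF C that] by (simp only: eq)
    also have "\<dots> = gelfand x (suffix k (suffix 1 \<omega>))" using Suc iwords_suffix[OF that] by blast
    finally show ?thesis unfolding suffix_suffix by simp
  qed
  have "canonical_shift n S ?y \<in> D" unfolding eq by (rule \<Phi>_in[OF C])
  then show ?case unfolding funpow.simps o_apply using gelfand_eq by blast
qed (simp add: assms)

lemma diagonal_level_1:
  assumes "x \<in> diagonal_level n S 1" shows "x \<in> D"
proof -
  have "P ` W 1 \<subseteq> D" using D_proj by blast
  moreover have "complex_vector.subspace D"
    using cstar_subalgebra_range by (simp add: diagonal_eq cstar_subalgebra_def)
  ultimately show ?thesis
    using assms complex_vector.span_minimal unfolding diagonal_level_def by blast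
qed

text \<open>Composition of transforms reverses the order: \<alpha> after k shifts evaluates at
  \<open>suffix k (g \<omega>)\<close>, while the other side evaluates at
  \<open>suffix m (g (suffix (k - m) \<omega>))\<close>. Elements of level 1 see only the first
  letter, but all k are allowed, which yields all letters from m on.\<close>

lemma property_P_iff:
  assumes \<alpha>: "\<And>x. x \<in> D \<Longrightarrow> \<alpha> x \<in> D" and gX: "g ` X \<subseteq> X"
    and g: "\<And>x \<omega>. x \<in> D \<Longrightarrow> \<omega> \<in> X \<Longrightarrow> gelfand (\<alpha> x) \<omega> = gelfand x (g \<omega>)"
  shows "property_P n S \<alpha> \<longleftrightarrow> (\<exists>m. commutes_from m g)"
proof -
  let ?\<phi> = "canonical_shift n S"
  have gX': "g \<omega> \<in> X" if "\<omega> \<in> X" for \<omega> using gX that by blast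
  have lhs: "\<alpha> ((?\<phi> ^^ k) x) \<in> D" "gelfand (\<alpha> ((?\<phi> ^^ k) x)) \<omega> = gelfand x (suffix k (g \<omega>))"
    if "x \<in> D" "\<omega> \<in> X" for x \<omega> k
    using gelfand_canonical_shift[OF that(1), of k] \<alpha> g gX' that by auto
  have rhs: "(?\<phi> ^^ l) (\<alpha> ((?\<phi> ^^ m) x)) \<in> D"
    "gelfand ((?\<phi> ^^ l) (\<alpha> ((?\<phi> ^^ m) x))) \<omega> = gelfand x (suffix m (g (suffix l \<omega>)))"
    if "x \<in> D" "\<omega> \<in> X" for x \<omega> l m
    using gelfand_canonical_shift[OF lhs(1)[OF that], of l] lhs(2)[OF that(1)] iwords_suffix[OF that(2)] that by auto
  show ?thesis
  proof
    assume "property_P n S \<alpha>"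
    then obtain m where m: "\<forall>k\<ge>m. \<forall>x\<in>diagonal_level n S 1. \<alpha> ((?\<phi> ^^ k) x) = (?\<phi> ^^ (k - m)) (\<alpha> ((?\<phi> ^^ m) x))"
      unfolding property_P_def by blast
    \<comment> \<open>The projection of the one-letter word \<open>g \<omega> (m + l)\<close> serves
      as test element: its transform is 1 on one side, so the other side must begin with the same
      letter.\<close>
    have key: "g \<omega> (m + l) = g (suffix l \<omega>) m" if w: "\<omega> \<in> X" for \<omega> l
    proof -
      let ?\<mu> = "[g \<omega> (m + l)]"
      have "g \<omega> (m + l) \<in> {1..n}" using gX'[OF w] unfolding iwords_def by blast
      then have \<mu>: "?\<mu> \<in> W 1" by (simp add: words_def)
      have "P ?\<mu> \<in> diagonal_level n S 1"
        unfolding diagonal_level_def using \<mu> by (intro complex_vector.span_base) blast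
      with m have "\<alpha> ((?\<phi> ^^ (m + l)) (P ?\<mu>)) = (?\<phi> ^^ (m + l - m)) (\<alpha> ((?\<phi> ^^ m) (P ?\<mu>)))"
        by (meson le_add1)
      then have "\<alpha> ((?\<phi> ^^ (m + l)) (P ?\<mu>)) = (?\<phi> ^^ l) (\<alpha> ((?\<phi> ^^ m) (P ?\<mu>)))"
        by (simp only: add_diff_cancel_left')
      from arg_cong[OF this, of "\<lambda>y. gelfand y \<omega>"]
      have "gelfand (P ?\<mu>) (suffix (m + l) (g \<omega>)) = gelfand (P ?\<mu>) (suffix m (g (suffix l \<omega>)))"
        unfolding lhs(2)[OF D_proj[OF \<mu>] w] rhs(2)[OF D_proj[OF \<mu>] w] .
      moreover have "gelfand (P ?\<mu>) (suffix (m + l) (g \<omega>)) = 1"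
        using gelfand_proj[OF iwords_suffix[OF gX'[OF w]] \<mu>] by simp
      ultimately show ?thesis
        using gelfand_proj[OF iwords_suffix[OF gX'[OF iwords_suffix[OF w]]] \<mu>, of m l] by (simp split: if_splits)
    qed
    have "commutes_from m g"
      unfolding commutes_from_def
    proof (intro ballI ext)
      fix \<omega> j assume w: "\<omega> \<in> X"
      show "suffix m (g (suffix 1 \<omega>)) j = suffix (Suc m) (g \<omega>) j"
        using key[OF iwords_suffix[OF w, of 1], of j] key[OF w, of "Suc j"] by simp
    qed
    then show "\<exists>m. commutes_from m g" ..
  next
    assume "\<exists>m. commutes_from m g"
    then obtain m where m: "commutes_from m g" ..
    show "property_P n S \<alpha>"
      unfolding property_P_def
    proof (intro exI allI impI ballI)
      fix k x assume k: "m \<le> k" and "x \<in> diagonal_level n S 1"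
      then have x: "x \<in> D" by (intro diagonal_level_1)
      show "\<alpha> ((?\<phi> ^^ k) x) = (?\<phi> ^^ (k - m)) (\<alpha> ((?\<phi> ^^ m) x))"
      proof (rule gelfand_eqI)
        fix \<omega> assume w: "\<omega> \<in> X"
        show "gelfand (\<alpha> ((?\<phi> ^^ k) x)) \<omega> = gelfand ((?\<phi> ^^ (k - m)) (\<alpha> ((?\<phi> ^^ m) x))) \<omega>"
          unfolding lhs(2)[OF x w] rhs(2)[OF x w] commutes_fromD[OF m w] using k by simp
      qed (use lhs(1)[OF x ones_in] rhs(1)[OF x ones_in] in auto)
    qed
  qed
qed

text \<open>The unitary sends \<open>Sw \<mu>\<close> to \<open>Sw (\<pi> \<mu>)\<close> for words
  of length k, so conjugation permutes the prefixes of projections. On functions this is composition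
  with the inverse permutation.\<close>

lemma Ad_perm_unitary:
  assumes \<pi>: "bij_betw \<pi> (W k) (W k)" and F: "F \<in> CX"
    and u: "u = (\<Sum>\<mu>\<in>W k. Sw (\<pi> \<mu>) * adj (Sw \<mu>))"
  shows "u * \<Phi> F * adj u = \<Phi> (\<lambda>\<omega>. F (prefix_perm k (inv_into (W k) \<pi>) \<omega>))"
proof -
  let ?\<rho> = "inv_into (W k) \<pi>"
  have \<rho>: "?\<rho> ` W k \<subseteq> W k" using bij_betw_inv_into[OF \<pi>] by (simp add: bij_betw_def)
  have uS: "u * Sw \<nu> = Sw (\<pi> \<nu>)" if "\<nu> \<in> W k" for \<nu>
  proof -
    have "u * Sw \<nu> = (\<Sum>\<mu>\<in>W k. Sw (\<pi> \<mu>) * (if \<mu> = \<nu> then 1 else 0))"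
      unfolding u sum_distrib_right
      by (intro sum.cong refl) (simp add: mult.assoc adj_word_isometry_mult[OF _ that])
    then show ?thesis using that by (simp add: if_distrib[of "(*) _"] sum.delta' cong: if_cong)
  qed
  have uP: "u * P (\<mu> @ \<nu>) * adj u = P (\<pi> \<mu> @ \<nu>)" if "\<mu> \<in> W k" for \<mu> \<nu>
  proof -
    have "u * P (\<mu> @ \<nu>) * adj u = (u * Sw \<mu>) * P \<nu> * adj (u * Sw \<mu>)"
      by (simp add: word_proj_append adj_mult mult.assoc)
    then show ?thesis by (simp add: uS[OF that] word_proj_append)
  qed
  \<comment> \<open>Only levels from k on are compared, where every word has a full prefix of length
    k to permute; the limit does not see the lower levels.\<close>
  have eq: "u * step (k + l) F * adj u = step (k + l) (\<lambda>\<omega>. F (prefix_perm k ?\<rho> \<omega>))" for l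
  proof -
    have "u * step (k + l) F * adj u = (\<Sum>\<mu>\<in>W k. \<Sum>\<nu>\<in>W l. F (ext (\<mu> @ \<nu>)) *C P (\<pi> \<mu> @ \<nu>))"
      unfolding step_def sum_words_add sum_distrib_left sum_distrib_right
      by (intro sum.cong refl) (simp add: mult_scaleC_left mult_scaleC_right uP)
    also have "\<dots> = (\<Sum>\<mu>\<in>W k. \<Sum>\<nu>\<in>W l. F (ext (?\<rho> (\<pi> \<mu>) @ \<nu>)) *C P (\<pi> \<mu> @ \<nu>))"
      by (intro sum.cong refl) (simp add: bij_betw_inv_into_left[OF \<pi>])
    also have "\<dots> = (\<Sum>\<mu>\<in>W k. \<Sum>\<nu>\<in>W l. F (ext (?\<rho> \<mu> @ \<nu>)) *C P (\<mu> @ \<nu>))"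
      by (rule sum.reindex_bij_betw[OF \<pi>])
    also have "\<dots> = step (k + l) (\<lambda>\<omega>. F (prefix_perm k ?\<rho> \<omega>))"
      unfolding step_def sum_words_add
    proof (intro sum.cong refl)
      fix \<mu> \<nu> assume "\<mu> \<in> W k" "\<nu> \<in> W l"
      then have "prefix_perm k ?\<rho> (ext (\<mu> @ \<nu>)) = ext (?\<rho> \<mu> @ \<nu>)"
        by (simp add: prefix_perm_def ext_def words_length prefix_conc_length flip: conc_conc)
      then show "F (ext (?\<rho> \<mu> @ \<nu>)) *C P (\<mu> @ \<nu>) = F (prefix_perm k ?\<rho> (ext (\<mu> @ \<nu>))) *C P (\<mu> @ \<nu>)" by simp
    qed
    finally show ?thesis .
  qed
  have C: "(\<lambda>\<omega>. F (prefix_perm k ?\<rho> \<omega>)) \<in> CX"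
    by (rule CX_comp[OF F prefix_perm_cont prefix_perm_in[OF \<rho>]])
  have "(\<lambda>l. u * step (l + k) F * adj u) \<longlonglongrightarrow> u * \<Phi> F * adj u"
    by (intro tendsto_intros LIMSEQ_ignore_initial_segment tendsto_\<Phi>[OF F])
  moreover have "(\<lambda>l. u * step (l + k) F * adj u) \<longlonglongrightarrow> \<Phi> (\<lambda>\<omega>. F (prefix_perm k ?\<rho> \<omega>))"
    using LIMSEQ_ignore_initial_segment[OF tendsto_\<Phi>[OF C], of k] eq by (simp add: add.commute)
  ultimately show ?thesis by (rule LIMSEQ_unique)
qed

end

section \<open>The quotient groups\<close>

definition shift_pow :: "nat \<Rightarrow> int \<Rightarrow> (int \<Rightarrow> nat) \<Rightarrow> (int \<Rightarrow> nat)" where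
  "shift_pow n j = restrict (zshift j) (Sig n)"

lemma shift_map_eq: "shift_map n = shift_pow n 1"
  by (auto simp: shift_map_def shift_pow_def zshift_def fun_eq_iff restrict_def)

lemma local_code_cong: "local_code n r \<psi> \<Longrightarrow> (\<And>x. x \<in> Sig n \<Longrightarrow> \<psi> x = \<phi> x) \<Longrightarrow> local_code n r \<phi>"
  unfolding local_code_def by metis

lemma shift_pow_in: "shift_pow n j \<in> carrier (shift_Aut n)"
  unfolding shift_Aut_iff
proof (intro conjI ballI allI)
  have b: "bij_betw (shift_pow n j) (Sig n) (Sig n)"
    by (rule bij_betw_byWitness[where f' = "zshift (- j)"]) (auto simp: shift_pow_def zshift_in)
  then show "shift_pow n j \<in> Bij (Sig n)" by (simp add: Bij_def shift_pow_def)
  show "shift_pow n j (zshift i x) = zshift i (shift_pow n j x)" if "x \<in> Sig n" for x i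
    using that by (simp add: shift_pow_def zshift_in add.commute)
  have code: "local_code n (nat \<bar>i\<bar>) (zshift i)" for i
    by (simp add: local_code_def zshift_def)
  show "\<exists>r. local_code n r (shift_pow n j)"
    using local_code_cong[OF code[of j], of "shift_pow n j"] by (auto simp: shift_pow_def)
  have "inv_into (Sig n) (shift_pow n j) x = zshift (- j) x" if "x \<in> Sig n" for x
    using b that zshift_in[OF that] by (intro inv_into_f_eq) (auto simp: bij_betw_def shift_pow_def)
  then show "\<exists>r. local_code n r (inv_into (Sig n) (shift_pow n j))"
    using local_code_cong[OF code[of "- j"], of "inv_into (Sig n) (shift_pow n j)"] by auto
qed

lemma shift_Aut_mult:
  assumes "\<psi> \<in> carrier (shift_Aut n)" "\<phi> \<in> carrier (shift_Aut n)"
  shows "\<psi> \<otimes>\<^bsub>shift_Aut n\<^esub> \<phi> = compose (Sig n) \<psi> \<phi>"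
  using assms by (simp add: shift_Aut_def BijGroup_def)

lemma shift_Aut_one: "\<one>\<^bsub>shift_Aut n\<^esub> = shift_pow n 0"
  by (auto simp: shift_Aut_def BijGroup_def shift_pow_def fun_eq_iff restrict_def)

lemma subgroup_shift_Aut: "subgroup (carrier (shift_Aut n)) (BijGroup (Sig n))"
proof (rule group.subgroupI[OF group_BijGroup])
  show "carrier (shift_Aut n) \<subseteq> carrier (BijGroup (Sig n))"
    by (auto simp: shift_Aut_def BijGroup_def)
  show "carrier (shift_Aut n) \<noteq> {}" using shift_pow_in by blast
next
  fix \<psi> assume \<psi>: "\<psi> \<in> carrier (shift_Aut n)"
  then have B: "\<psi> \<in> Bij (Sig n)" by (simp add: shift_Aut_iff)
  then have b: "bij_betw \<psi> (Sig n) (Sig n)" by (simp add: Bij_def)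
  let ?\<phi> = "restrict (inv_into (Sig n) \<psi>) (Sig n)"
  have B': "?\<phi> \<in> Bij (Sig n)" by (rule restrict_inv_into_Bij[OF B])
  have inv: "inv_into (Sig n) ?\<phi> x = \<psi> x" if "x \<in> Sig n" for x
    using B' that bij_betwE[OF b] bij_betw_inv_into_left[OF b that]
    by (intro inv_into_f_eq) (auto simp: Bij_def bij_betw_def)
  have "?\<phi> \<in> carrier (shift_Aut n)"
    unfolding shift_Aut_iff
  proof (intro conjI ballI allI B')
    show "?\<phi> (zshift j x) = zshift j (?\<phi> x)" if "x \<in> Sig n" for x j
      using inv_into_zshift[OF b _ that] \<psi> that zshift_in by (simp add: shift_Aut_iff)
    show "\<exists>r. local_code n r ?\<phi>"
      using \<psi> local_code_cong[of n _ "inv_into (Sig n) \<psi>" ?\<phi>] by (auto simp: shift_Aut_iff)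
    show "\<exists>r. local_code n r (inv_into (Sig n) ?\<phi>)"
      using \<psi> local_code_cong[of n _ \<psi> "inv_into (Sig n) ?\<phi>"] inv by (auto simp: shift_Aut_iff)
  qed
  then show "inv\<^bsub>BijGroup (Sig n)\<^esub> \<psi> \<in> carrier (shift_Aut n)" by (simp only: inv_BijGroup[OF B])
next
  fix \<psi> \<phi> assume "\<psi> \<in> carrier (shift_Aut n)" "\<phi> \<in> carrier (shift_Aut n)"
  then have B: "\<psi> \<in> Bij (Sig n)" "\<phi> \<in> Bij (Sig n)"
    and h: "homeomorphic_map (full_shift n) (full_shift n) \<psi>" "homeomorphic_map (full_shift n) (full_shift n) \<phi>"
    and com: "\<forall>x\<in>Sig n. \<psi> (shift_map n x) = shift_map n (\<psi> x)" "\<forall>x\<in>Sig n. \<phi> (shift_map n x) = shift_map n (\<phi> x)"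
    by (auto simp: shift_Aut_def)
  have "homeomorphic_map (full_shift n) (full_shift n) (compose (Sig n) \<psi> \<phi>)"
    using homeomorphic_map_compose[OF h(2,1)] by (rule homeomorphic_map_eq) (simp add: compose_def)
  moreover have "compose (Sig n) \<psi> \<phi> (shift_map n x) = shift_map n (compose (Sig n) \<psi> \<phi> x)" if "x \<in> Sig n" for x
  proof -
    have "\<phi> x \<in> Sig n" using Bij_imp_funcset[OF B(2)] that by blast
    then show ?thesis using com that zshift_in[OF that, of 1] by (simp add: compose_def shift_map_eq shift_pow_def)
  qed
  ultimately have "compose (Sig n) \<psi> \<phi> \<in> carrier (shift_Aut n)"
    using compose_Bij[OF B] by (simp add: shift_Aut_def)
  then show "\<psi> \<otimes>\<^bsub>BijGroup (Sig n)\<^esub> \<phi> \<in> carrier (shift_Aut n)"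
    using B by (simp add: BijGroup_def)
qed

lemma group_shift_Aut: "group (shift_Aut n)"
  using subgroup.subgroup_is_group[OF subgroup_shift_Aut group_BijGroup] by (simp add: shift_Aut_def)

lemma shift_pow_mult: "shift_pow n i \<otimes>\<^bsub>shift_Aut n\<^esub> shift_pow n j = shift_pow n (i + j)"
  unfolding shift_Aut_mult[OF shift_pow_in shift_pow_in]
  by (auto simp: compose_def shift_pow_def fun_eq_iff restrict_def zshift_in)

lemma shift_pow_inv: "inv\<^bsub>shift_Aut n\<^esub> (shift_pow n j) = shift_pow n (- j)"
  by (rule group.inv_equality[OF group_shift_Aut]) (simp_all add: shift_pow_mult shift_pow_in shift_Aut_one)

lemma generate_shift: "generate (shift_Aut n) {shift_map n} = range (shift_pow n)"
proof
  show "generate (shift_Aut n) {shift_map n} \<subseteq> range (shift_pow n)"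
  proof
    fix x assume "x \<in> generate (shift_Aut n) {shift_map n}"
    then show "x \<in> range (shift_pow n)"
      by (induction rule: generate.induct) (auto simp: shift_Aut_one shift_map_eq shift_pow_inv shift_pow_mult)
  qed
  have 1: "shift_pow n (int k) \<in> generate (shift_Aut n) {shift_map n}" for k
  proof (induction k)
    case 0
    show ?case using generate.one[of "shift_Aut n"] by (simp add: shift_Aut_one)
  next
    case (Suc k)
    have "shift_pow n (int k) \<otimes>\<^bsub>shift_Aut n\<^esub> shift_map n \<in> generate (shift_Aut n) {shift_map n}"
      by (rule generate.eng[OF Suc generate.incl]) simp
    then show ?case by (simp add: shift_map_eq shift_pow_mult add.commute)
  qed
  have "shift_pow n j \<in> generate (shift_Aut n) {shift_map n}" for j
  proof (cases "j \<ge> 0")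
    case True
    then show ?thesis using 1[of "nat j"] by simp
  next
    case False
    have "inv\<^bsub>shift_Aut n\<^esub> (shift_pow n (int (nat (- j)))) \<in> generate (shift_Aut n) {shift_map n}"
      using group.generate_m_inv_closed[OF group_shift_Aut _ 1[of "nat (- j)"]] shift_pow_in by (simp add: shift_map_eq)
    then show ?thesis using False by (simp add: shift_pow_inv)
  qed
  then show "range (shift_pow n) \<subseteq> generate (shift_Aut n) {shift_map n}" by blast
qed

text \<open>The powers of the shift are central, so conjugation fixes each of them.\<close>

lemma normal_shift: "generate (shift_Aut n) {shift_map n} \<lhd> shift_Aut n"
proof -
  interpret K: group "shift_Aut n" by (rule group_shift_Aut)
  have "\<psi> \<otimes>\<^bsub>shift_Aut n\<^esub> shift_pow n j \<otimes>\<^bsub>shift_Aut n\<^esub> inv\<^bsub>shift_Aut n\<^esub> \<psi> \<in> range (shift_pow n)"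
    if \<psi>: "\<psi> \<in> carrier (shift_Aut n)" for \<psi> j
  proof -
    have "\<psi> x \<in> Sig n" "\<psi> (zshift j x) = zshift j (\<psi> x)" if "x \<in> Sig n" for x
      using \<psi> that Bij_imp_funcset by (auto simp: shift_Aut_iff)
    then have "\<psi> \<otimes>\<^bsub>shift_Aut n\<^esub> shift_pow n j = shift_pow n j \<otimes>\<^bsub>shift_Aut n\<^esub> \<psi>"
      unfolding shift_Aut_mult[OF \<psi> shift_pow_in] shift_Aut_mult[OF shift_pow_in \<psi>] compose_def
      by (intro restrict_ext) (simp add: shift_pow_def)
    then have "\<psi> \<otimes>\<^bsub>shift_Aut n\<^esub> shift_pow n j \<otimes>\<^bsub>shift_Aut n\<^esub> inv\<^bsub>shift_Aut n\<^esub> \<psi> = shift_pow n j"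
      using K.inv_solve_right'[of "shift_pow n j" _ \<psi>] \<psi> shift_pow_in by simp
    then show ?thesis by simp
  qed
  then show ?thesis
    using K.generate_is_subgroup[of "{shift_map n}"] shift_pow_in
    unfolding K.normal_inv_iff generate_shift by (auto simp: shift_map_eq)
qed

section \<open>The homomorphism from automorphisms of the diagonal to automorphisms of the full
  shift, and its kernel\<close>

context cuntz
begin

abbreviation G where "G \<equiv> G_group n S"

text \<open>The roles cross: \<alpha> acts on transforms by composition with the inverse of f, so
  property (P) of \<alpha> concerns \<open>inv_into X f\<close>, and that of the inverse
  automorphism concerns f. As both are required, the swap is harmless.\<close>

lemma G_carrier_iff:
  "\<alpha> \<in> carrier G \<longleftrightarrow> \<alpha> \<in> Bij D \<and> cstar_automorphism D \<alpha> \<and> (\<exists>f\<in>G_homeos. implements \<alpha> f)"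
proof -
  have "property_P n S \<alpha> \<and> property_P n S (inv_into D \<alpha>) \<longleftrightarrow> (\<exists>m. commutes_from m (inv_into X f)) \<and> (\<exists>m. commutes_from m f)"
    if "cstar_automorphism D \<alpha>" "implements \<alpha> f" "bij_betw f X X" for f
  proof -
    have b: "bij_betw \<alpha> D D" using that(1) by (simp add: cstar_automorphism_def)
    have "property_P n S \<alpha> \<longleftrightarrow> (\<exists>m. commutes_from m (inv_into X f))"
      using bij_betwE[OF b] bij_betw_inv_into[OF that(3)] implements_inv[OF that(3,2)]
      by (intro property_P_iff) (auto simp: bij_betw_def)
    moreover have "property_P n S (inv_into D \<alpha>) \<longleftrightarrow> (\<exists>m. commutes_from m f)"
      using bij_betwE[OF bij_betw_inv_into[OF b]] that(3) implements_inv_into[OF that(3) b that(2)]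
      by (intro property_P_iff) (auto simp: bij_betw_def)
    ultimately show ?thesis by blast
  qed
  note key = this
  have carr: "\<alpha> \<in> carrier G \<longleftrightarrow> \<alpha> \<in> Bij D \<and> cstar_automorphism D \<alpha> \<and> property_P n S \<alpha> \<and> property_P n S (inv_into D \<alpha>)"
    by (simp add: G_group_def)
  show ?thesis
  proof
    assume l: "\<alpha> \<in> carrier G"
    then have aut: "cstar_automorphism D \<alpha>" using carr by blast
    obtain f where f: "bij_betw f X X" "word_cont f" "word_cont (inv_into X f)" "implements \<alpha> f"
      by (rule aut_homeo[OF aut])
    then have "f \<in> G_homeos" using key[OF aut f(4,1)] l carr by (simp add: G_homeos_def)
    then show "\<alpha> \<in> Bij D \<and> cstar_automorphism D \<alpha> \<and> (\<exists>f\<in>G_homeos. implements \<alpha> f)"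
      using l carr f(4) by blast
  next
    assume r: "\<alpha> \<in> Bij D \<and> cstar_automorphism D \<alpha> \<and> (\<exists>f\<in>G_homeos. implements \<alpha> f)"
    then obtain f where f: "f \<in> G_homeos" "implements \<alpha> f" by blast
    then have "property_P n S \<alpha> \<and> property_P n S (inv_into D \<alpha>)"
      using key[of f] r by (simp add: G_homeos_def)
    then show "\<alpha> \<in> carrier G" using r carr by blast
  qed
qed

lemma cstar_automorphism_cong:
  "cstar_automorphism D \<alpha> \<Longrightarrow> (\<And>x. x \<in> D \<Longrightarrow> \<alpha> x = \<beta> x) \<Longrightarrow> cstar_automorphism D \<beta>"
  unfolding cstar_automorphism_def
  by (simp add: bij_betw_cong[of D \<alpha> \<beta>] D_add D_scale D_mult D_adj)

lemma cstar_automorphism_comp: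
  assumes \<alpha>: "cstar_automorphism D \<alpha>" and \<beta>: "cstar_automorphism D \<beta>"
  shows "cstar_automorphism D (\<alpha> \<circ> \<beta>)"
  using \<alpha> \<beta> cstar_automorphism_in[OF \<beta>] bij_betw_trans[of \<beta> D D \<alpha> D]
  unfolding cstar_automorphism_def by simp

lemma implements_comp:
  assumes "implements \<alpha> f" "implements \<beta> g" "g ` X \<subseteq> X" "\<And>x. x \<in> D \<Longrightarrow> \<beta> x \<in> D"
  shows "implements (compose D \<alpha> \<beta>) (f \<circ> g)"
  using assms unfolding implements_def by (auto simp: compose_def)

lemma implements_id: "implements (\<lambda>x\<in>D. x) (\<lambda>\<omega>. \<omega>)"
  by (simp add: implements_def)

lemma id_G_homeos: "(\<lambda>\<omega>. \<omega>) \<in> G_homeos"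
  using commutes_from_id by (intro G_homeosI[where f' = "\<lambda>\<omega>. \<omega>"]) (auto simp: word_cont_def)

lemma subgroup_G: "subgroup (carrier G) (BijGroup D)"
proof (rule group.subgroupI[OF group_BijGroup])
  show "carrier G \<subseteq> carrier (BijGroup D)"
    by (auto simp: G_carrier_iff BijGroup_def)
  have "cstar_automorphism D (\<lambda>x\<in>D. x)"
    by (rule cstar_automorphism_cong[of "\<lambda>x. x"]) (simp_all add: cstar_automorphism_def bij_betw_def)
  then have "(\<lambda>x\<in>D. x) \<in> carrier G"
    using id_Bij implements_id id_G_homeos by (auto simp: G_carrier_iff)
  then show "carrier G \<noteq> {}" by blast
next
  fix \<alpha> assume \<alpha>: "\<alpha> \<in> carrier G"
  then obtain f where f: "f \<in> G_homeos" "implements \<alpha> f" by (auto simp: G_carrier_iff)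
  have bf: "bij_betw f X X" using f(1) by (simp add: G_homeos_def)
  have B: "\<alpha> \<in> Bij D" and aut: "cstar_automorphism D \<alpha>" using \<alpha> by (auto simp: G_carrier_iff)
  then have b: "bij_betw \<alpha> D D" by (simp add: Bij_def)
  let ?\<beta> = "restrict (inv_into D \<alpha>) D"
  have "cstar_automorphism D ?\<beta>"
    by (rule cstar_automorphism_cong[OF cstar_automorphism_inv[OF aut]]) simp
  moreover have "implements ?\<beta> (inv_into X f)"
    unfolding implements_def
    using implements_inv_into[OF bf b f(2)] bij_betwE[OF bij_betw_inv_into[OF bf]] bij_betw_inv_into_right[OF bf]
    by simp
  ultimately have "?\<beta> \<in> carrier G"
    using restrict_inv_into_Bij[OF B] G_homeos_inv[OF f(1)] by (auto simp: G_carrier_iff)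
  then show "inv\<^bsub>BijGroup D\<^esub> \<alpha> \<in> carrier G" by (simp only: inv_BijGroup[OF B])
next
  fix \<alpha> \<beta> assume "\<alpha> \<in> carrier G" "\<beta> \<in> carrier G"
  then obtain f g where fg: "f \<in> G_homeos" "implements \<alpha> f" "g \<in> G_homeos" "implements \<beta> g"
    and B: "\<alpha> \<in> Bij D" "\<beta> \<in> Bij D" and aut: "cstar_automorphism D \<alpha>" "cstar_automorphism D \<beta>"
    by (auto simp: G_carrier_iff)
  have "implements (compose D \<alpha> \<beta>) (f \<circ> g)"
    using implements_comp[OF fg(2,4)] G_homeos_image[OF fg(3)] cstar_automorphism_in[OF aut(2)] by blast
  moreover have "cstar_automorphism D (compose D \<alpha> \<beta>)"
    by (rule cstar_automorphism_cong[OF cstar_automorphism_comp[OF aut]]) (simp add: compose_def)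
  ultimately have "compose D \<alpha> \<beta> \<in> carrier G"
    using compose_Bij[OF B] G_homeos_comp[OF fg(1,3)] by (auto simp: G_carrier_iff)
  then show "\<alpha> \<otimes>\<^bsub>BijGroup D\<^esub> \<beta> \<in> carrier G" using B by (simp add: BijGroup_def)
qed

lemma group_G: "group G"
  using subgroup.subgroup_is_group[OF subgroup_G group_BijGroup] by (simp add: G_group_def)

text \<open>The choice is immaterial: \<alpha> determines f on X because transforms separate points,
  see \<open>two_sided_eq\<close>.\<close>

definition two_sided :: "('a \<Rightarrow> 'a) \<Rightarrow> (int \<Rightarrow> nat) \<Rightarrow> (int \<Rightarrow> nat)" where
  "two_sided \<alpha> = bar (SOME f. f \<in> G_homeos \<and> implements \<alpha> f)"

lemma two_sided_eq:
  assumes \<alpha>: "cstar_automorphism D \<alpha>" and f: "f \<in> G_homeos" "implements \<alpha> f"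
  shows "two_sided \<alpha> = bar f"
proof -
  define g where "g = (SOME f. f \<in> G_homeos \<and> implements \<alpha> f)"
  have g: "g \<in> G_homeos" "implements \<alpha> g"
    using someI[of "\<lambda>f. f \<in> G_homeos \<and> implements \<alpha> f" f] f by (auto simp: g_def)
  have "g \<omega> = f \<omega>" if w: "\<omega> \<in> X" for \<omega>
  proof (rule gelfand_separates[OF G_homeos_in[OF g(1) w] G_homeos_in[OF f(1) w]])
    fix y assume "y \<in> D"
    then obtain x where "x \<in> D" "y = \<alpha> x"
      using \<alpha> unfolding cstar_automorphism_def bij_betw_def by blast
    then show "gelfand y (g \<omega>) = gelfand y (f \<omega>)" using f(2) g(2) w by (simp add: implements_def)
  qed
  then show ?thesis unfolding two_sided_def g_def[symmetric] by (rule bar_cong)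
qed

lemma two_sided_hom: "two_sided \<in> hom G (shift_Aut n)"
proof (rule homI)
  show "two_sided \<alpha> \<in> carrier (shift_Aut n)" if "\<alpha> \<in> carrier G" for \<alpha>
    using that two_sided_eq bar_shift_Aut by (auto simp: G_carrier_iff)
  fix \<alpha> \<beta> assume "\<alpha> \<in> carrier G" "\<beta> \<in> carrier G"
  then obtain f g where fg: "f \<in> G_homeos" "implements \<alpha> f" "g \<in> G_homeos" "implements \<beta> g"
    and B: "\<alpha> \<in> Bij D" "\<beta> \<in> Bij D" and aut: "cstar_automorphism D \<alpha>" "cstar_automorphism D \<beta>"
    by (auto simp: G_carrier_iff)
  have mult: "\<alpha> \<otimes>\<^bsub>G\<^esub> \<beta> = compose D \<alpha> \<beta>" using B by (simp add: G_group_def BijGroup_def)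
  have "implements (compose D \<alpha> \<beta>) (f \<circ> g)"
    using implements_comp[OF fg(2,4)] G_homeos_image[OF fg(3)] cstar_automorphism_in[OF aut(2)] by blast
  moreover have "cstar_automorphism D (compose D \<alpha> \<beta>)"
    by (rule cstar_automorphism_cong[OF cstar_automorphism_comp[OF aut]]) (simp add: compose_def)
  ultimately have "two_sided (\<alpha> \<otimes>\<^bsub>G\<^esub> \<beta>) = bar (f \<circ> g)"
    unfolding mult by (intro two_sided_eq G_homeos_comp fg)
  also have "\<dots> = compose (Sig n) (bar f) (bar g)"
  proof
    fix x
    show "bar (f \<circ> g) x = compose (Sig n) (bar f) (bar g) x"
      using bar_comp_G_homeos[OF fg(1,3), of x] by (cases "x \<in> Sig n") (simp_all add: compose_def bar_def)
  qed
  also have "\<dots> = two_sided \<alpha> \<otimes>\<^bsub>shift_Aut n\<^esub> two_sided \<beta>"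
    using two_sided_eq[OF aut(1) fg(1,2)] two_sided_eq[OF aut(2) fg(3,4)]
    by (simp add: shift_Aut_mult bar_shift_Aut fg)
  finally show "two_sided (\<alpha> \<otimes>\<^bsub>G\<^esub> \<beta>) = two_sided \<alpha> \<otimes>\<^bsub>shift_Aut n\<^esub> two_sided \<beta>" .
qed

text \<open>Both sides compose the transform of x with the inverse prefix permutation: \<alpha> by
  the convention of \<open>implements\<close>, and conjugation by
  \<open>Ad_perm_unitary\<close>.\<close>

lemma implements_prefix_perm:
  assumes \<pi>: "bij_betw \<pi> (W k) (W k)" and f: "\<And>\<omega>. \<omega> \<in> X \<Longrightarrow> f \<omega> = prefix_perm k \<pi> \<omega>"
    and \<alpha>: "implements \<alpha> f" "\<And>x. x \<in> D \<Longrightarrow> \<alpha> x \<in> D"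
    and u: "u = (\<Sum>\<mu>\<in>W k. Sw (\<pi> \<mu>) * adj (Sw \<mu>))" and x: "x \<in> D"
  shows "\<alpha> x = u * x * adj u"
proof -
  let ?\<rho> = "inv_into (W k) \<pi>"
  have im: "\<pi> ` W k \<subseteq> W k" "?\<rho> ` W k \<subseteq> W k"
    using \<pi> bij_betw_inv_into[OF \<pi>] by (simp_all add: bij_betw_def)
  have C: "(\<lambda>\<omega>. gelfand x (prefix_perm k ?\<rho> \<omega>)) \<in> CX"
    by (rule CX_comp[OF gelfand(1)[OF x] prefix_perm_cont prefix_perm_in[OF im(2)]])
  have eq: "u * x * adj u = \<Phi> (\<lambda>\<omega>. gelfand x (prefix_perm k ?\<rho> \<omega>))"
    using Ad_perm_unitary[OF \<pi> gelfand(1)[OF x] u] gelfand(2)[OF x] by simp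
  show ?thesis
  proof (rule gelfand_eqI[OF \<alpha>(2)[OF x]])
    show "u * x * adj u \<in> D" unfolding eq by (rule \<Phi>_in[OF C])
    fix \<omega> assume w: "\<omega> \<in> X"
    let ?\<eta> = "prefix_perm k ?\<rho> \<omega>"
    have \<eta>: "?\<eta> \<in> X" using prefix_perm_in[OF im(2)] w by blast
    have "f ?\<eta> = \<omega>"
      using f[OF \<eta>] prefix_perm_inverse[OF im(2) _ w] bij_betw_inv_into_right[OF \<pi>] by simp
    then have "gelfand (\<alpha> x) \<omega> = gelfand x ?\<eta>" using \<alpha>(1) x \<eta> unfolding implements_def by metis
    then show "gelfand (\<alpha> x) \<omega> = gelfand (u * x * adj u) \<omega>" unfolding eq gelfand_\<Phi>[OF C w] .
  qed
qed

text \<open>A power of the shift arises from f only with exponent 0, so the preimage of the subgroup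
  generated by the shift is already the kernel of \<open>two_sided\<close>. That kernel consists of
  the prefix permutations, which are implemented by permutation unitaries.\<close>

lemma IG_eq: "IG_subgroup n S = {\<alpha> \<in> carrier G. two_sided \<alpha> \<in> generate (shift_Aut n) {shift_map n}}"
proof (intro equalityI subsetI)
  fix \<alpha> assume "\<alpha> \<in> IG_subgroup n S"
  then obtain k \<pi> where \<pi>: "bij_betw \<pi> (W k) (W k)"
    and \<alpha>: "\<alpha> = restrict (\<lambda>x. (\<Sum>\<mu>\<in>W k. Sw (\<pi> \<mu>) * adj (Sw \<mu>)) * x * adj (\<Sum>\<mu>\<in>W k. Sw (\<pi> \<mu>) * adj (Sw \<mu>))) D"
    unfolding IG_subgroup_def perm_unitaries_def by blast
  let ?f = "prefix_perm k \<pi>"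
  have f: "?f \<in> G_homeos" by (rule prefix_perm_G_homeos[OF \<pi>])
  then have h: "cstar_automorphism D (homeo_aut ?f)" "implements (homeo_aut ?f) ?f"
    using homeo_aut by (auto simp: G_homeos_def)
  have "homeo_aut ?f x = \<alpha> x" for x
  proof (cases "x \<in> D")
    case True
    then show ?thesis
      using implements_prefix_perm[OF \<pi> refl h(2) cstar_automorphism_in[OF h(1)] refl] by (simp add: \<alpha>)
  qed (simp add: \<alpha> homeo_aut_def)
  then have eq: "\<alpha> = homeo_aut ?f" by auto
  have "\<alpha> \<in> Bij D" using h(1) unfolding eq[symmetric] by (simp add: Bij_def cstar_automorphism_def \<alpha>)
  then have "\<alpha> \<in> carrier G" using h f by (auto simp: G_carrier_iff eq)
  moreover have "bar ?f = shift_pow n 0"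
    using bar_prefix_perm[OF \<pi>] by (auto simp: shift_pow_def bar_def fun_eq_iff restrict_def)
  then have "two_sided \<alpha> = shift_pow n 0" using two_sided_eq[OF h(1) f h(2)] by (simp add: eq)
  ultimately show "\<alpha> \<in> {\<alpha> \<in> carrier G. two_sided \<alpha> \<in> generate (shift_Aut n) {shift_map n}}"
    by (simp add: generate_shift)
next
  fix \<alpha> assume "\<alpha> \<in> {\<alpha> \<in> carrier G. two_sided \<alpha> \<in> generate (shift_Aut n) {shift_map n}}"
  then obtain f j where f: "f \<in> G_homeos" "implements \<alpha> f" and aut: "cstar_automorphism D \<alpha>"
    and B: "\<alpha> \<in> Bij D" and j: "two_sided \<alpha> = shift_pow n j"
    by (auto simp: G_carrier_iff generate_shift)
  have bar: "bar f x = zshift j x" if "x \<in> Sig n" for x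
    using that j two_sided_eq[OF aut f] by (simp add: shift_pow_def)
  then have "j = 0" by (rule bar_power_of_shift[OF f(1)])
  then obtain k \<pi> where \<pi>: "bij_betw \<pi> (W k) (W k)" "\<And>\<omega>. \<omega> \<in> X \<Longrightarrow> f \<omega> = prefix_perm k \<pi> \<omega>"
    using bar_eq_idD[OF f(1)] bar by (metis zshift_0)
  define u where "u = (\<Sum>\<mu>\<in>W k. Sw (\<pi> \<mu>) * adj (Sw \<mu>))"
  have "\<alpha> = restrict (\<lambda>x. u * x * adj u) D"
    using implements_prefix_perm[OF \<pi> f(2) cstar_automorphism_in[OF aut] u_def] Bij_imp_extensional[OF B]
    by (intro extensionalityI[of _ D]) auto
  moreover have "u \<in> perm_unitaries n S"
    using \<pi>(1) unfolding perm_unitaries_def u_def by blast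
  ultimately show "\<alpha> \<in> IG_subgroup n S" unfolding IG_subgroup_def by blast
qed

text \<open>The first isomorphism theorem for q, which is \<open>two_sided\<close> followed by the
  projection to cosets; \<open>IG_eq\<close> identifies its kernel. For surjectivity it is enough to
  reach \<psi> up to a power of the shift, since that power is absorbed by the coset.\<close>

lemma embedding_and_iso:
  shows "\<exists>h. h \<in> mon (G Mod IG_subgroup n S) (shift_Aut n Mod generate (shift_Aut n) {shift_map n})"
    and "prime n \<Longrightarrow> G Mod IG_subgroup n S \<cong> shift_Aut n Mod generate (shift_Aut n) {shift_map n}"
proof -
  let ?K = "shift_Aut n"
  let ?N = "generate ?K {shift_map n}"
  interpret K: group ?K by (rule group_shift_Aut)
  interpret N: normal ?N ?K by (rule normal_shift)
  define q where "q \<alpha> = ?N #>\<^bsub>?K\<^esub> two_sided \<alpha>" for \<alpha>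
  have q: "q \<in> hom G (?K Mod ?N)"
    using hom_compose[OF two_sided_hom N.r_coset_hom_Mod] by (simp add: q_def[abs_def] o_def)
  interpret q: group_hom G "?K Mod ?N" q
    using q group_G N.factorgroup_is_group by (simp add: group_hom_def group_hom_axioms_def)
  have in_K: "two_sided \<alpha> \<in> carrier ?K" if "\<alpha> \<in> carrier G" for \<alpha>
    using two_sided_hom that by (rule hom_in_carrier)
  have "q \<alpha> = ?N \<longleftrightarrow> two_sided \<alpha> \<in> ?N" if "\<alpha> \<in> carrier G" for \<alpha>
    unfolding q_def using K.coset_join1[OF _ in_K[OF that] N.subgroup_axioms]
      K.coset_join2[OF in_K[OF that] N.subgroup_axioms] N.subset by blast
  then have ker: "kernel G (?K Mod ?N) q = IG_subgroup n S"
    by (auto simp: kernel_def IG_eq)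
  show "\<exists>h. h \<in> mon (G Mod IG_subgroup n S) (?K Mod ?N)"
    using q.FactGroup_hom q.FactGroup_inj_on unfolding ker mon_def by blast
  show "G Mod IG_subgroup n S \<cong> ?K Mod ?N" if prime: "prime n"
  proof -
    have "carrier (?K Mod ?N) \<subseteq> q ` carrier G"
    proof
      fix Y assume "Y \<in> carrier (?K Mod ?N)"
      then obtain \<psi> where \<psi>: "\<psi> \<in> carrier ?K" "Y = ?N #>\<^bsub>?K\<^esub> \<psi>" by (auto simp: carrier_FactGroup)
      obtain f j where f: "f \<in> G_homeos" "\<And>x. x \<in> Sig n \<Longrightarrow> bar f x = zshift j (\<psi> x)"
        by (rule bar_surj_mod_shift[OF prime \<psi>(1)]) blast
      let ?\<alpha> = "homeo_aut f"
      have h: "cstar_automorphism D ?\<alpha>" "implements ?\<alpha> f"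
        using homeo_aut f(1) by (auto simp: G_homeos_def)
      have "?\<alpha> \<in> Bij D" using h(1) by (simp add: Bij_def cstar_automorphism_def homeo_aut_def)
      then have \<alpha>: "?\<alpha> \<in> carrier G" using h f(1) by (auto simp: G_carrier_iff)
      have \<psi>_in: "\<psi> x \<in> Sig n" if "x \<in> Sig n" for x
        using \<psi>(1) that Bij_imp_funcset by (auto simp: shift_Aut_iff)
      have "two_sided ?\<alpha> = shift_pow n j \<otimes>\<^bsub>?K\<^esub> \<psi>"
        unfolding two_sided_eq[OF h(1) f(1) h(2)] shift_Aut_mult[OF shift_pow_in \<psi>(1)]
      proof
        fix x show "bar f x = compose (Sig n) (shift_pow n j) \<psi> x"
          using f(2)[of x] \<psi>_in[of x] by (cases "x \<in> Sig n") (simp_all add: compose_def shift_pow_def bar_def)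
      qed
      then have "q ?\<alpha> = ?N #>\<^bsub>?K\<^esub> shift_pow n j #>\<^bsub>?K\<^esub> \<psi>"
        unfolding q_def using K.coset_mult_assoc[OF N.subset shift_pow_in \<psi>(1)] by simp
      also have "?N #>\<^bsub>?K\<^esub> shift_pow n j = ?N"
        using K.coset_join2[OF shift_pow_in N.subgroup_axioms] by (simp add: generate_shift)
      finally show "Y \<in> q ` carrier G" using \<alpha> \<psi>(2) by blast
    qed
    then have "q ` carrier G = carrier (?K Mod ?N)" using q by (auto simp: hom_in_carrier)
    from q.FactGroup_iso_set[OF this] show ?thesis unfolding ker is_iso_def by blast
  qed
qed

end

theorem theorem4p5:
  fixes n :: nat and S :: "nat \<Rightarrow> 'a::cstar_algebra"
  assumes "n \<ge> 2" and "is_cuntz_algebra n S"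
  shows "(\<exists>h. h \<in> mon (G_group n S Mod IG_subgroup n S)
                      (shift_Aut n Mod generate (shift_Aut n) {shift_map n})) \<and>
         (prime n \<longrightarrow>
            G_group n S Mod IG_subgroup n S \<cong>
            shift_Aut n Mod generate (shift_Aut n) {shift_map n})"
proof -
  interpret cuntz n S using assms by unfold_locales
  show ?thesis using embedding_and_iso by blast
qed

end
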